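(* Let $F$ be a distribution function on $\mathbb{R}^d$ with univariate margins $F_1,\dots,F_d$ and with copula $C$, i.e. $F(\boldsymbol{x})=C(F_1(x_1),\dots,F_d(x_d))$ for all $\boldsymbol{x}=(x_1,\dots,x_d)\in\mathbb{R}^d$. Suppose there is a $D$-norm $\|\cdot\|_D$ on $\mathbb{R}^d$ such that $$C(\boldsymbol{u})=1-\|\boldsymbol{1}-\boldsymbol{u}\|_D+o(\|\boldsymbol{1}-\boldsymbol{u}\|)\quad\text{as }\boldsymbol{u}\to\boldsymbol{1},\ \text{uniformly for }\boldsymbol{u}\in[0,1]^d .$$ For each $1\le i\le d$ put $\omega(F_i):=\sup\{x\in\mathbb{R}: F_i(x)<1\}\in(-\infty,\infty]$, suppose that the derivative $F_i'=f_i$ exists and is positive throughout some left neighborhood of $\omega(F_i)$, and suppose that $F_i$ satisfies one of the following three von Mises type conditions: (1) $\omega(F_i)\in(-\infty,\infty]$ and $\displaystyle\lim_{x\uparrow\omega(F_i)}\frac{f_i(x)\int_x^{\omega(F_i)}(1-F_i(t))\,dt}{(1-F_i(x))^2}=1$; (2) $\omega(F_i)=\infty$ and there exists $\alpha_i>0$ such that $\displaystyle\lim_{x\to\infty}\frac{x f_i(x)}{1-F_i(x)}=\alpha_i$; (3) $\omega(F_i)<\infty$ and there exists $\alpha_i>0$ such that $\displaystyle\lim_{x\uparrow\omega(F_i)}\frac{(\omega(F_i)-x)f_i(x)}{1-F_i(x)}=\alpha_i$. Let $\boldsymbol{X}^{(1)},\boldsymbol{X}^{(2)},\dots$ be independent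 random vectors with distribution function $F$. Let $\boldsymbol{k}=\boldsymbol{k}(n)=(k_1,\dots,k_d)\in\{1,\dots,n\}^d$, $n\in\mathbb{N}$, be such that, as $n\to\infty$, $k_i/k_j\to k_{ij}^2\in(0,\infty)$ (with $k_{ij}>0$) for all pairs $i,j=1,\dots,d$, $\|\boldsymbol{k}\|\to\infty$ and $\|\boldsymbol{k}\|/n\to 0$. Put $$b_{ni}:=F_i^{-1}\left(1-\frac{k_i}{n}\right),\qquad a_{ni}:=\frac{k_i^{1/2}}{n f_i(b_{ni})},\qquad 1\le i\le d$$ (well defined for $n$ large). Then for any sequences $c_{ni}>0$, $d_{ni}\in\mathbb{R}$, $1\le i\le d$, satisfying $$\lim_{n\to\infty}\frac{c_{ni}}{a_{ni}}=1\quad\text{and}\quad\lim_{n\to\infty}\frac{d_{ni}-b_{ni}}{a_{ni}}=0,\qquad 1\le i\le d,$$ the vector of intermediate multivariate order statistics satisfies $$\left(\frac{X_{n-k_i+1:n,i}-d_{ni}}{c_{ni}}\right)_{i=1}^d\to_D N(\boldsymbol{0},\Sigma)\qquad(n\to\infty),$$ where $\Sigma=(\sigma_{ij})$ is the $d\times d$ matrix with $$\sigma_{ij}=\begin{cases}1,&\text{if } i=j,\\ k_{ij}+k_{ji}-\|k_{ij}\boldsymbol{e}_i+k_{ji}\boldsymbol{e}_j\|_D,&\text{if } i\neq j.\end{cases}$$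
   Context: A copula on $\mathbb{R}^d$ is the distribution function of a random vector whose components are each uniformly distributed on $(0,1)$. A norm $\|\cdot\|_D$ on $\mathbb{R}^d$ is called a $D$-norm if there exists a random vector $\boldsymbol{Z}=(Z_1,\dots,Z_d)$ with $Z_i\ge 0$ and $E(Z_i)=1$, $1\le i\le d$, such that $\|\boldsymbol{x}\|_D=E\left(\max_{1\le i\le d}|x_i|Z_i\right)$ for all $\boldsymbol{x}\in\mathbb{R}^d$. (The stated expansion of $C$ is equivalent to $C$ being in the max-domain of attraction of the nondegenerate multivariate extreme value distribution $G(\boldsymbol{x})=\exp(-\|\boldsymbol{x}\|_D)$, $\boldsymbol{x}\le\boldsymbol{0}$.) Here $\|\cdot\|$ is an arbitrary fixed norm on $\mathbb{R}^d$, $\boldsymbol{1}=(1,\dots,1)\in\mathbb{R}^d$, and $\boldsymbol{e}_j$ is the $j$-th unit vector of $\mathbb{R}^d$. The generalized inverse of $F_i$ is $F_i^{-1}(u):=\inf\{t\in\mathbb{R}: F_i(t)\ge u\}$, $u\in(0,1)$. For a sample $\boldsymbol{X}^{(j)}=(X_1^{(j)},\dots,X_d^{(j)})$, $j=1,\dots,n$, the ordered values of the $i$-th components $X_i^{(1)},\dots,X_i^{(n)}$ are denoted $X_{1:n,i}\le X_{2:n,i}\le\dots\le X_{n:n,i}$, $1\le i\le d$. The symbol $\to_D$ denotes convergence in distribution, and $N(\boldsymbol{0},\Sigma)$ is the $d$-variate normal distribution with mean $\boldsymbol{0}$ and covariance matrix $\Sigma$. *)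

theory Defs
  imports "HOL-Probability.Probability" "HOL-Library.Landau_Symbols"
begin

definition has_dist_fun :: "'a measure \<Rightarrow> ('a \<Rightarrow> real ^ 'd) \<Rightarrow> (real ^ 'd \<Rightarrow> real) \<Rightarrow> bool" where
  "has_dist_fun M X F \<longleftrightarrow>
     X \<in> borel_measurable M \<and> (\<forall>x. F x = measure M {\<omega> \<in> space M. \<forall>i. X \<omega> $ i \<le> x $ i})"

text \<open>In the next definitions the existentially quantified random vector lives on a probability
  space over the type \<^typ>\<open>real ^ 'd\<close>. This is no restriction: every random vector has the same
  law as the identity map on that type, equipped with this law.\<close>

definition dist_fun :: "(real ^ 'd \<Rightarrow> real) \<Rightarrow> bool" where
  "dist_fun F \<longleftrightarrow>
     (\<exists>(M :: (real ^ 'd) measure) X. prob_space M \<and> has_dist_fun M X F)"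

definition copula :: "(real ^ 'd \<Rightarrow> real) \<Rightarrow> bool" where
  "copula C \<longleftrightarrow>
     (\<exists>(M :: (real ^ 'd) measure) U. prob_space M \<and> has_dist_fun M U C \<and>
        (\<forall>i. distr M borel (\<lambda>\<omega>. U \<omega> $ i) = uniform_measure lborel {0<..<1}))"

definition margin :: "(real ^ 'd \<Rightarrow> real) \<Rightarrow> 'd \<Rightarrow> real \<Rightarrow> real" where
  "margin F i t = Lim at_top (\<lambda>s. F (\<chi> j. if j = i then t else s))"

definition is_norm :: "('v :: real_vector \<Rightarrow> real) \<Rightarrow> bool" where
  "is_norm N \<longleftrightarrow> (\<forall>x. 0 \<le> N x) \<and> (\<forall>x. N x = 0 \<longleftrightarrow> x = 0) \<and>
     (\<forall>r x. N (r *\<^sub>R x) = \<bar>r\<bar> * N x) \<and> (\<forall>x y. N (x + y) \<le> N x + N y)"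

definition D_norm :: "(real ^ 'd \<Rightarrow> real) \<Rightarrow> bool" where
  "D_norm N \<longleftrightarrow> is_norm N \<and>
     (\<exists>(M :: (real ^ 'd) measure) Z. prob_space M \<and> Z \<in> borel_measurable M \<and>
        (\<forall>\<omega>\<in>space M. \<forall>i. 0 \<le> Z \<omega> $ i) \<and>
        (\<forall>i. has_bochner_integral M (\<lambda>\<omega>. Z \<omega> $ i) 1) \<and>
        (\<forall>x. N x = (\<integral>\<omega>. Max (range (\<lambda>i. \<bar>x $ i\<bar> * Z \<omega> $ i)) \<partial>M)))"

definition right_endpoint :: "(real \<Rightarrow> real) \<Rightarrow> ereal" where
  "right_endpoint G = Sup (ereal ` {x. G x < 1})"

text \<open>The filter \<open>x \<up> w\<close> on the reals, for an endpoint \<open>w \<in> (-\<infinity>, \<infinity>]\<close>.\<close>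

definition up_to :: "ereal \<Rightarrow> real filter" where
  "up_to w = (if w = \<infinity> then at_top else at_left (real_of_ereal w))"

definition gen_inv :: "(real \<Rightarrow> real) \<Rightarrow> real \<Rightarrow> real" where
  "gen_inv G u = Inf {t. u \<le> G t}"

text \<open>Here \<open>g\<close> is the density of \<open>G\<close> near its right endpoint. If the integral in the first
  condition diverges, its value in HOL is 0, so that the limit cannot be 1 and the condition fails.\<close>

definition von_mises_1 :: "(real \<Rightarrow> real) \<Rightarrow> (real \<Rightarrow> real) \<Rightarrow> bool" where
  "von_mises_1 G g \<longleftrightarrow>
     ((\<lambda>x. g x * (LBINT t=ereal x..right_endpoint G. 1 - G t) / (1 - G x)\<^sup>2) \<longlongrightarrow> 1)
       (up_to (right_endpoint G))"

definition von_mises_2 :: "(real \<Rightarrow> real) \<Rightarrow> (real \<Rightarrow> real) \<Rightarrow> bool" where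
  "von_mises_2 G g \<longleftrightarrow> right_endpoint G = \<infinity> \<and>
     (\<exists>\<alpha>>0. ((\<lambda>x. x * g x / (1 - G x)) \<longlongrightarrow> \<alpha>) at_top)"

definition von_mises_3 :: "(real \<Rightarrow> real) \<Rightarrow> (real \<Rightarrow> real) \<Rightarrow> bool" where
  "von_mises_3 G g \<longleftrightarrow> right_endpoint G < \<infinity> \<and>
     (\<exists>\<alpha>>0. ((\<lambda>x. (real_of_ereal (right_endpoint G) - x) * g x / (1 - G x)) \<longlongrightarrow> \<alpha>)
              (up_to (right_endpoint G)))"

text \<open>\<open>order_stat n m x\<close> is the \<open>m\<close>-th smallest (counting from 1) of \<open>x 1, \<dots>, x n\<close>.\<close>

definition order_stat :: "nat \<Rightarrow> nat \<Rightarrow> (nat \<Rightarrow> real) \<Rightarrow> real" where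
  "order_stat n m x = sort (map x [1..<Suc n]) ! (m - 1)"

text \<open>The covariance matrix may be singular, so the normal law is defined through its
  one-dimensional projections, where a normal law of variance 0 is a point mass.\<close>

definition normal_law :: "real \<Rightarrow> real \<Rightarrow> real measure" where
  "normal_law m v =
     (if v = 0 then return borel m else density lborel (\<lambda>x. ennreal (normal_density m (sqrt v) x)))"

definition mv_normal :: "(real ^ 'd) measure \<Rightarrow> real ^ 'd \<Rightarrow> real ^ 'd ^ 'd \<Rightarrow> bool" where
  "mv_normal \<mu> m S \<longleftrightarrow> prob_space \<mu> \<and> sets \<mu> = sets borel \<and> transpose S = S \<and>
     (\<forall>t. 0 \<le> t \<bullet> (S *v t) \<and>
          distr \<mu> borel (\<lambda>x. t \<bullet> x) = normal_law (t \<bullet> m) (t \<bullet> (S *v t)))"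

definition conv_in_dist ::
    "'a measure \<Rightarrow> (nat \<Rightarrow> 'a \<Rightarrow> 'b :: euclidean_space) \<Rightarrow> 'b measure \<Rightarrow> bool" where
  "conv_in_dist M Y \<mu> \<longleftrightarrow> (\<forall>n. Y n \<in> borel_measurable M) \<and>
     (\<forall>g :: 'b \<Rightarrow> real. continuous_on UNIV g \<longrightarrow> bounded (range g) \<longrightarrow>
        (\<lambda>n. \<integral>\<omega>. g (Y n \<omega>) \<partial>M) \<longlonglongrightarrow> (\<integral>x. g x \<partial>\<mu>))"

end

theory Submission
  imports Defs
begin

text \<open>
An intermediate order statistic is at most a level if and only if fewer than k observations exceed that
level. So the theorem is a central limit theorem for numbers of exceedances, and it has four
ingredients.

The margins. The three von Mises conditions all say that (1 - F) / f is asymptotically equivalent to a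
function that is Lipschitz near the right endpoint (tail_scale). Therefore f is asymptotically
constant on the scale of the normalizing constants, and the expected number of exceedances of
d + c s among n observations is k - s sqrt k + o(sqrt k) (exceedance_expansion).

The reduction to a fixed level. Passing from the level d + c s to the level d changes the number of
exceedances by its expected change s sqrt k and by a random error whose variance is of order sqrt k
only. Hence each normalized order statistic differs from the normalized number W of exceedances of the
level d by an error that vanishes in probability (scaled_order_stat_near_count_dev).

The covariances. The covariance of two components of W is, up to vanishing terms,
n P(both levels are exceeded) / sqrt (k i k j). By inclusion and exclusion the expansion of the copula
determines that probability, and the homogeneity of the D-norm gives the limit
\<kappa> i j + \<kappa> j i - Dn (\<kappa> i j e i + \<kappa> j i e j) (copula_expansion_tendsto).

The central limit theorem. Each projection of W is a sum of independent, uniformly small, centered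
summands, whose characteristic function converges to the one of the normal law
(iexp_row_sum_tendsto). The normal law exists because the limiting covariance matrix is positive
semidefinite and hence of the form A times the transpose of A (mv_normal_exists). Convergence of the
characteristic functions together with tightness gives convergence in distribution, because
trigonometric polynomials approximate continuous functions on balls; this step tolerates the error
between the order statistics and W (conv_in_dist_if_iexp_tendsto).
\<close>

section \<open>The von Mises conditions and the tail of a margin\<close>

lemma eventually_up_to:
  assumes "w \<noteq> -\<infinity>"
  shows "eventually P (up_to w) \<longleftrightarrow> (\<exists>z. ereal z < w \<and> (\<forall>x. z < x \<and> ereal x < w \<longrightarrow> P x))"
proof (cases w)
  case (real r)
  then show ?thesis
    by (auto simp: up_to_def eventually_at_left_field)
next
  case PInf
  then show ?thesis
    by (auto simp: up_to_def eventually_at_top_dense)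
qed (use assms in auto)

lemma filterlim_up_to:
  assumes "w \<noteq> -\<infinity>"
  shows "filterlim b (up_to w) F \<longleftrightarrow> 
    (\<forall>z. ereal z < w \<longrightarrow> (\<forall>\<^sub>F n in F. z < b n \<and> ereal (b n) < w))"
proof safe
  fix z assume "filterlim b (up_to w) F" "ereal z < w"
  moreover have "\<forall>\<^sub>F x in up_to w. z < x \<and> ereal x < w"
    using \<open>ereal z < w\<close> assms by (auto simp: eventually_up_to)
  ultimately show "\<forall>\<^sub>F n in F. z < b n \<and> ereal (b n) < w"
    unfolding filterlim_iff by blast
next
  assume *: "\<forall>z. ereal z < w \<longrightarrow> (\<forall>\<^sub>F n in F. z < b n \<and> ereal (b n) < w)"
  show "filterlim b (up_to w) F"
    unfolding filterlim_iff
  proof safe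
    fix P assume "eventually P (up_to w)"
    then obtain z where z: "ereal z < w" "\<forall>x. z < x \<and> ereal x < w \<longrightarrow> P x"
      using assms by (auto simp: eventually_up_to)
    show "\<forall>\<^sub>F n in F. P (b n)"
      using *[rule_format, OF z(1)] by eventually_elim (use z(2) in auto)
  qed
qed

locale smooth_tail =
  fixes G g :: "real \<Rightarrow> real" and \<omega> :: ereal and x0 :: real
  defines "\<omega> \<equiv> right_endpoint G"
  assumes mono_G: "mono G"
    and G_lim: "(G \<longlongrightarrow> 1) at_top"
    and x0: "ereal x0 < \<omega>"
    and deriv: "\<And>x. x0 < x \<Longrightarrow> ereal x < \<omega> \<Longrightarrow> (G has_real_derivative g x) (at x)"
    and g_pos: "\<And>x. x0 < x \<Longrightarrow> ereal x < \<omega> \<Longrightarrow> 0 < g x"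
begin

lemma omega_not_MInf: "\<omega> \<noteq> -\<infinity>"
  using x0 by auto

lemmas eventually_tail = eventually_up_to[OF omega_not_MInf]
lemmas filterlim_tail = filterlim_up_to[OF omega_not_MInf]

lemma eventually_gt: "ereal z < \<omega> \<Longrightarrow> \<forall>\<^sub>F x in up_to \<omega>. z < x \<and> ereal x < \<omega>"
  using eventually_tail by auto

lemma ereal_less_if_le: "ereal y < \<omega> \<Longrightarrow> x \<le> y \<Longrightarrow> ereal x < \<omega>"
  by (meson ereal_less_eq(3) le_less_trans)

lemma G_less_1: "ereal x < \<omega> \<Longrightarrow> G x < 1"
proof -
  assume "ereal x < \<omega>"
  then obtain y where "x < y" "G y < 1"
    unfolding \<omega>_def right_endpoint_def less_Sup_iff by auto
  then show ?thesis
    using monoD[OF mono_G, of x y] by linarith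
qed

lemma G_less:
  assumes "x0 < x" "x < y" "ereal y < \<omega>"
  shows "G x < G y"
proof (rule DERIV_pos_imp_increasing[OF assms(2)])
  fix t assume "x \<le> t" "t \<le> y"
  with assms ereal_less_if_le[OF assms(3), of t] show "\<exists>D. (G has_real_derivative D) (at t) \<and> 0 < D"
    using deriv[of t] g_pos[of t] by auto
qed

text \<open>What the three von Mises conditions have in common: up to asymptotic equivalence, the reciprocal
hazard rate (1 - G) / g is a scale A that is Lipschitz near the endpoint. The Lipschitz bound makes A
asymptotically constant on intervals of length o(A), and the third clause keeps displacements by a
small multiple of A inside every prescribed left neighborhood of the endpoint.\<close>

definition tail_scale :: "(real \<Rightarrow> real) \<Rightarrow> bool" where
  "tail_scale A \<longleftrightarrow>
     (\<forall>\<^sub>F x in up_to \<omega>. 0 < A x) \<and>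
     (\<exists>K z. ereal z < \<omega> \<and> (\<forall>x y. z < x \<and> x < y \<and> ereal y < \<omega> \<longrightarrow> \<bar>A y - A x\<bar> \<le> K * (y - x))) \<and>
     (\<exists>\<delta>>0. \<forall>z. ereal z < \<omega> \<longrightarrow>
        (\<forall>\<^sub>F x in up_to \<omega>. z < x - \<delta> * A x \<and> ereal (x + \<delta> * A x) < \<omega>)) \<and>
     ((\<lambda>x. A x * g x / (1 - G x)) \<longlongrightarrow> 1) (up_to \<omega>)"

lemma tail_scale_von_mises_2:
  assumes "von_mises_2 G g"
  shows "\<exists>A. tail_scale A"
proof -
  from assms obtain \<alpha> where \<omega>: "\<omega> = \<infinity>" and \<alpha>: "\<alpha> > 0"
    and lim: "((\<lambda>x. x * g x / (1 - G x)) \<longlongrightarrow> \<alpha>) at_top"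
    unfolding von_mises_2_def \<omega>_def by auto
  have "tail_scale (\<lambda>x. x / \<alpha>)"
    unfolding tail_scale_def
  proof (intro conjI)
    show "\<forall>\<^sub>F x in up_to \<omega>. 0 < x / \<alpha>"
      using \<alpha> eventually_gt[of 0] \<omega> by (auto elim: eventually_mono)
    show "\<exists>K z. ereal z < \<omega> \<and> (\<forall>x y. z < x \<and> x < y \<and> ereal y < \<omega> \<longrightarrow> \<bar>y / \<alpha> - x / \<alpha>\<bar> \<le> K * (y - x))"
      using \<alpha> \<omega> by (intro exI[of _ "1 / \<alpha>"] exI[of _ 0]) (auto simp: field_simps)
    show "\<exists>\<delta>>0. \<forall>z. ereal z < \<omega> \<longrightarrow>
        (\<forall>\<^sub>F x in up_to \<omega>. z < x - \<delta> * (x / \<alpha>) \<and> ereal (x + \<delta> * (x / \<alpha>)) < \<omega>)"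
    proof (intro exI[of _ "\<alpha> / 2"] conjI allI impI)
      fix z :: real
      show "\<forall>\<^sub>F x in up_to \<omega>. z < x - \<alpha> / 2 * (x / \<alpha>) \<and> ereal (x + \<alpha> / 2 * (x / \<alpha>)) < \<omega>"
        using eventually_gt[of "2 * z"] \<alpha> \<omega> by (auto elim!: eventually_mono)
    qed (use \<alpha> in auto)
    show "((\<lambda>x. x / \<alpha> * g x / (1 - G x)) \<longlongrightarrow> 1) (up_to \<omega>)"
      using tendsto_divide[OF lim tendsto_const[of \<alpha>]] \<alpha> \<omega>
      by (simp add: up_to_def field_simps)
  qed
  then show ?thesis by blast
qed

lemma tail_scale_von_mises_3:
  assumes "von_mises_3 G g"
  shows "\<exists>A. tail_scale A"
proof -
  from assms obtain \<alpha> where "\<omega> < \<infinity>" and \<alpha>: "\<alpha> > 0"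
    and lim: "((\<lambda>x. (real_of_ereal \<omega> - x) * g x / (1 - G x)) \<longlongrightarrow> \<alpha>) (up_to \<omega>)"
    unfolding von_mises_3_def \<omega>_def by auto
  then obtain w where w: "\<omega> = ereal w"
    using x0 by (cases \<omega>) auto
  have "tail_scale (\<lambda>x. (w - x) / \<alpha>)"
    unfolding tail_scale_def
  proof (intro conjI)
    show "\<forall>\<^sub>F x in up_to \<omega>. 0 < (w - x) / \<alpha>"
      using \<alpha> eventually_gt[OF x0] w by (auto elim: eventually_mono)
    show "\<exists>K z. ereal z < \<omega> \<and> (\<forall>x y. z < x \<and> x < y \<and> ereal y < \<omega> \<longrightarrow> 
        \<bar>(w - y) / \<alpha> - (w - x) / \<alpha>\<bar> \<le> K * (y - x))"
      using \<alpha> x0 by (intro exI[of _ "1 / \<alpha>"] exI[of _ x0]) (auto simp: field_simps)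
    show "\<exists>\<delta>>0. \<forall>z. ereal z < \<omega> \<longrightarrow>
        (\<forall>\<^sub>F x in up_to \<omega>. z < x - \<delta> * ((w - x) / \<alpha>) \<and> ereal (x + \<delta> * ((w - x) / \<alpha>)) < \<omega>)"
    proof (intro exI[of _ "\<alpha> / 2"] conjI allI impI)
      fix z :: real assume z: "ereal z < \<omega>"
      then have "z < w" using w by simp
      then show "\<forall>\<^sub>F x in up_to \<omega>. z < x - \<alpha> / 2 * ((w - x) / \<alpha>) \<and> ereal (x + \<alpha> / 2 * ((w - x) / \<alpha>)) < \<omega>"
        using eventually_gt[of "(w + z) / 2"] \<alpha> w 
        by (simp, elim eventually_mono) (use \<open>z < w\<close> in \<open>simp add: field_simps\<close>)
    qed (use \<alpha> in auto)
    show "((\<lambda>x. (w - x) / \<alpha> * g x / (1 - G x)) \<longlongrightarrow> 1) (up_to \<omega>)"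
      using tendsto_divide[OF lim tendsto_const[of \<alpha>]] \<alpha> w
      by (simp add: field_simps)
  qed
  then show ?thesis by blast
qed

text \<open>Here the scale A is the mean excess function J / (1 - G). Its derivative g J / (1 - G)^2 - 1 tends
to 0 by hypothesis, so A is Lipschitz with constant 1/2. If the endpoint is infinite, this bounds
A (x) by x / 2 + O(1); if it is a real number w, then A (x) \<le> w - x because 1 - G decreases. In both
cases a displacement by A / 2 stays near the endpoint.\<close>

lemma tail_scale_von_mises_1:
  assumes "von_mises_1 G g"
  shows "\<exists>A. tail_scale A"
proof -
  define J where "J x = (LBINT t=ereal x..\<omega>. 1 - G t)" for x
  have lim: "((\<lambda>x. g x * J x / (1 - G x)\<^sup>2) \<longlongrightarrow> 1) (up_to \<omega>)"
    using assms unfolding von_mises_1_def J_def \<omega>_def by simp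
  have "\<forall>\<^sub>F x in up_to \<omega>. 1/2 < g x * J x / (1 - G x)\<^sup>2" "\<forall>\<^sub>F x in up_to \<omega>. g x * J x / (1 - G x)\<^sup>2 < 3/2"
    by (rule order_tendstoD[OF lim], simp)+
  then have "\<forall>\<^sub>F x in up_to \<omega>. x0 < x \<and> ereal x < \<omega> \<and> 1/2 < g x * J x / (1 - G x)\<^sup>2 \<and> g x * J x / (1 - G x)\<^sup>2 < 3/2"
    using eventually_gt[OF x0] by eventually_elim auto
  then obtain z0 where z0: "ereal z0 < \<omega>"
    and z0P: "\<And>x. z0 < x \<Longrightarrow> ereal x < \<omega> \<Longrightarrow> x0 < x \<and> 1/2 < g x * J x / (1 - G x)\<^sup>2 \<and> g x * J x / (1 - G x)\<^sup>2 < 3/2"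
    unfolding eventually_tail by auto
  have cont: "continuous_on {a..b} (\<lambda>t. 1 - G t)" if "x0 < a" "ereal b < \<omega>" for a b
  proof (intro continuous_intros continuous_at_imp_continuous_on ballI)
    fix x assume "x \<in> {a..b}"
    then show "isCont G x"
      using deriv[of x] that ereal_less_if_le[of b x] by (auto intro: DERIV_isCont)
  qed
  have G1: "G x < 1" if "ereal x < \<omega>" for x using G_less_1[OF that] .
  have Jpos: "0 < J x" if "z0 < x" "ereal x < \<omega>" for x
  proof -
    have "0 < g x * J x / (1 - G x)\<^sup>2" using z0P[OF that] by linarith
    then show ?thesis
      using z0P[OF that] g_pos[of x] that G1[of x] by (auto simp: zero_less_divide_iff zero_less_mult_iff)
  qed
  have int: "set_integrable lborel (einterval (ereal x) \<omega>) (\<lambda>t. 1 - G t)" if "z0 < x" "ereal x < \<omega>" for x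
  proof (rule ccontr)
    assume "\<not> ?thesis"
    \<comment> \<open>A divergent integral has the value 0, which is incompatible with the limit 1.\<close>
    then have "J x = 0"
      using that unfolding J_def interval_lebesgue_integral_def set_lebesgue_integral_def set_integrable_def
      by (simp add: not_integrable_integral_eq)
    with Jpos[OF that] show False by simp
  qed
  have split: "J y = J x - (LBINT t=ereal x..ereal y. 1 - G t)" if "z0 < x" "x \<le> y" "ereal y < \<omega>" for x y
  proof -
    have x: "ereal x < \<omega>" using that ereal_less_if_le by blast
    have "interval_lebesgue_integrable lborel (min (ereal x) (min (ereal y) \<omega>)) (max (ereal x) (max (ereal y) \<omega>)) (\<lambda>t. 1 - G t)"
      using int[OF that(1) x] that x
      by (simp add: interval_lebesgue_integrable_def min_def max_def)
    from interval_integral_sum[OF this] show ?thesis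
      unfolding J_def by simp
  qed
  have Jder: "(J has_real_derivative - (1 - G x)) (at x)" if x: "z0 < x" "ereal x < \<omega>" for x
  proof -
    obtain y where y: "x < y" "ereal y < \<omega>"
      using ereal_dense2[OF x(2)] by (metis ereal_less_ereal_Ex less_ereal.simps(1) x(2) ereal_dense2)
    define a where "a = (z0 + x) / 2"
    have a: "z0 < a" "a < x" using x unfolding a_def by auto
    have xa: "x0 < a" using z0P[of a] a ereal_less_if_le[OF x(2), of a] by auto
    have "((\<lambda>u. LBINT t=a..u. 1 - G t) has_vector_derivative (1 - G x)) (at x within {a..y})"
      by (rule interval_integral_FTC2) (use a y cont[OF xa y(2)] in auto)
    then have "((\<lambda>u. LBINT t=a..u. 1 - G t) has_real_derivative (1 - G x)) (at x)"
      using a y by (simp add: has_real_derivative_iff_has_vector_derivative at_within_Icc_at)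
    then have "((\<lambda>u. J a - (LBINT t=a..u. 1 - G t)) has_real_derivative - (1 - G x)) (at x)"
      by (auto intro!: derivative_eq_intros)
    moreover have "\<forall>\<^sub>F u in nhds x. J a - (LBINT t=a..u. 1 - G t) = J u"
    proof -
      have "\<forall>\<^sub>F u in nhds x. u \<in> {a<..<y}"
        using a y by (intro eventually_nhds_in_open) auto
      then show ?thesis
      proof eventually_elim
        case (elim u)
        then show ?case using split[OF a(1), of u] ereal_less_if_le[OF y(2), of u] by auto
      qed
    qed
    ultimately show ?thesis
      by (simp add: DERIV_cong_ev)
  qed
  define A where "A x = J x / (1 - G x)" for x
  have Apos: "0 < A x" if "z0 < x" "ereal x < \<omega>" for x
    using Jpos[OF that] G1[OF that(2)] by (simp add: A_def)
  have Ader: "(A has_real_derivative g x * J x / (1 - G x)\<^sup>2 - 1) (at x)" if "z0 < x" "ereal x < \<omega>" for x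
  proof -
    have "(A has_real_derivative (- (1 - G x) * (1 - G x) - J x * (0 - g x)) / ((1 - G x) * (1 - G x))) (at x)"
      unfolding A_def using Jder[OF that] deriv[of x] z0P[OF that] that G1[of x]
      by (intro DERIV_divide DERIV_diff DERIV_const) auto
    also have "(- (1 - G x) * (1 - G x) - J x * (0 - g x)) / ((1 - G x) * (1 - G x)) = g x * J x / (1 - G x)\<^sup>2 - 1"
      using G1[OF that(2)] by (simp add: divide_simps power2_eq_square) algebra
    finally show ?thesis .
  qed
  have Lip: "\<bar>A y - A x\<bar> \<le> (1/2) * (y - x)" if xy: "z0 < x" "x < y" "ereal y < \<omega>" for x y
  proof -
    have "\<exists>\<xi>>x. \<xi> < y \<and> A y - A x = (y - x) * (g \<xi> * J \<xi> / (1 - G \<xi>)\<^sup>2 - 1)"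
      using xy by (intro MVT2) (auto intro!: Ader intro: ereal_less_if_le)
    then obtain \<xi> where \<xi>: "x < \<xi>" "\<xi> < y" "A y - A x = (y - x) * (g \<xi> * J \<xi> / (1 - G \<xi>)\<^sup>2 - 1)"
      by auto
    have "\<bar>g \<xi> * J \<xi> / (1 - G \<xi>)\<^sup>2 - 1\<bar> \<le> 1/2"
    proof -
      have "1/2 < g \<xi> * J \<xi> / (1 - G \<xi>)\<^sup>2" "g \<xi> * J \<xi> / (1 - G \<xi>)\<^sup>2 < 3/2"
        using z0P[of \<xi>] \<xi> xy ereal_less_if_le[of y \<xi>] by auto
      then show ?thesis by linarith
    qed
    then have "(y - x) * \<bar>g \<xi> * J \<xi> / (1 - G \<xi>)\<^sup>2 - 1\<bar> \<le> (y - x) * (1/2)"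
      using xy by (intro mult_left_mono) auto
    then show ?thesis
      using \<xi>(3) xy by (simp add: abs_mult)
  qed
  have dom: "\<forall>\<^sub>F x in up_to \<omega>. z < x - 1/2 * A x \<and> ereal (x + 1/2 * A x) < \<omega>" if z: "ereal z < \<omega>" for z
  proof (cases \<omega>)
    case PInf
    define x1 where "x1 = z0 + 1"
    have "z < x - 1/2 * A x" if "max x1 (2 * z + A x1 - x1) < x" for x
    proof -
      have "A x \<le> A x1 + 1/2 * (x - x1)"
      proof -
        have "A x - A x1 \<le> 1/2 * (x - x1)"
          by (rule abs_le_D1, rule Lip) (use that PInf in \<open>auto simp: x1_def\<close>)
        then show ?thesis by linarith
      qed
      moreover have "x1 < x" "2 * z + A x1 - x1 < x" using that by auto
      ultimately show ?thesis by (simp add: field_simps)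
    qed
    then have "\<exists>N. \<forall>x>N. z < x - 1/2 * A x" by blast
    then show ?thesis
      using PInf by (simp add: up_to_def eventually_at_top_dense)
  next
    case (real w)
    have le: "A x \<le> w - x" if x: "z0 < x" "ereal x < \<omega>" for x
    proof -
      have const: "set_integrable lborel (einterval (ereal x) \<omega>) (\<lambda>t. 1 - G x)"
        unfolding real set_integrable_def by (rule integrable_scaleR_left, rule integrable_real_indicator)
          (use x real in simp_all)
      have "J x = (LBINT t:einterval (ereal x) \<omega>. 1 - G t)"
        using x unfolding J_def interval_lebesgue_integral_def by (simp only: if_P less_imp_le)
      also have "\<dots> \<le> (LBINT t:einterval (ereal x) \<omega>. 1 - G x)"
        using int[OF x] real
        by (intro set_integral_mono const) (auto simp: einterval_iff intro!: monoD[OF mono_G])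
      also have "\<dots> = (1 - G x) * (w - x)"
        using real x by (simp add: set_lebesgue_integral_def)
      finally show ?thesis
        using G1[OF x(2)] by (simp add: A_def field_simps)
    qed
    have "ereal (max z0 ((w + z) / 2)) < \<omega>"
      using z z0 real by (auto simp: max_def)
    from eventually_gt[OF this] show ?thesis
    proof eventually_elim
      case (elim x)
      then have "A x \<le> w - x" "0 < A x" using le[of x] Apos[of x] by auto
      then show ?case using elim real by (auto simp: field_simps)
    qed
  qed (use omega_not_MInf in auto)
  have "tail_scale A"
    unfolding tail_scale_def
  proof (intro conjI)
    show "\<forall>\<^sub>F x in up_to \<omega>. 0 < A x"
      using eventually_gt[OF z0] by eventually_elim (auto intro: Apos)
    show "\<exists>K z. ereal z < \<omega> \<and> (\<forall>x y. z < x \<and> x < y \<and> ereal y < \<omega> \<longrightarrow> \<bar>A y - A x\<bar> \<le> K * (y - x))"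
      using Lip z0 by blast
    show "\<exists>\<delta>>0. \<forall>z. ereal z < \<omega> \<longrightarrow>
        (\<forall>\<^sub>F x in up_to \<omega>. z < x - \<delta> * A x \<and> ereal (x + \<delta> * A x) < \<omega>)"
      using dom by (intro exI[of _ "1/2"]) auto
    show "((\<lambda>x. A x * g x / (1 - G x)) \<longlongrightarrow> 1) (up_to \<omega>)"
      using lim by (simp add: A_def power2_eq_square mult.commute)
  qed
  then show ?thesis by blast
qed


text \<open>The density is asymptotically constant under displacements that are small compared with
(1 - G) / g. Indeed g = r (1 - G) / A with r
tending to 1, so three ratios are to be controlled: the one of r by the convergence of r, the one
of A by the Lipschitz bound, and the one of 1 - G because the derivative - r / A of ln (1 - G) is
bounded by 4 / A (b n) between b n and the displaced point.\<close>

lemma density_ratio_tendsto: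
  fixes b \<delta> \<xi> :: "nat \<Rightarrow> real"
  assumes A: "tail_scale A"
    and b: "filterlim b (up_to \<omega>) sequentially"
    and \<delta>: "\<delta> \<longlonglongrightarrow> 0"
    and \<xi>: "\<And>n. \<bar>\<xi> n - b n\<bar> \<le> \<bar>\<delta> n\<bar> * ((1 - G (b n)) / g (b n))"
  shows "filterlim \<xi> (up_to \<omega>) sequentially" and "(\<lambda>n. g (\<xi> n) / g (b n)) \<longlonglongrightarrow> 1"
proof -
  define r where "r x = A x * g x / (1 - G x)" for x
  define D where "D n = \<bar>\<delta> n / r (b n)\<bar>" for n
  from A have Apos: "\<forall>\<^sub>F x in up_to \<omega>. 0 < A x" and r: "(r \<longlongrightarrow> 1) (up_to \<omega>)"
    unfolding tail_scale_def r_def by auto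
  from A obtain K z where z: "ereal z < \<omega>" and 
    Lip: "\<And>x y. z < x \<Longrightarrow> x < y \<Longrightarrow> ereal y < \<omega> \<Longrightarrow> \<bar>A y - A x\<bar> \<le> K * (y - x)"
    unfolding tail_scale_def by blast
  from A obtain \<delta>0 where \<delta>0: "\<delta>0 > 0" and dom: "\<And>z. ereal z < \<omega> \<Longrightarrow> 
      \<forall>\<^sub>F x in up_to \<omega>. z < x - \<delta>0 * A x \<and> ereal (x + \<delta>0 * A x) < \<omega>"
    unfolding tail_scale_def by blast
  have rb: "(\<lambda>n. r (b n)) \<longlonglongrightarrow> 1"
    using filterlim_compose[OF r b] by simp
  have D0: "D \<longlonglongrightarrow> 0"
    unfolding D_def using tendsto_rabs[OF tendsto_divide[OF \<delta> rb]] by simp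
  have evb: "eventually P (up_to \<omega>) \<Longrightarrow> \<forall>\<^sub>F n in sequentially. P (b n)" for P
    using b by (simp add: filterlim_iff)
  \<comment> \<open>Displacements are henceforth measured in units of A instead of (1 - G) / g.\<close>
  have near: "\<forall>\<^sub>F n in sequentially. \<bar>\<xi> n - b n\<bar> \<le> D n * A (b n)"
    using evb[OF Apos] evb[OF eventually_gt[OF x0]] 
  proof eventually_elim
    case (elim n)
    then have "g (b n) > 0" "1 - G (b n) > 0" using g_pos G_less_1 by auto
    then have "\<bar>\<delta> n\<bar> * ((1 - G (b n)) / g (b n)) = D n * A (b n)"
      using elim by (simp add: D_def r_def abs_mult)
    then show ?case using \<xi>[of n] by simp
  qed
  have Dsmall: "\<forall>\<^sub>F n in sequentially. D n < e" if "e > 0" for e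
    using order_tendstoD(2)[OF D0 that] .
  have seg: "\<forall>\<^sub>F n in sequentially. \<forall>y. \<bar>y - b n\<bar> \<le> D n * A (b n) \<longrightarrow> u < y \<and> ereal y < \<omega>"
    if "ereal u < \<omega>" for u
    using evb[OF dom[OF that]] Dsmall[OF \<delta>0] evb[OF Apos]
  proof eventually_elim
    case (elim n)
    show ?case
    proof (intro allI impI)
      fix y assume y: "\<bar>y - b n\<bar> \<le> D n * A (b n)"
      also have "\<dots> \<le> \<delta>0 * A (b n)" using elim by (intro mult_right_mono) auto
      finally have "b n - \<delta>0 * A (b n) \<le> y" "y \<le> b n + \<delta>0 * A (b n)" by linarith+
      then show "u < y \<and> ereal y < \<omega>"
        using elim ereal_less_if_le[of "b n + \<delta>0 * A (b n)" y] by auto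
    qed
  qed
  show \<xi>lim: "filterlim \<xi> (up_to \<omega>) sequentially"
    unfolding filterlim_tail
  proof (intro allI impI)
    fix u assume "ereal u < \<omega>"
    from seg[OF this] near show "\<forall>\<^sub>F n in sequentially. u < \<xi> n \<and> ereal (\<xi> n) < \<omega>"
      by eventually_elim auto
  qed
  have r\<xi>: "(\<lambda>n. r (\<xi> n)) \<longlonglongrightarrow> 1"
    using filterlim_compose[OF r \<xi>lim] by simp
  have AL: "\<forall>\<^sub>F n in sequentially. \<forall>y. \<bar>y - b n\<bar> \<le> D n * A (b n) \<longrightarrow> \<bar>A y / A (b n) - 1\<bar> \<le> \<bar>K\<bar> * D n"
    using seg[OF z] evb[OF eventually_gt[OF z]] evb[OF Apos]
  proof eventually_elim
    case (elim n)
    show ?case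
    proof (intro allI impI)
      fix y assume y: "\<bar>y - b n\<bar> \<le> D n * A (b n)"
      have "\<bar>A y - A (b n)\<bar> \<le> K * \<bar>y - b n\<bar>"
        using Lip[of y "b n"] Lip[of "b n" y] elim y
        by (cases y "b n" rule: linorder_cases) (auto simp: abs_minus_commute)
      also have "\<dots> \<le> \<bar>K\<bar> * (D n * A (b n))"
        using y by (intro mult_mono) auto
      finally have "\<bar>A y - A (b n)\<bar> / A (b n) \<le> \<bar>K\<bar> * D n"
        using elim by (simp add: divide_le_eq ac_simps)
      also have "\<bar>A y - A (b n)\<bar> / A (b n) = \<bar>A y / A (b n) - 1\<bar>"
      proof -
        have "A y / A (b n) - 1 = (A y - A (b n)) / A (b n)"
          using elim(3) by (simp add: diff_divide_distrib)
        then show ?thesis using elim(3) by (simp add: abs_divide)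
      qed
      finally show "\<bar>A y / A (b n) - 1\<bar> \<le> \<bar>K\<bar> * D n" .
    qed
  qed
  have A\<xi>: "(\<lambda>n. A (\<xi> n) / A (b n)) \<longlonglongrightarrow> 1"
  proof (rule LIM_zero_cancel, rule Lim_null_comparison)
    show "\<forall>\<^sub>F n in sequentially. norm (A (\<xi> n) / A (b n) - 1) \<le> \<bar>K\<bar> * D n"
      using AL near by eventually_elim auto
    show "(\<lambda>n. \<bar>K\<bar> * D n) \<longlonglongrightarrow> 0"
      using tendsto_mult_right_zero[OF D0] by simp
  qed
  have r2: "\<forall>\<^sub>F x in up_to \<omega>. r x < 2 \<and> x0 < x \<and> ereal x < \<omega>"
  proof -
    have "(1::real) < 2" by simp
    from order_tendstoD(2)[OF r this] eventually_gt[OF x0]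
    show ?thesis by eventually_elim auto
  qed
  then obtain u where u: "ereal u < \<omega>" and uP: "\<And>x. u < x \<Longrightarrow> ereal x < \<omega> \<Longrightarrow> r x < 2 \<and> x0 < x"
    unfolding eventually_tail by blast
  have KD: "\<forall>\<^sub>F n in sequentially. \<bar>K\<bar> * D n < 1/2"
    using order_tendstoD(2)[OF tendsto_mult_right_zero[OF D0, of "\<bar>K\<bar>"], of "1/2"] by simp
  have "(\<lambda>n. ln (1 - G (\<xi> n)) - ln (1 - G (b n))) \<longlonglongrightarrow> 0"
  proof (rule Lim_null_comparison)
    show "(\<lambda>n. 4 * D n) \<longlonglongrightarrow> 0"
      using tendsto_mult_right_zero[OF D0] by simp
    show "\<forall>\<^sub>F n in sequentially. norm (ln (1 - G (\<xi> n)) - ln (1 - G (b n))) \<le> 4 * D n"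
      using near seg[OF u] AL KD evb[OF Apos]
    proof eventually_elim
      case (elim n)
      let ?S = "{y. \<bar>y - b n\<bar> \<le> D n * A (b n)}"
      have D: "0 \<le> D n * A (b n)" using elim(1) by linarith
      have S: "convex ?S"
      proof -
        have "?S = {b n - D n * A (b n) .. b n + D n * A (b n)}" by auto
        then show ?thesis by simp
      qed
      have der: "((\<lambda>x. ln (1 - G x)) has_field_derivative - (r y / A y)) (at y within ?S)" 
        and bnd: "norm (- (r y / A y)) \<le> 4 / A (b n)" if y: "y \<in> ?S" for y
      proof -
        have y': "u < y" "ereal y < \<omega>" "r y < 2" "x0 < y" using elim(2) uP y by auto
        have "\<bar>A y / A (b n) - 1\<bar> < 1/2" using elim(3,4) y by (force intro: le_less_trans)
        then have "1/2 < A y / A (b n)" by linarith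
        then have Ay: "A (b n) / 2 < A y" using elim(5) by (simp add: field_simps)
        have pos: "0 < g y" "0 < 1 - G y" using g_pos[of y] G_less_1[of y] y' by auto
        have "((\<lambda>x. ln (1 - G x)) has_field_derivative - (g y / (1 - G y))) (at y)"
          using deriv[OF y'(4,2)] pos by (auto intro!: derivative_eq_intros simp: field_simps)
        also have "g y / (1 - G y) = r y / A y"
          using Ay elim(5) by (simp add: r_def)
        finally show "((\<lambda>x. ln (1 - G x)) has_field_derivative - (r y / A y)) (at y within ?S)"
          by (rule has_field_derivative_at_within)
        have "0 \<le> r y" using pos Ay elim(5) by (simp add: r_def)
        then have "norm (- (r y / A y)) = r y / A y" using Ay elim(5) by simp
        also have "\<dots> \<le> 2 / (A (b n) / 2)" using y' Ay elim(5) \<open>0 \<le> r y\<close> by (intro frac_le) auto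
        finally show "norm (- (r y / A y)) \<le> 4 / A (b n)" by simp
      qed
      have "norm (ln (1 - G (\<xi> n)) - ln (1 - G (b n))) \<le> 4 / A (b n) * norm (\<xi> n - b n)"
        by (rule field_differentiable_bound[OF S der bnd]) (use elim(1) D in auto)
      also have "\<dots> \<le> 4 / A (b n) * (D n * A (b n))"
        using elim(1,5) by (intro mult_left_mono) auto
      finally show ?case using elim(5) by simp
    qed
  qed
  from tendsto_exp[OF this] have "(\<lambda>n. exp (ln (1 - G (\<xi> n)) - ln (1 - G (b n)))) \<longlonglongrightarrow> 1"
    by simp
  moreover have ev\<xi>: "\<forall>\<^sub>F n in sequentially. x0 < \<xi> n \<and> ereal (\<xi> n) < \<omega>"
    using \<xi>lim x0 unfolding filterlim_tail by blast
  have "\<forall>\<^sub>F n in sequentially. exp (ln (1 - G (\<xi> n)) - ln (1 - G (b n))) = (1 - G (\<xi> n)) / (1 - G (b n))"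
    using ev\<xi> evb[OF eventually_gt[OF x0]]
    by eventually_elim (use G_less_1 in \<open>simp add: exp_diff\<close>)
  ultimately have Gl: "(\<lambda>n. (1 - G (\<xi> n)) / (1 - G (b n))) \<longlonglongrightarrow> 1"
    by (rule Lim_transform_eventually)
  have "(\<lambda>n. r (\<xi> n) / r (b n) * ((1 - G (\<xi> n)) / (1 - G (b n))) / (A (\<xi> n) / A (b n))) \<longlonglongrightarrow> 1"
    using tendsto_divide[OF tendsto_mult[OF tendsto_divide[OF r\<xi> rb] Gl] A\<xi>] by simp
  moreover have "\<forall>\<^sub>F n in sequentially. r (\<xi> n) / r (b n) * ((1 - G (\<xi> n)) / (1 - G (b n))) / (A (\<xi> n) / A (b n)) = g (\<xi> n) / g (b n)"
  proof -
    have "\<forall>\<^sub>F n in sequentially. A (\<xi> n) > 0"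
      using Apos \<xi>lim unfolding filterlim_iff by blast
    with ev\<xi> evb[OF eventually_gt[OF x0]] evb[OF Apos] show ?thesis
    proof eventually_elim
      case (elim n)
      have cancel: "(A1 * g1 / P) / (A0 * g0 / Q) * (P / Q) / (A1 / A0) = g1 / g0"
        if "A1 \<noteq> 0" "A0 \<noteq> 0" "P \<noteq> 0" "Q \<noteq> 0" for A1 A0 g1 g0 P Q :: real
        using that by (simp add: field_simps)
      show ?case unfolding r_def
        by (rule cancel) (use elim G_less_1[of "b n"] G_less_1[of "\<xi> n"] in auto)
    qed
  qed
  ultimately show "(\<lambda>n. g (\<xi> n) / g (b n)) \<longlonglongrightarrow> 1"
    by (rule Lim_transform_eventually)
qed

text \<open>The mean value theorem turns the increment of G into a value of g at an intermediate point, which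
is asymptotically the value at b n.\<close>

lemma tail_expansion:
  fixes b \<delta> :: "nat \<Rightarrow> real"
  assumes A: "tail_scale A"
    and b: "filterlim b (up_to \<omega>) sequentially"
    and \<delta>: "\<delta> \<longlonglongrightarrow> 0"
  shows "\<exists>\<rho>. \<rho> \<longlonglongrightarrow> 1 \<and> (\<forall>\<^sub>F n in sequentially.
     G (b n + \<delta> n * ((1 - G (b n)) / g (b n))) - G (b n) = \<delta> n * \<rho> n * (1 - G (b n)))"
proof -
  define x where "x n = b n + \<delta> n * ((1 - G (b n)) / g (b n))" for n
  define good where "good n \<xi> \<longleftrightarrow> \<bar>\<xi> - b n\<bar> \<le> \<bar>x n - b n\<bar> \<and> G (x n) - G (b n) = (x n - b n) * g \<xi>" for n \<xi>
  define \<xi> where "\<xi> n = (if \<exists>\<xi>. good n \<xi> then SOME \<xi>. good n \<xi> else b n)" for n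
  have good: "good n (\<xi> n)" if "\<exists>\<xi>. good n \<xi>" for n
    using someI_ex[OF that] that unfolding \<xi>_def by simp
  have b': "\<forall>\<^sub>F n in sequentially. x0 < b n \<and> ereal (b n) < \<omega>"
    using b x0 unfolding filterlim_tail by blast
  have "\<exists>N. \<forall>n\<ge>N. x0 < b n \<and> ereal (b n) < \<omega>"
    using b' by (simp add: eventually_sequentially)
  then obtain N where N: "\<And>n. n \<ge> N \<Longrightarrow> x0 < b n \<and> ereal (b n) < \<omega>" by blast
  \<comment> \<open>Both sequences are shifted, since the bound on the displacement may fail for finitely many n.\<close>
  define b2 where "b2 n = b (n + N)" for n
  have b2: "filterlim b2 (up_to \<omega>) sequentially"
    unfolding b2_def by (rule filterlim_compose[OF b filterlim_add_const_nat_at_top])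
  have \<delta>2: "(\<lambda>n. \<delta> (n + N)) \<longlonglongrightarrow> 0"
    using \<delta> by (rule LIMSEQ_ignore_initial_segment)
  have h: "0 < (1 - G (b n)) / g (b n)" if "n \<ge> N" for n
    using N[OF that] G_less_1 g_pos by simp
  have x: "\<bar>x n - b n\<bar> = \<bar>\<delta> n\<bar> * ((1 - G (b n)) / g (b n))" if "n \<ge> N" for n
    by (simp only: x_def add_diff_cancel_left' abs_mult abs_of_pos[OF h[OF that]])
  have bound: "\<bar>\<xi> n - b n\<bar> \<le> \<bar>\<delta> n\<bar> * ((1 - G (b n)) / g (b n))" if "n \<ge> N" for n
  proof (cases "\<exists>\<xi>. good n \<xi>")
    case True
    from good[OF this] show ?thesis unfolding good_def x[OF that] by (rule conjunct1)
  next
    case False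
    then have "\<xi> n = b n" unfolding \<xi>_def by (rule if_not_P)
    then show ?thesis using mult_nonneg_nonneg[OF abs_ge_zero less_imp_le[OF h[OF that]], of "\<delta> n"] by simp
  qed
  have "(\<lambda>n. g (\<xi> (n + N)) / g (b2 n)) \<longlonglongrightarrow> 1"
    by (rule density_ratio_tendsto(2)[OF A b2 \<delta>2]) (unfold b2_def, rule bound, simp)
  then have \<rho>: "(\<lambda>n. g (\<xi> n) / g (b n)) \<longlonglongrightarrow> 1"
    unfolding b2_def by (rule LIMSEQ_offset[of "\<lambda>n. g (\<xi> n) / g (b n)" N])
  have "filterlim (\<lambda>n. x (n + N)) (up_to \<omega>) sequentially"
    by (rule density_ratio_tendsto(1)[OF A b2 \<delta>2]) (unfold b2_def, simp only: x le_add2)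
  then have "\<forall>\<^sub>F n in sequentially. x0 < x (n + N) \<and> ereal (x (n + N)) < \<omega>"
    using x0 unfolding filterlim_tail by blast
  then have x': "\<forall>\<^sub>F n in sequentially. x0 < x n \<and> ereal (x n) < \<omega>"
    by (rule eventually_sequentially_seg[THEN iffD1, of "\<lambda>n. x0 < x n \<and> ereal (x n) < \<omega>" N])
  have "\<forall>\<^sub>F n in sequentially. G (x n) - G (b n) = \<delta> n * (g (\<xi> n) / g (b n)) * (1 - G (b n))"
    using b' x'
  proof eventually_elim
    case (elim n)
    have ex: "\<exists>\<xi>. good n \<xi>"
    proof (cases "b n" "x n" rule: linorder_cases)
      case less
      have "\<exists>\<xi>>b n. \<xi> < x n \<and> G (x n) - G (b n) = (x n - b n) * g \<xi>"
      proof (rule MVT2[OF less])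
        fix t assume "b n \<le> t" "t \<le> x n"
        then show "(G has_real_derivative g t) (at t)"
          using elim ereal_less_if_le[of "x n" t] by (intro deriv) auto
      qed
      then obtain t where "b n < t" "t < x n" "G (x n) - G (b n) = (x n - b n) * g t" by blast
      then have "good n t" unfolding good_def by linarith
      then show ?thesis by blast
    next
      case greater
      have "\<exists>\<xi>>x n. \<xi> < b n \<and> G (b n) - G (x n) = (b n - x n) * g \<xi>"
      proof (rule MVT2[OF greater])
        fix t assume "x n \<le> t" "t \<le> b n"
        then show "(G has_real_derivative g t) (at t)"
          using elim ereal_less_if_le[of "b n" t] by (intro deriv) auto
      qed
      then obtain t where t: "x n < t" "t < b n" "G (b n) - G (x n) = (b n - x n) * g t" by blast
      then have "G (x n) - G (b n) = (x n - b n) * g t" by (simp add: algebra_simps)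
      with t have "good n t" unfolding good_def by linarith
      then show ?thesis by blast
    next
      case equal
      then have "good n (b n)" unfolding good_def by simp
      then show ?thesis by blast
    qed
    have "G (x n) - G (b n) = (x n - b n) * g (\<xi> n)"
      using good[OF ex] unfolding good_def by (rule conjunct2)
    also have "\<dots> = \<delta> n * (g (\<xi> n) / g (b n)) * (1 - G (b n))"
      by (simp add: x_def)
    finally show ?case .
  qed
  then have "\<forall>\<^sub>F n in sequentially.
      G (b n + \<delta> n * ((1 - G (b n)) / g (b n))) - G (b n) = \<delta> n * (g (\<xi> n) / g (b n)) * (1 - G (b n))"
    unfolding x_def .
  with \<rho> show ?thesis by (intro exI[of _ "\<lambda>n. g (\<xi> n) / g (b n)"] conjI)
qed

text \<open>A distribution function may jump at a finite right endpoint w, but not under a von Mises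
condition: since A (x) \<le> (w - x) / \<delta>, the hazard rate g / (1 - G) is at least c / (w - x) near w, and
integration shows that 1 - G (x) is at most a constant times (w - x) to the power c.\<close>

lemma G_near_1:
  assumes A: "tail_scale A" and e: "e > 0"
  shows "\<exists>x>x0. ereal x < \<omega> \<and> 1 - e < G x"
proof (cases \<omega>)
  case PInf
  have "\<forall>\<^sub>F x in at_top. 1 - e < G x \<and> x0 < x"
  proof -
    have "1 - e < 1" using e by simp
    from order_tendstoD(1)[OF G_lim this] eventually_gt_at_top[of x0]
    show ?thesis by eventually_elim auto
  qed
  then obtain x where "1 - e < G x" "x0 < x"
    using eventually_happens'[OF trivial_limit_at_top_linorder] by blast
  then show ?thesis
    using PInf by auto
next
  case (real w)
  from A obtain \<delta> where \<delta>: "\<delta> > 0" "\<And>z. ereal z < \<omega> \<Longrightarrow> 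
      \<forall>\<^sub>F x in up_to \<omega>. z < x - \<delta> * A x \<and> ereal (x + \<delta> * A x) < \<omega>"
    unfolding tail_scale_def by blast
  have ev: "\<forall>\<^sub>F x in up_to \<omega>. 0 < A x" "((\<lambda>x. A x * g x / (1 - G x)) \<longlongrightarrow> 1) (up_to \<omega>)"
    using A unfolding tail_scale_def by auto
  have "\<forall>\<^sub>F x in up_to \<omega>. 0 < A x \<and> 1/2 < A x * g x / (1 - G x) \<and> x + \<delta> * A x < w \<and> x0 < x"
  proof -
    have "(1/2::real) < 1" by simp
    from ev(1) order_tendstoD(1)[OF ev(2) this] \<delta>(2)[OF x0] eventually_gt[OF x0]
    show ?thesis by eventually_elim (use real in auto)
  qed
  then obtain z where z: "ereal z < \<omega>" and zP: "\<And>x. z < x \<Longrightarrow> x < w \<Longrightarrow> 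
     0 < A x \<and> 1/2 < A x * g x / (1 - G x) \<and> x + \<delta> * A x < w \<and> x0 < x"
    unfolding eventually_tail using real by auto
  \<comment> \<open>Half of what the equality A g / (1 - G) = 1 would give, as the limit 1 is only approached.\<close>
  define c where "c = \<delta> / 2"
  define y where "y = (z + w) / 2"
  have y: "z < y" "y < w" using z real by (auto simp: y_def)
  define H where "H x = ln (1 - G x) - c * ln (w - x)" for x
  have H: "H x \<le> H y" if x: "y < x" "x < w" for x
  proof (rule DERIV_nonpos_imp_nonincreasing[of y x H])
    fix t assume t: "y \<le> t" "t \<le> x"
    then have t': "z < t" "t < w" "ereal t < \<omega>" using y x real by auto
    note zP = zP[OF t'(1,2)]
    have pos: "0 < 1 - G t" using G_less_1[OF t'(3)] by simp
    have D: "(H has_real_derivative - (g t / (1 - G t)) + c / (w - t)) (at t)"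
      unfolding H_def using deriv[of t] zP t' pos
      by (auto intro!: derivative_eq_intros simp: field_simps)
    have "\<delta> * A t \<le> w - t" using zP by linarith
    then have "c / (w - t) \<le> c / (\<delta> * A t)"
      using zP \<delta>(1) t' by (intro divide_left_mono) (auto simp: c_def)
    also have "\<dots> = (1/2) / A t" using \<delta>(1) by (simp add: c_def)
    also have "\<dots> \<le> (A t * g t / (1 - G t)) / A t"
      using zP by (intro divide_right_mono) auto
    also have "\<dots> = g t / (1 - G t)" using zP by simp
    finally show "\<exists>D. (H has_real_derivative D) (at t) \<and> D \<le> 0"
      using D by (intro exI[of _ "- (g t / (1 - G t)) + c / (w - t)"]) auto
  qed (use x in auto)
  define s where "s = min ((w - y) / 2) (exp ((ln e - H y) / c - 1))"
  define x where "x = w - s"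
  have c: "c > 0" using \<delta>(1) by (simp add: c_def)
  have s: "0 < s" "s < w - y" using y by (auto simp: s_def min_less_iff_disj)
  have "ln s \<le> ln (exp ((ln e - H y) / c - 1))"
    using s(1) by (subst ln_le_cancel_iff) (auto simp: s_def)
  then have "ln s < (ln e - H y) / c" by simp
  then have "H y + c * ln (w - x) < ln e"
    using c by (simp add: x_def field_simps)
  moreover have x: "y < x" "x < w" using s by (auto simp: x_def)
  ultimately have "ln (1 - G x) < ln e" using H[of x] by (auto simp: H_def)
  then have "1 - G x < e"
    using G_less_1[of x] real x e by simp
  then show ?thesis using zP[of x] x y real by (intro exI[of _ x]) auto
qed (use omega_not_MInf in auto)

text \<open>Near the endpoint G is continuous and strictly increasing and it takes values arbitrarily close
to 1, so that its generalized inverse is a genuine inverse.\<close>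

lemma gen_inv_tail:
  assumes A: "tail_scale A" and z: "x0 < z" "ereal z < \<omega>" and u: "G z < u" "u < 1"
  shows "z < gen_inv G u" and "ereal (gen_inv G u) < \<omega>" and "G (gen_inv G u) = u"
proof -
  obtain y where y: "x0 < y" "ereal y < \<omega>" "u < G y"
  proof -
    have "\<exists>x>x0. ereal x < \<omega> \<and> 1 - (1 - u) < G x"
      using u by (intro G_near_1[OF A]) simp
    then show ?thesis using that by auto
  qed
  have zy: "z \<le> y" using monoD[OF mono_G, of y z] y u by linarith
  have "\<exists>x\<ge>z. x \<le> y \<and> G x = u"
  proof (rule IVT[of G z u y])
    have "isCont G x" if "z \<le> x" "x \<le> y" for x
      using deriv[of x] z that ereal_less_if_le[OF y(2), of x] by (intro DERIV_isCont) auto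
    then show "\<forall>x. z \<le> x \<and> x \<le> y \<longrightarrow> isCont G x" by blast
  qed (use u y zy in auto)
  then obtain x where x: "z \<le> x" "x \<le> y" "G x = u" by blast
  have x\<omega>: "ereal x < \<omega>" using ereal_less_if_le[OF y(2) x(2)] .
  have "u \<le> G t \<longleftrightarrow> x \<le> t" for t
  proof
    assume "x \<le> t" then show "u \<le> G t" using monoD[OF mono_G, of x t] x(3) by simp
  next
    assume ut: "u \<le> G t"
    show "x \<le> t"
    proof (rule ccontr)
      assume "\<not> x \<le> t"
      then have "G t < u"
        using monoD[OF mono_G, of t z] u(1) G_less[of t x] z(1) x x\<omega> by (cases "t \<le> z") auto
      then show False using ut by simp
    qed
  qed
  then have "{t. u \<le> G t} = {x..}" by auto
  then have "gen_inv G u = x" by (simp add: gen_inv_def)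
  moreover have "z \<noteq> x" using x u by auto
  ultimately show "z < gen_inv G u" and "ereal (gen_inv G u) < \<omega>" and "G (gen_inv G u) = u"
    using x x\<omega> by auto
qed

text \<open>The expected number of exceedances of the level d + c s among n observations is k - s sqrt k, up to
an error of smaller order than sqrt k. The level is b + a \<tau> with \<tau> tending to s; since
1 - G (b) = k / n, the factor a equals ((1 - G (b)) / g (b)) / sqrt k, and the expansion of the tail
applies with \<delta> = \<tau> / sqrt k.\<close>

lemma exceedance_expansion:
  fixes k :: "nat \<Rightarrow> nat" and b a c d :: "nat \<Rightarrow> real"
  assumes A: "tail_scale A"
    and k: "filterlim (\<lambda>n. real (k n)) at_top sequentially" "(\<lambda>n. real (k n) / real n) \<longlonglongrightarrow> 0"
    and b: "\<And>n. b n = gen_inv G (1 - real (k n) / real n)"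
    and a: "\<And>n. a n = sqrt (real (k n)) / (real n * g (b n))"
    and c: "(\<lambda>n. c n / a n) \<longlonglongrightarrow> 1" and d: "(\<lambda>n. (d n - b n) / a n) \<longlonglongrightarrow> 0"
  shows "(\<lambda>n. (real n * (1 - G (d n + c n * s)) - real (k n)) / sqrt (real (k n))) \<longlonglongrightarrow> - s"
proof -
  have kpos: "\<forall>\<^sub>F n in sequentially. 0 < real (k n)"
    using k(1) unfolding filterlim_at_top_dense by blast
  have q: "\<forall>\<^sub>F n in sequentially. z < b n \<and> ereal (b n) < \<omega> \<and> 1 - G (b n) = real (k n) / real n"
    if z: "x0 < z" "ereal z < \<omega>" for z
  proof -
    have "0 < 1 - G z" using G_less_1[OF z(2)] by simp
    from order_tendstoD(2)[OF k(2) this] kpos eventually_gt_at_top[of 0]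
    show ?thesis
    proof eventually_elim
      case (elim n)
      then have u: "G z < 1 - real (k n) / real n" "1 - real (k n) / real n < 1" by auto
      from gen_inv_tail[OF A z u] show ?case by (simp add: b)
    qed
  qed
  obtain z1 where z1: "x0 < z1" "ereal z1 < \<omega>"
    using ereal_dense2[OF x0] by auto
  have bl: "filterlim b (up_to \<omega>) sequentially"
    unfolding filterlim_tail
  proof (intro allI impI)
    fix z assume z: "ereal z < \<omega>"
    have "x0 < max z z1" "ereal (max z z1) < \<omega>" using z z1 by (auto simp: max_def)
    from q[OF this] show "\<forall>\<^sub>F n in sequentially. z < b n \<and> ereal (b n) < \<omega>"
      by eventually_elim auto
  qed
  define \<tau> where "\<tau> n = (d n - b n) / a n + c n / a n * s" for n
  have \<tau>: "\<tau> \<longlonglongrightarrow> s"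
    unfolding \<tau>_def using tendsto_add[OF d tendsto_mult[OF c tendsto_const[of s]]] by simp
  define \<delta> where "\<delta> n = \<tau> n / sqrt (real (k n))" for n
  have "filterlim (\<lambda>n. sqrt (real (k n))) at_top sequentially"
    by (rule filterlim_compose[OF sqrt_at_top k(1)])
  then have \<delta>: "\<delta> \<longlonglongrightarrow> 0"
    unfolding \<delta>_def by (intro tendsto_divide_0[OF \<tau>] filterlim_at_top_imp_at_infinity)
  obtain \<rho> where \<rho>: "\<rho> \<longlonglongrightarrow> 1" and exp: "\<forall>\<^sub>F n in sequentially.
     G (b n + \<delta> n * ((1 - G (b n)) / g (b n))) - G (b n) = \<delta> n * \<rho> n * (1 - G (b n))"
    using tail_expansion[OF A bl \<delta>] by blast
  have "(\<lambda>n. - (\<tau> n * \<rho> n)) \<longlonglongrightarrow> - s"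
    using tendsto_minus[OF tendsto_mult[OF \<tau> \<rho>]] by simp
  moreover have "\<forall>\<^sub>F n in sequentially. 
      - (\<tau> n * \<rho> n) = (real n * (1 - G (d n + c n * s)) - real (k n)) / sqrt (real (k n))"
    using exp q[OF z1] kpos eventually_gt_at_top[of 0]
  proof eventually_elim
    case (elim n)
    define K where "K = sqrt (real (k n))"
    have K: "K > 0" "real (k n) = K * K" using elim by (auto simp: K_def)
    have g: "g (b n) > 0" using g_pos[of "b n"] elim z1 by auto
    have n: "real n > 0" using elim by simp
    have Gb: "1 - G (b n) = K * K / real n" using elim(2) K(2) by simp
    have a0: "a n > 0" using K g n unfolding a K_def by simp
    have "a n * \<tau> n = d n - b n + c n * s" using a0 by (simp add: \<tau>_def field_simps)
    moreover have "\<delta> n * ((1 - G (b n)) / g (b n)) = a n * \<tau> n"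
      using K(1) g n unfolding Gb a \<delta>_def K_def[symmetric] by (simp add: field_simps)
    ultimately have "b n + \<delta> n * ((1 - G (b n)) / g (b n)) = d n + c n * s" by simp
    then have "1 - G (d n + c n * s) = (1 - G (b n)) - \<delta> n * \<rho> n * (1 - G (b n))"
      using elim(1) by simp
    also have "\<dots> = (K * K / real n) * (1 - \<delta> n * \<rho> n)"
      unfolding Gb by (simp add: algebra_simps)
    finally have "real n * (1 - G (d n + c n * s)) = K * K * (1 - \<delta> n * \<rho> n)"
      using n by simp
    also have "\<dots> = K * K - K * (\<tau> n * \<rho> n)"
      using K(1) unfolding \<delta>_def K_def[symmetric] by (simp add: right_diff_distrib)
    finally have "real n * (1 - G (d n + c n * s)) - K * K = - K * (\<tau> n * \<rho> n)" by simp
    then show ?case using K unfolding K_def[symmetric] by simp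
  qed
  ultimately show ?thesis by (rule Lim_transform_eventually)
qed

end

section \<open>Distribution functions and copulas\<close>

lemma (in prob_space) prob_tendsto_at_top:
  fixes A :: "real \<Rightarrow> 'a set"
  assumes A: "\<And>s. A s \<in> events" and B: "B \<in> events"
    and ev: "AE \<omega> in M. \<forall>\<^sub>F s in at_top. \<omega> \<in> A s \<longleftrightarrow> \<omega> \<in> B"
  shows "((\<lambda>s. prob (A s)) \<longlongrightarrow> prob B) at_top"
proof -
  have "((\<lambda>s. expectation (indicat_real (A s))) \<longlongrightarrow> expectation (indicat_real B)) at_top"
  proof (rule integral_dominated_convergence_at_top[where w = "\<lambda>_. 1"])
    show "AE \<omega> in M. ((\<lambda>s. indicat_real (A s) \<omega>) \<longlongrightarrow> indicat_real B \<omega>) at_top"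
      using ev
    proof eventually_elim
      case (elim \<omega>)
      then show ?case by (intro tendsto_eventually) (auto elim!: eventually_mono simp: indicator_def)
    qed
  qed (use A B in auto)
  then show ?thesis using A B by simp
qed

lemma has_dist_fun_borel_measurable:
  assumes "has_dist_fun M V F"
  shows "(\<lambda>\<omega>. V \<omega> $ i) \<in> borel_measurable M"
proof (rule measurable_compose[where f = V and N = borel])
  show "V \<in> borel_measurable M" using assms by (simp add: has_dist_fun_def)
  show "(\<lambda>x. x $ i) \<in> borel_measurable borel"
    by (intro borel_measurable_continuous_onI continuous_intros)
qed

lemma (in prob_space) dist_fun_tendsto_at_top:
  assumes V: "has_dist_fun M V F"
  shows "((\<lambda>s. F (\<chi> j. if j \<in> J then u j else s)) \<longlongrightarrow> prob {\<omega> \<in> space M. \<forall>j\<in>J. V \<omega> $ j \<le> u j}) at_top"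
proof -
  note has_dist_fun_borel_measurable[OF V, measurable]
  have "F (\<chi> j. if j \<in> J then u j else s) = prob {\<omega> \<in> space M. \<forall>j. V \<omega> $ j \<le> (if j \<in> J then u j else s)}" for s
    using V unfolding has_dist_fun_def by simp
  moreover have "((\<lambda>s. prob {\<omega> \<in> space M. \<forall>j. V \<omega> $ j \<le> (if j \<in> J then u j else s)})
      \<longlongrightarrow> prob {\<omega> \<in> space M. \<forall>j\<in>J. V \<omega> $ j \<le> u j}) at_top"
  proof (rule prob_tendsto_at_top)
    have "\<forall>\<^sub>F s in at_top. \<omega> \<in> {\<omega> \<in> space M. \<forall>j. V \<omega> $ j \<le> (if j \<in> J then u j else s)} \<longleftrightarrow>
        \<omega> \<in> {\<omega> \<in> space M. \<forall>j\<in>J. V \<omega> $ j \<le> u j}" for \<omega>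
    proof -
      have "\<forall>\<^sub>F s in at_top. \<forall>j. V \<omega> $ j \<le> s"
        by (intro eventually_all_finite eventually_ge_at_top)
      then show ?thesis by eventually_elim auto
    qed
    then show "AE \<omega> in M. \<forall>\<^sub>F s in at_top. \<omega> \<in> {\<omega> \<in> space M. \<forall>j. V \<omega> $ j \<le> (if j \<in> J then u j else s)} \<longleftrightarrow>
        \<omega> \<in> {\<omega> \<in> space M. \<forall>j\<in>J. V \<omega> $ j \<le> u j}" by (intro AE_I2)
  next
    have "countable J" by (simp add: countable_finite)
    then show "{\<omega> \<in> space M. \<forall>j\<in>J. V \<omega> $ j \<le> u j} \<in> events" by measurable
  qed measurable
  ultimately show ?thesis by simp
qed

lemma (in prob_space) margin_eq_prob:
  assumes V: "has_dist_fun M V F"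
  shows "margin F i t = prob {\<omega> \<in> space M. V \<omega> $ i \<le> t}"
  unfolding margin_def
  using dist_fun_tendsto_at_top[OF V, of "{i}" "\<lambda>_. t"] by (intro tendsto_Lim) auto

lemma (in prob_space) margin_mono_and_lim:
  assumes V: "has_dist_fun M V F"
  shows "mono (margin F i)" and "(margin F i \<longlongrightarrow> 1) at_top"
proof -
  note has_dist_fun_borel_measurable[OF V, measurable]
  interpret D: real_distribution "distr M borel (\<lambda>\<omega>. V \<omega> $ i)"
    by (rule real_distribution_distr) simp
  have eq: "margin F i = cdf (distr M borel (\<lambda>\<omega>. V \<omega> $ i))"
    unfolding margin_eq_prob[OF V] cdf_def
    by (rule ext, subst measure_distr) (auto simp: vimage_def Int_def conj_commute)
  show "mono (margin F i)" unfolding eq by (simp add: mono_def D.cdf_nondecreasing)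
  show "(margin F i \<longlongrightarrow> 1) at_top" unfolding eq by (rule D.cdf_lim_at_top_prob)
qed

text \<open>The components of a random vector with distribution function C are almost surely less than 1, so
in the limit the coordinates outside of J impose no restriction, whether or not m reaches 1.\<close>

lemma copula_tendsto_at_top:
  fixes C :: "real ^ 'd \<Rightarrow> real" and m :: "'d \<Rightarrow> real \<Rightarrow> real"
  assumes "copula C" and m: "\<And>l. (m l \<longlongrightarrow> 1) at_top"
  shows "((\<lambda>s. C (\<chi> l. if l \<in> J then u l else m l s)) \<longlongrightarrow> C (\<chi> l. if l \<in> J then u l else 1)) at_top"
proof -
  obtain K :: "(real ^ 'd) measure" and U where K: "prob_space K" and U: "has_dist_fun K U C"
    and unif: "\<And>i. distr K borel (\<lambda>\<omega>. U \<omega> $ i) = uniform_measure lborel {0<..<1}"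
    using assms(1) unfolding copula_def by blast
  interpret K: prob_space K by fact
  note has_dist_fun_borel_measurable[OF U, measurable]
  have C: "C x = K.prob {\<omega> \<in> space K. \<forall>i. U \<omega> $ i \<le> x $ i}" for x
    using U unfolding has_dist_fun_def by simp
  have "AE \<omega> in K. U \<omega> $ l < 1" for l
  proof (rule AE_distrD[where M' = borel and P = "\<lambda>x. x < 1" and f = "\<lambda>\<omega>. U \<omega> $ l"])
    show "AE x in distr K borel (\<lambda>\<omega>. U \<omega> $ l). x < 1"
      unfolding unif by (rule AE_uniform_measureI) auto
  qed simp
  then have U1: "AE \<omega> in K. \<forall>l. U \<omega> $ l < 1" by (simp add: AE_all_countable)
  show ?thesis
    unfolding C
  proof (rule K.prob_tendsto_at_top, goal_cases)
    case 3
    from U1 show ?case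
    proof eventually_elim
      case (elim \<omega>)
      have "\<forall>\<^sub>F s in at_top. \<forall>l. U \<omega> $ l < m l s"
        using elim by (intro eventually_all_finite order_tendstoD(1)[OF m]) auto
      then show ?case
      proof eventually_elim
        case (elim s)
        then show ?case using \<open>\<forall>l. U \<omega> $ l < 1\<close> by (auto simp: less_imp_le)
      qed
    qed
  qed simp_all
qed

text \<open>The coordinates outside of J are sent to infinity on both sides of the relation between F and C.\<close>

lemma (in prob_space) joint_prob_eq_copula:
  assumes V: "has_dist_fun M V F" and C: "copula C" "\<And>x. F x = C (\<chi> i. margin F i (x $ i))"
  shows "prob {\<omega> \<in> space M. \<forall>j\<in>J. V \<omega> $ j \<le> u j} = C (\<chi> l. if l \<in> J then margin F l (u l) else 1)"
proof (rule tendsto_unique[OF _ dist_fun_tendsto_at_top[OF V]])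
  have "F (\<chi> j. if j \<in> J then u j else s) = C (\<chi> l. if l \<in> J then margin F l (u l) else margin F l s)" for s
    by (subst C(2)) (rule arg_cong[where f = C], auto simp: vec_eq_iff)
  then show "((\<lambda>s. F (\<chi> j. if j \<in> J then u j else s)) \<longlongrightarrow> C (\<chi> l. if l \<in> J then margin F l (u l) else 1)) at_top"
    using copula_tendsto_at_top[OF C(1) margin_mono_and_lim(2)[OF V]] by simp
qed simp

text \<open>Inclusion and exclusion, written so that the copula is evaluated at a point of the form 1 - x with
a vector x of small exceedance probabilities.\<close>

lemma (in prob_space) joint_exceedance:
  assumes V: "has_dist_fun M V F" and C: "copula C" "\<And>x. F x = C (\<chi> i. margin F i (x $ i))" and il: "i \<noteq> l"
  shows "prob {\<omega> \<in> space M. s < V \<omega> $ i \<and> t < V \<omega> $ l} =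
    (1 - margin F i s) + (1 - margin F l t)
      - (1 - C (1 - ((1 - margin F i s) *\<^sub>R axis i 1 + (1 - margin F l t) *\<^sub>R axis l 1)))"
proof -
  note has_dist_fun_borel_measurable[OF V, measurable]
  let ?A = "{\<omega> \<in> space M. V \<omega> $ i \<le> s}" and ?B = "{\<omega> \<in> space M. V \<omega> $ l \<le> t}"
  have "{\<omega> \<in> space M. s < V \<omega> $ i \<and> t < V \<omega> $ l} = space M - (?A \<union> ?B)" by auto
  then have "prob {\<omega> \<in> space M. s < V \<omega> $ i \<and> t < V \<omega> $ l} = 1 - prob (?A \<union> ?B)"
    by (simp add: prob_compl)
  also have "prob (?A \<union> ?B) = prob ?A + prob ?B - prob (?A \<inter> ?B)"
    using finite_measure_Union'[of ?A ?B] finite_measure_Diff'[of ?B ?A]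
    by (simp add: Int_commute)
  also have "?A \<inter> ?B = {\<omega> \<in> space M. \<forall>j\<in>{i, l}. V \<omega> $ j \<le> (if j = i then s else t)}"
    using il by auto
  also have "prob \<dots> = C (\<chi> j. if j \<in> {i, l} then margin F j (if j = i then s else t) else 1)"
    by (rule joint_prob_eq_copula[OF V C])
  also have "(\<chi> j. if j \<in> {i, l} then margin F j (if j = i then s else t) else 1) =
      1 - ((1 - margin F i s) *\<^sub>R axis i 1 + (1 - margin F l t) *\<^sub>R axis l 1)"
    using il by (auto simp: vec_eq_iff axis_def)
  finally show ?thesis
    unfolding margin_eq_prob[OF V, symmetric] by simp
qed

section \<open>Norms on Euclidean space\<close>

lemma is_norm_diff_le:
  assumes "is_norm N"
  shows "\<bar>N x - N y\<bar> \<le> N (x - y)"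
proof -
  have "N x \<le> N (x - y) + N y" "N y \<le> N (y - x) + N x"
    using assms unfolding is_norm_def by (metis diff_add_cancel)+
  moreover have "N (y - x) = N (x - y)"
    using assms unfolding is_norm_def by (metis abs_1 abs_minus_cancel minus_diff_eq mult_1 scaleR_minus1_left)
  ultimately show ?thesis by linarith
qed

lemma is_norm_sum_le:
  assumes N: "is_norm N"
  shows "N (\<Sum>i\<in>I. f i) \<le> (\<Sum>i\<in>I. N (f i))"
proof (induction I rule: infinite_finite_induct)
  case (insert i I)
  have "N (f i + (\<Sum>i\<in>I. f i)) \<le> N (f i) + N (\<Sum>i\<in>I. f i)"
    using N unfolding is_norm_def by blast
  then show ?case using insert by simp
qed (use N[unfolded is_norm_def, THEN conjunct2, THEN conjunct1, rule_format, of 0] in simp_all)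

lemma is_norm_tendsto:
  fixes N :: "real ^ 'd \<Rightarrow> real"
  assumes N: "is_norm N" and x: "(x \<longlongrightarrow> y) F"
  shows "((\<lambda>n. N (x n)) \<longlongrightarrow> N y) F"
proof (rule LIM_zero_cancel, rule Lim_null_comparison)
  show "\<forall>\<^sub>F n in F. norm (N (x n) - N y) \<le> (\<Sum>i\<in>UNIV. \<bar>x n $ i - y $ i\<bar> * N (axis i 1))"
  proof (rule always_eventually, rule allI)
    fix n
    have "norm (N (x n) - N y) \<le> N (x n - y)" using is_norm_diff_le[OF N] by simp
    also have "x n - y = (\<Sum>i\<in>UNIV. (x n - y) $ i *\<^sub>R axis i 1)"
      using basis_expansion[of "x n - y"] by (simp add: scalar_mult_eq_scaleR)
    also have "N \<dots> \<le> (\<Sum>i\<in>UNIV. N ((x n - y) $ i *\<^sub>R axis i 1))" by (rule is_norm_sum_le[OF N])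
    finally show "norm (N (x n) - N y) \<le> (\<Sum>i\<in>UNIV. \<bar>x n $ i - y $ i\<bar> * N (axis i 1))"
      using N unfolding is_norm_def by simp
  qed
  have "((\<lambda>n. \<Sum>i\<in>UNIV. \<bar>x n $ i - y $ i\<bar> * N (axis i 1)) \<longlongrightarrow> (\<Sum>i\<in>UNIV. \<bar>y $ i - y $ i\<bar> * N (axis i 1))) F"
    by (intro tendsto_intros x)
  then show "((\<lambda>n. \<Sum>i\<in>UNIV. \<bar>x n $ i - y $ i\<bar> * N (axis i 1)) \<longlongrightarrow> 0) F" by simp
qed

text \<open>The hypotheses concern the norm of the vector k (n). By homogeneity it equals
k (n) i times the norm of k (n) / k (n) i, and that vector converges to a nonzero limit. So each
component grows like the norm.\<close>

lemma intermediate_sequence_components: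
  fixes N :: "real ^ 'd \<Rightarrow> real" and k :: "nat \<Rightarrow> 'd \<Rightarrow> nat"
  assumes N: "is_norm N" and k: "\<And>n i. 1 \<le> n \<Longrightarrow> k n i \<in> {1..n}"
    and ratio: "\<And>i j. (\<lambda>n. real (k n i) / real (k n j)) \<longlonglongrightarrow> r i j" and r: "\<And>i j. 0 < r i j"
    and top: "filterlim (\<lambda>n. N (\<chi> i. real (k n i))) at_top sequentially"
    and small: "(\<lambda>n. N (\<chi> i. real (k n i)) / real n) \<longlonglongrightarrow> 0"
  shows "filterlim (\<lambda>n. real (k n i)) at_top sequentially" and "(\<lambda>n. real (k n i) / real n) \<longlonglongrightarrow> 0"
proof -
  define \<nu> where "\<nu> n = N (\<chi> j. real (k n j) / real (k n i))" for n
  have lim: "\<nu> \<longlonglongrightarrow> N (\<chi> j. r j i)"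
    unfolding \<nu>_def by (intro is_norm_tendsto[OF N] vec_tendstoI) (simp add: ratio)
  have "(\<chi> j. r j i) \<noteq> 0" using r[of i i] by (auto simp: vec_eq_iff intro!: exI[of _ i])
  then have pos: "0 < N (\<chi> j. r j i)" using N unfolding is_norm_def by (metis less_le)
  have inv: "(\<lambda>n. 1 / \<nu> n) \<longlonglongrightarrow> 1 / N (\<chi> j. r j i)" using pos by (intro tendsto_intros lim) auto
  have eq: "\<forall>\<^sub>F n in sequentially. 1 / \<nu> n * N (\<chi> j. real (k n j)) = real (k n i)"
    using order_tendstoD(1)[OF lim pos] eventually_ge_at_top[of 1]
  proof eventually_elim
    case (elim n)
    have ki: "0 < real (k n i)" using k[of n i] elim by auto
    have "(\<chi> j. real (k n j)) = real (k n i) *\<^sub>R (\<chi> j. real (k n j) / real (k n i))"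
      using ki by (simp add: vec_eq_iff)
    then have "N (\<chi> j. real (k n j)) = real (k n i) * \<nu> n"
      using N ki unfolding is_norm_def \<nu>_def by (metis abs_of_pos)
    then show ?case using elim by simp
  qed
  have "filterlim (\<lambda>n. 1 / \<nu> n * N (\<chi> j. real (k n j))) at_top sequentially"
    using pos by (intro filterlim_tendsto_pos_mult_at_top[OF inv _ top]) simp
  then show "filterlim (\<lambda>n. real (k n i)) at_top sequentially"
    using filterlim_cong[OF refl refl eq] by blast
  have "(\<lambda>n. 1 / \<nu> n * (N (\<chi> j. real (k n j)) / real n)) \<longlonglongrightarrow> 0"
    using tendsto_mult[OF inv small] by simp
  moreover have "\<forall>\<^sub>F n in sequentially. 1 / \<nu> n * (N (\<chi> j. real (k n j)) / real n) = real (k n i) / real n"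
    using eq by eventually_elim (simp only: times_divide_eq_right)
  ultimately show "(\<lambda>n. real (k n i) / real n) \<longlonglongrightarrow> 0" by (rule Lim_transform_eventually)
qed

section \<open>Joint exceedance probabilities\<close>

text \<open>Norms are homogeneous and continuous: the weights w move inside of the norms, where the scaled
vectors converge. This gives the limit of the main term and bounds the scaled remainder.\<close>

lemma copula_expansion_tendsto:
  fixes C Dn N :: "real ^ 'd \<Rightarrow> real" and p q w :: "nat \<Rightarrow> real"
  assumes N: "is_norm N" and Dn: "is_norm Dn"
    and exp: "(\<lambda>u. C u - (1 - Dn (1 - u))) \<in> o[at 1 within {u. \<forall>i. 0 \<le> u $ i \<and> u $ i \<le> 1}](\<lambda>u. N (1 - u))"
    and il: "i \<noteq> l"
    and p: "p \<longlonglongrightarrow> 0" "\<forall>\<^sub>F n in sequentially. 0 < p n" and q: "q \<longlonglongrightarrow> 0" "\<forall>\<^sub>F n in sequentially. 0 < q n"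
    and w: "\<And>n. 0 \<le> w n" "(\<lambda>n. w n * p n) \<longlonglongrightarrow> \<alpha>" "(\<lambda>n. w n * q n) \<longlonglongrightarrow> \<beta>"
  shows "(\<lambda>n. w n * (p n + q n - (1 - C (1 - (p n *\<^sub>R axis i 1 + q n *\<^sub>R axis l 1)))))
    \<longlonglongrightarrow> \<alpha> + \<beta> - Dn (\<alpha> *\<^sub>R axis i 1 + \<beta> *\<^sub>R axis l 1)"
proof -
  define x :: "nat \<Rightarrow> real ^ 'd" where "x n = p n *\<^sub>R axis i 1 + q n *\<^sub>R axis l 1" for n
  define R where "R n = C (1 - x n) - (1 - Dn (x n))" for n
  have "filterlim (\<lambda>n. 1 - x n) (at 1 within {u. \<forall>i. 0 \<le> u $ i \<and> u $ i \<le> 1}) sequentially"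
    unfolding filterlim_at
  proof
    have "\<forall>\<^sub>F n in sequentially. p n < 1" "\<forall>\<^sub>F n in sequentially. q n < 1"
      using order_tendstoD(2)[OF p(1)] order_tendstoD(2)[OF q(1)] by simp_all
    with p(2) q(2) show "\<forall>\<^sub>F n in sequentially. 1 - x n \<in> {u. \<forall>i. 0 \<le> u $ i \<and> u $ i \<le> 1} \<and> 1 - x n \<noteq> 1"
    proof eventually_elim
      case (elim n)
      have "x n $ i = p n" using il by (simp add: x_def axis_def)
      then have "x n \<noteq> 0" using elim by auto
      moreover have "0 \<le> x n $ j \<and> x n $ j \<le> 1" for j using elim il by (auto simp: x_def axis_def)
      ultimately show ?case by auto
    qed
    have "(\<lambda>n. 1 - x n) \<longlonglongrightarrow> 1 - (0 *\<^sub>R axis i 1 + 0 *\<^sub>R axis l 1)"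
      unfolding x_def by (intro tendsto_intros p q)
    then show "(\<lambda>n. 1 - x n) \<longlonglongrightarrow> 1" by simp
  qed
  from landau_o.small.compose[OF exp this] have R: "R \<in> o(\<lambda>n. N (x n))"
    by (simp add: R_def[abs_def])
  have scaled: "(\<lambda>n. K (w n *\<^sub>R x n)) \<longlonglongrightarrow> K (\<alpha> *\<^sub>R axis i 1 + \<beta> *\<^sub>R axis l 1)" if "is_norm K" for K
    unfolding x_def scaleR_add_right scaleR_scaleR
    by (intro is_norm_tendsto[OF that] tendsto_intros w)
  have hom: "K (w n *\<^sub>R x n) = w n * K (x n)" if "is_norm K" for K n
    using that w(1)[of n] unfolding is_norm_def by simp
  have "(\<lambda>n. w n * R n) \<in> o(\<lambda>n. w n * N (x n))"
    using R by simp
  also have "(\<lambda>n. w n * N (x n)) \<in> O(\<lambda>_. 1)"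
    using scaled[OF N] unfolding hom[OF N] by (intro bigoI_tendsto[where c = "N (\<alpha> *\<^sub>R axis i 1 + \<beta> *\<^sub>R axis l 1)"]) auto
  finally have wR: "(\<lambda>n. w n * R n) \<longlonglongrightarrow> 0"
    using smalloD_tendsto by fastforce
  have "(\<lambda>n. w n * p n + w n * q n - w n * Dn (x n) + w n * R n)
      \<longlonglongrightarrow> \<alpha> + \<beta> - Dn (\<alpha> *\<^sub>R axis i 1 + \<beta> *\<^sub>R axis l 1) + 0"
    using scaled[OF Dn] unfolding hom[OF Dn] by (intro tendsto_add tendsto_diff w wR)
  moreover have "w n * p n + w n * q n - w n * Dn (x n) + w n * R n = w n * (p n + q n - (1 - C (1 - x n)))" for n
    by (simp add: R_def algebra_simps)
  ultimately show ?thesis by (simp add: x_def)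
qed

section \<open>Order statistics\<close>

lemma sorted_nth_le_iff:
  fixes t :: "'a :: linorder"
  assumes "sorted ys" "i < length ys"
  shows "ys ! i \<le> t \<longleftrightarrow> i < length (filter (\<lambda>y. y \<le> t) ys)"
  using assms
proof (induction ys arbitrary: i)
  case Nil
  then show ?case by simp
next
  case (Cons y ys)
  show ?case
  proof (cases "y \<le> t")
    case True
    then show ?thesis using Cons by (cases i) auto
  next
    case False
    then have "\<forall>z\<in>set (y # ys). \<not> z \<le> t" using Cons.prems(1) by auto
    moreover from this have "filter (\<lambda>y. y \<le> t) (y # ys) = []" unfolding filter_empty_conv .
    ultimately show ?thesis using nth_mem[OF Cons.prems(2)] by (metis length_0_conv not_less_zero)
  qed
qed

lemma order_stat_le_iff:
  assumes "1 \<le> m" "m \<le> n"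
  shows "order_stat n m x \<le> t \<longleftrightarrow> m \<le> card {j \<in> {1..n}. x j \<le> t}"
proof -
  have "length (filter (\<lambda>y. y \<le> t) (sort (map x [1..<Suc n]))) = length (filter (\<lambda>y. y \<le> t) (map x [1..<Suc n]))"
    by (metis mset_filter mset_sort size_mset)
  also have "\<dots> = length (filter (\<lambda>j. x j \<le> t) [1..<Suc n])"
    by (simp add: filter_map o_def)
  also have "\<dots> = card {j \<in> {1..n}. x j \<le> t}"
    by (subst distinct_card[symmetric]) (auto intro!: arg_cong[of _ _ card])
  finally have "length (filter (\<lambda>y. y \<le> t) (sort (map x [1..<Suc n]))) = card {j \<in> {1..n}. x j \<le> t}" .
  moreover have "m - 1 < length (sort (map x [1..<Suc n]))" using assms by simp
  ultimately show ?thesis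
    unfolding order_stat_def using sorted_nth_le_iff[of "sort (map x [1..<Suc n])" "m - 1" t] assms
    by auto
qed

lemma upper_order_stat_le_iff:
  assumes "1 \<le> k" "k \<le> n"
  shows "order_stat n (n - k + 1) x \<le> t \<longleftrightarrow> card {j \<in> {1..n}. t < x j} < k"
proof -
  have "{j \<in> {1..n}. x j \<le> t} \<union> {j \<in> {1..n}. t < x j} = {1..n}" by auto
  then have "n = card ({j \<in> {1..n}. x j \<le> t} \<union> {j \<in> {1..n}. t < x j})"
    by (simp only: card_atLeastAtMost)
  also have "\<dots> = card {j \<in> {1..n}. x j \<le> t} + card {j \<in> {1..n}. t < x j}"
    by (rule card_Un_disjoint) auto
  finally show ?thesis using order_stat_le_iff[of "n - k + 1" n x t] assms by auto
qed

lemma borel_measurable_order_stat: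
  assumes X: "\<And>j. j \<in> {1..n} \<Longrightarrow> X j \<in> borel_measurable M" and m: "1 \<le> m" "m \<le> n"
  shows "(\<lambda>\<omega>. order_stat n m (\<lambda>j. X j \<omega>)) \<in> borel_measurable M"
  unfolding borel_measurable_iff_le
proof
  fix t
  have card: "real (card {j \<in> {1..n}. X j \<omega> \<le> t}) = (\<Sum>j\<in>{1..n}. indicator {..t} (X j \<omega>))" for \<omega>
    by (simp add: indicator_def sum.If_cases Int_def)
  have "{\<omega> \<in> space M. order_stat n m (\<lambda>j. X j \<omega>) \<le> t} = 
      {\<omega> \<in> space M. real m \<le> (\<Sum>j\<in>{1..n}. indicator {..t} (X j \<omega>))}"
    unfolding card[symmetric] by (simp add: order_stat_le_iff[OF m])
  also have "\<dots> \<in> sets M"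
    by (intro borel_measurable_le borel_measurable_sum borel_measurable_const measurable_compose[OF X]) auto
  finally show "{\<omega> \<in> space M. order_stat n m (\<lambda>j. X j \<omega>) \<le> t} \<in> sets M" .
qed

section \<open>Sums of independent small summands\<close>

lemma (in prob_space) expectation_square_sum_indep:
  fixes V :: "'i \<Rightarrow> 'a \<Rightarrow> real"
  assumes "finite I" "indep_vars (\<lambda>_. borel) V I"
    and "\<And>j \<omega>. j \<in> I \<Longrightarrow> \<bar>V j \<omega>\<bar> \<le> B" and "\<And>j. j \<in> I \<Longrightarrow> expectation (V j) = 0"
  shows "expectation (\<lambda>\<omega>. (\<Sum>j\<in>I. V j \<omega>)\<^sup>2) = (\<Sum>j\<in>I. expectation (\<lambda>\<omega>. (V j \<omega>)\<^sup>2))"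
  using assms
proof (induction I rule: finite_induct)
  case empty
  then show ?case by simp
next
  case (insert i I)
  have V: "V j \<in> borel_measurable M" if "j \<in> insert i I" for j
    using insert.prems(1) that unfolding indep_vars_def by blast
  have indI: "indep_vars (\<lambda>_. borel) V I" using insert.prems(1) by (rule indep_vars_subset) auto
  have ind: "indep_var borel (V i) borel (\<lambda>\<omega>. \<Sum>j\<in>I. V j \<omega>)"
    by (rule indep_vars_sum[OF insert.hyps insert.prems(1)])
  define S where "S \<omega> = (\<Sum>j\<in>I. V j \<omega>)" for \<omega>
  have S[measurable]: "S \<in> borel_measurable M" unfolding S_def using V by (intro borel_measurable_sum) auto
  have Vi[measurable]: "V i \<in> borel_measurable M" using V by simp
  have Sb: "\<bar>S \<omega>\<bar> \<le> real (card I) * B" for \<omega>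
  proof -
    have "\<bar>S \<omega>\<bar> \<le> (\<Sum>j\<in>I. \<bar>V j \<omega>\<bar>)" unfolding S_def by (rule sum_abs)
    also have "\<dots> \<le> (\<Sum>j\<in>I. B)" using insert.prems(2) by (intro sum_mono) auto
    finally show ?thesis by simp
  qed
  have Vb: "\<bar>V i \<omega>\<bar> \<le> B" for \<omega> using insert.prems(2) by simp
  have int: "integrable M (V i)" "integrable M S"
    by (rule integrable_const_bound[where B = B], use Vb in auto)
       (rule integrable_const_bound[where B = "real (card I) * B"], use Sb in auto)
  have int2: "integrable M (\<lambda>\<omega>. (V i \<omega>)\<^sup>2)" "integrable M (\<lambda>\<omega>. (S \<omega>)\<^sup>2)"
    by (rule integrable_const_bound[where B = "B\<^sup>2"], use power_mono[OF Vb abs_ge_zero, of _ 2] in auto)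
       (rule integrable_const_bound[where B = "(real (card I) * B)\<^sup>2"], use power_mono[OF Sb abs_ge_zero, of _ 2] in auto)
  have int3: "integrable M (\<lambda>\<omega>. V i \<omega> * S \<omega>)" and "expectation (\<lambda>\<omega>. V i \<omega> * S \<omega>) = expectation (V i) * expectation S"
    using indep_var_integrable[OF ind] indep_var_lebesgue_integral[OF ind] int unfolding S_def by simp_all
  then have 0: "expectation (\<lambda>\<omega>. V i \<omega> * S \<omega>) = 0" using insert.prems(3) by simp
  have "expectation (\<lambda>\<omega>. (\<Sum>j\<in>insert i I. V j \<omega>)\<^sup>2) = expectation (\<lambda>\<omega>. (V i \<omega>)\<^sup>2 + 2 * (V i \<omega> * S \<omega>) + (S \<omega>)\<^sup>2)"
    using insert.hyps by (simp add: S_def power2_sum algebra_simps)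
  also have "\<dots> = expectation (\<lambda>\<omega>. (V i \<omega>)\<^sup>2) + expectation (\<lambda>\<omega>. (S \<omega>)\<^sup>2)"
    using int2 int3 0 by simp
  also have "expectation (\<lambda>\<omega>. (S \<omega>)\<^sup>2) = (\<Sum>j\<in>I. expectation (\<lambda>\<omega>. (V j \<omega>)\<^sup>2))"
    unfolding S_def using insert.prems indI by (intro insert.IH) auto
  finally show ?case using insert.hyps by simp
qed

lemma exp_minus_remainder:
  fixes x :: real
  assumes "0 \<le> x"
  shows "\<bar>exp (- x) - (1 - x)\<bar> \<le> x\<^sup>2"
proof -
  have "1 - x \<le> exp (- x)" using exp_ge_add_one_self[of "- x"] by simp
  moreover have "exp (- x) \<le> 1 - x + x\<^sup>2"
  proof -
    have "exp (- x) \<le> 1 / (1 + x)"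
      using exp_ge_add_one_self[of x] assms by (simp add: exp_minus field_simps)
    also have "\<dots> \<le> 1 - x + x\<^sup>2"
    proof -
      have "(1 + x) * (1 - x + x\<^sup>2) = 1 + x ^ 3" by (simp add: algebra_simps power2_eq_square power3_eq_cube)
      then have "1 \<le> (1 + x) * (1 - x + x\<^sup>2)" using assms by simp
      then show ?thesis using assms by (simp add: divide_le_eq mult.commute)
    qed
    finally show ?thesis .
  qed
  ultimately show ?thesis by linarith
qed

text \<open>Both the characteristic function and exp (- v / 2) agree with 1 - v / 2 up to small errors: the
third moment of V is at most \<epsilon> v, and the exponential contributes an error of second order in v.\<close>

lemma (in prob_space) iexp_expectation_approx:
  fixes V :: "'a \<Rightarrow> real"
  assumes V[measurable]: "V \<in> borel_measurable M" and b: "\<And>\<omega>. \<bar>V \<omega>\<bar> \<le> \<epsilon>"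
    and "expectation V = 0"
  defines "v \<equiv> expectation (\<lambda>\<omega>. (V \<omega>)\<^sup>2)"
  shows "norm ((CLINT \<omega>|M. iexp (V \<omega>)) - of_real (exp (- v / 2))) \<le> \<epsilon> * v / 6 + v\<^sup>2 / 4"
proof -
  have int: "integrable M V" by (rule integrable_const_bound[where B = \<epsilon>]) (use b in auto)
  have sq: "(V \<omega>)\<^sup>2 \<le> \<epsilon>\<^sup>2" for \<omega> using power_mono[OF b abs_ge_zero, of \<omega> 2] by simp
  have int2: "integrable M (\<lambda>\<omega>. (V \<omega>)\<^sup>2)" by (rule integrable_const_bound[where B = "\<epsilon>\<^sup>2"]) (use sq in auto)
  have v: "0 \<le> v" unfolding v_def by (rule integral_nonneg_AE) auto
  have cube: "min (6 * (V \<omega>)\<^sup>2) (\<bar>1\<bar> * \<bar>V \<omega>\<bar> ^ 3) \<le> \<epsilon> * (V \<omega>)\<^sup>2" for \<omega>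
  proof -
    have "\<bar>V \<omega>\<bar> ^ 3 = \<bar>V \<omega>\<bar> * (V \<omega>)\<^sup>2" by (simp add: power3_eq_cube power2_eq_square abs_mult)
    also have "\<dots> \<le> \<epsilon> * (V \<omega>)\<^sup>2" using b by (intro mult_right_mono) auto
    finally show ?thesis by (simp add: min_le_iff_disj)
  qed
  have "norm (char (distr M borel V) 1 - of_real (1 - 1\<^sup>2 * v / 2)) \<le>
      (1\<^sup>2 / 6) * expectation (\<lambda>\<omega>. min (6 * (V \<omega>)\<^sup>2) (\<bar>1\<bar> * \<bar>V \<omega>\<bar> ^ 3))"
    using char_approx3'[of V v "distr M borel V" 1] int int2 assms(3) by (simp add: v_def)
  also have "\<dots> \<le> (1\<^sup>2 / 6) * expectation (\<lambda>\<omega>. \<epsilon> * (V \<omega>)\<^sup>2)"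
  proof (intro mult_left_mono integral_mono)
    show "integrable M (\<lambda>\<omega>. min (6 * (V \<omega>)\<^sup>2) (\<bar>1\<bar> * \<bar>V \<omega>\<bar> ^ 3))"
      by (rule Bochner_Integration.integrable_bound[of M "\<lambda>\<omega>. 6 * (V \<omega>)\<^sup>2"]) (use int2 in auto)
  qed (use int2 cube in auto)
  also have "\<dots> = \<epsilon> * v / 6" by (simp add: v_def)
  finally have 1: "norm ((CLINT \<omega>|M. iexp (V \<omega>)) - of_real (1 - v / 2)) \<le> \<epsilon> * v / 6"
    by (simp add: char_def integral_distr)
  have "norm (of_real (1 - v / 2) - of_real (exp (- v / 2)) :: complex) = \<bar>exp (- (v / 2)) - (1 - v / 2)\<bar>"
    unfolding of_real_diff[symmetric] norm_of_real by (simp add: abs_minus_commute)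
  also have "\<dots> \<le> (v / 2)\<^sup>2" using v by (intro exp_minus_remainder) simp
  also have "\<dots> = v\<^sup>2 / 4" by (simp add: power_divide)
  finally show ?thesis
    using 1 norm_diff_triangle_le by blast
qed

text \<open>The central limit theorem for triangular arrays with uniformly small summands, on the level of
characteristic functions. The product of the characteristic functions is compared factor by factor
with a power of exp (- v n / 2), so that only the common variance of the summands of a row matters and
not their laws.\<close>

lemma (in prob_space) iexp_row_sum_tendsto:
  fixes V :: "nat \<Rightarrow> nat \<Rightarrow> 'a \<Rightarrow> real"
  assumes ind: "\<And>n. indep_vars (\<lambda>_. borel) (V n) {1..n}"
    and bound: "\<forall>\<^sub>F n in sequentially. \<forall>j\<in>{1..n}. \<forall>\<omega>. \<bar>V n j \<omega>\<bar> \<le> \<epsilon> n" and \<epsilon>: "\<epsilon> \<longlonglongrightarrow> 0"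
    and mean: "\<And>n j. j \<in> {1..n} \<Longrightarrow> expectation (V n j) = 0"
    and var: "\<And>n j. j \<in> {1..n} \<Longrightarrow> expectation (\<lambda>\<omega>. (V n j \<omega>)\<^sup>2) = v n"
    and v: "(\<lambda>n. real n * v n) \<longlonglongrightarrow> \<sigma>"
  shows "(\<lambda>n. CLINT \<omega>|M. iexp (\<Sum>j\<in>{1..n}. V n j \<omega>)) \<longlonglongrightarrow> of_real (exp (- \<sigma> / 2))"
proof -
  have V: "V n j \<in> borel_measurable M" if "j \<in> {1..n}" for n j
    using ind[of n] that unfolding indep_vars_def by blast
  define \<phi> where "\<phi> n j = (CLINT \<omega>|M. iexp (V n j \<omega>))" for n j
  have prod: "(CLINT \<omega>|M. iexp (\<Sum>j\<in>{1..n}. V n j \<omega>)) = (\<Prod>j\<in>{1..n}. \<phi> n j)" for n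
  proof -
    have "(CLINT \<omega>|M. iexp (\<Sum>j\<in>{1..n}. V n j \<omega>)) = char (distr M borel (\<lambda>\<omega>. \<Sum>j\<in>{1..n}. V n j \<omega>)) 1"
      unfolding char_def using V[of _ n] by (subst integral_distr) (auto intro!: borel_measurable_sum)
    also have "\<dots> = (\<Prod>j\<in>{1..n}. char (distr M borel (V n j)) 1)"
      by (rule char_distr_sum[OF ind])
    also have "\<dots> = (\<Prod>j\<in>{1..n}. \<phi> n j)"
      unfolding char_def \<phi>_def using V by (intro prod.cong refl) (simp add: integral_distr)
    finally show ?thesis .
  qed
  have vn: "\<forall>\<^sub>F n in sequentially. 0 \<le> v n"
    using eventually_gt_at_top[of 0]
  proof eventually_elim
    case (elim n)
    then have "v n = expectation (\<lambda>\<omega>. (V n 1 \<omega>)\<^sup>2)" using var[of 1 n] by simp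
    then show ?case by simp
  qed
  have "(\<lambda>n. real n * v n * (1 / real n)) \<longlonglongrightarrow> 0"
    using tendsto_mult[OF v lim_1_over_n] by simp
  moreover have "\<forall>\<^sub>F n in sequentially. real n * v n * (1 / real n) = v n"
    using eventually_gt_at_top[of 0] by eventually_elim simp
  ultimately have v0: "v \<longlonglongrightarrow> 0" by (rule Lim_transform_eventually)
  have "(\<lambda>n. (\<Prod>j\<in>{1..n}. \<phi> n j) - (of_real (exp (- v n / 2))) ^ n) \<longlonglongrightarrow> 0"
  proof (rule Lim_null_comparison)
    show "(\<lambda>n. real n * v n * (\<epsilon> n / 6 + v n / 4)) \<longlonglongrightarrow> 0"
      by (rule tendsto_eq_intros v \<epsilon> v0 | simp)+
    show "\<forall>\<^sub>F n in sequentially. norm ((\<Prod>j\<in>{1..n}. \<phi> n j) - (of_real (exp (- v n / 2))) ^ n)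
        \<le> real n * v n * (\<epsilon> n / 6 + v n / 4)"
      using bound vn
    proof eventually_elim
      case (elim n)
      have \<phi>1: "norm (\<phi> n j) \<le> 1" if "j \<in> {1..n}" for j
      proof -
        interpret D: real_distribution "distr M borel (V n j)" by (rule real_distribution_distr[OF V[OF that]])
        show ?thesis using D.cmod_char_le_1[of 1] V[OF that] by (simp add: \<phi>_def char_def integral_distr)
      qed
      have "norm ((\<Prod>j\<in>{1..n}. \<phi> n j) - (\<Prod>j\<in>{1..n}. of_real (exp (- v n / 2))))
          \<le> (\<Sum>j\<in>{1..n}. norm (\<phi> n j - of_real (exp (- v n / 2))))"
        by (rule norm_prod_diff) (use \<phi>1 elim(2) in auto)
      also have "\<dots> \<le> (\<Sum>j\<in>{1..n}. \<epsilon> n * v n / 6 + (v n)\<^sup>2 / 4)"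
      proof (rule sum_mono)
        fix j assume j: "j \<in> {1..n}"
        show "norm (\<phi> n j - of_real (exp (- v n / 2))) \<le> \<epsilon> n * v n / 6 + (v n)\<^sup>2 / 4"
          using iexp_expectation_approx[OF V[OF j], of "\<epsilon> n"] elim(1) j mean[OF j]
          unfolding \<phi>_def var[OF j] by blast
      qed
      also have "\<dots> = real n * v n * (\<epsilon> n / 6 + v n / 4)"
        by (simp add: algebra_simps power2_eq_square)
      finally show ?case by simp
    qed
  qed
  moreover have "(\<lambda>n. (of_real (exp (- v n / 2)) :: complex) ^ n) \<longlonglongrightarrow> of_real (exp (- \<sigma> / 2))"
  proof -
    have "(\<lambda>n. of_real (exp (- (real n * v n) / 2)) :: complex) \<longlonglongrightarrow> of_real (exp (- \<sigma> / 2))"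
      by (intro tendsto_intros v) simp
    then show ?thesis
      by (simp add: of_real_power[symmetric] exp_of_nat_mult[symmetric] del: of_real_power of_real_exp)
  qed
  ultimately have "(\<lambda>n. ((\<Prod>j\<in>{1..n}. \<phi> n j) - (of_real (exp (- v n / 2))) ^ n) + (of_real (exp (- v n / 2))) ^ n)
      \<longlonglongrightarrow> 0 + of_real (exp (- \<sigma> / 2))"
    by (rule tendsto_add)
  then show ?thesis unfolding prod by simp
qed

section \<open>Comparison of random sequences in probability\<close>

text \<open>A lemma of Ghosh. If Y and W differ by more than e, then some point of a grid of width e / 3
separates them with a gap of at least half the width; while W stays in a bounded interval, finitely
many grid points suffice. So it is enough to exclude the separation at each fixed level s.\<close>

lemma (in prob_space) diff_tendsto_0_in_prob:
  fixes Y W :: "nat \<Rightarrow> 'a \<Rightarrow> real"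
  assumes Y[measurable]: "\<And>n. Y n \<in> borel_measurable M" and W[measurable]: "\<And>n. W n \<in> borel_measurable M"
    and tight: "\<And>e. 0 < e \<Longrightarrow> \<exists>R. \<forall>\<^sub>F n in sequentially. prob {\<omega> \<in> space M. R < \<bar>W n \<omega>\<bar>} < e"
    and up: "\<And>s e. 0 < e \<Longrightarrow> (\<lambda>n. prob {\<omega> \<in> space M. W n \<omega> < s - e \<and> s < Y n \<omega>}) \<longlonglongrightarrow> 0"
    and down: "\<And>s e. 0 < e \<Longrightarrow> (\<lambda>n. prob {\<omega> \<in> space M. s + e < W n \<omega> \<and> Y n \<omega> \<le> s}) \<longlonglongrightarrow> 0"
    and e: "0 < e"
  shows "(\<lambda>n. prob {\<omega> \<in> space M. e < \<bar>Y n \<omega> - W n \<omega>\<bar>}) \<longlonglongrightarrow> 0"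
proof (rule tendstoI)
  fix r :: real assume r: "0 < r"
  obtain R where R: "\<forall>\<^sub>F n in sequentially. prob {\<omega> \<in> space M. R < \<bar>W n \<omega>\<bar>} < r / 2"
    using tight[of "r / 2"] r by auto
  define h where "h = e / 3"
  have h: "0 < h" using e by (simp add: h_def)
  define L where "L = {- (\<lceil>\<bar>R\<bar> / h\<rceil> + 3) .. \<lceil>\<bar>R\<bar> / h\<rceil> + 3}"
  define A where "A n l = {\<omega> \<in> space M. W n \<omega> < of_int l * h - h / 2 \<and> of_int l * h < Y n \<omega>}" for n and l :: int
  define B where "B n l = {\<omega> \<in> space M. of_int l * h + h / 2 < W n \<omega> \<and> Y n \<omega> \<le> of_int l * h}" for n and l :: int
  have meas: "A n l \<in> events" "B n l \<in> events" for n l unfolding A_def B_def by measurable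
  have cover: "{\<omega> \<in> space M. e < \<bar>Y n \<omega> - W n \<omega>\<bar>} \<subseteq>
      {\<omega> \<in> space M. R < \<bar>W n \<omega>\<bar>} \<union> (\<Union>l\<in>L. A n l \<union> B n l)" for n
  proof
    fix \<omega> assume \<omega>: "\<omega> \<in> {\<omega> \<in> space M. e < \<bar>Y n \<omega> - W n \<omega>\<bar>}"
    define l where "l = \<lfloor>W n \<omega> / h\<rfloor>"
    have l: "of_int l * h \<le> W n \<omega>" "W n \<omega> < (of_int l + 1) * h"
      using h by (simp_all add: l_def floor_le_iff[symmetric] pos_le_divide_eq[symmetric] pos_divide_less_eq[symmetric])
    have e3: "e = 3 * h" by (simp add: h_def)
    show "\<omega> \<in> {\<omega> \<in> space M. R < \<bar>W n \<omega>\<bar>} \<union> (\<Union>l\<in>L. A n l \<union> B n l)"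
    proof (cases "R < \<bar>W n \<omega>\<bar>")
      case True
      then show ?thesis using \<omega> by simp
    next
      case False
      then have "\<bar>W n \<omega>\<bar> \<le> \<bar>R\<bar>" by linarith
      then have "\<bar>W n \<omega> / h\<bar> \<le> \<bar>R\<bar> / h" using h by (simp add: divide_right_mono)
      then have "l + 2 \<in> L" "l - 1 \<in> L" unfolding L_def l_def by (auto; linarith)+
      moreover have "\<omega> \<in> A n (l + 2) \<or> \<omega> \<in> B n (l - 1)"
      proof (cases "W n \<omega> < Y n \<omega>")
        case True
        then have "W n \<omega> + 3 * h < Y n \<omega>" using \<omega> e3 by auto
        then show ?thesis using \<omega> l h by (auto simp: A_def algebra_simps)
      next
        case False
        then have "Y n \<omega> + 3 * h < W n \<omega>" using \<omega> e3 by auto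
        then show ?thesis using \<omega> l h by (auto simp: B_def algebra_simps)
      qed
      ultimately show ?thesis by blast
    qed
  qed
  have "(\<lambda>n. \<Sum>l\<in>L. prob (A n l) + prob (B n l)) \<longlonglongrightarrow> (\<Sum>l\<in>L. 0 + 0)"
    unfolding A_def B_def using h by (intro tendsto_sum tendsto_add up down) auto
  then have "\<forall>\<^sub>F n in sequentially. (\<Sum>l\<in>L. prob (A n l) + prob (B n l)) < r / 2"
    using r by (intro order_tendstoD(2)) auto
  with R show "\<forall>\<^sub>F n in sequentially. dist (prob {\<omega> \<in> space M. e < \<bar>Y n \<omega> - W n \<omega>\<bar>}) 0 < r"
  proof eventually_elim
    case (elim n)
    have "prob {\<omega> \<in> space M. e < \<bar>Y n \<omega> - W n \<omega>\<bar>} \<le> prob ({\<omega> \<in> space M. R < \<bar>W n \<omega>\<bar>} \<union> (\<Union>l\<in>L. A n l \<union> B n l))"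
      using meas by (intro finite_measure_mono cover) (auto simp: L_def)
    also have "\<dots> \<le> prob {\<omega> \<in> space M. R < \<bar>W n \<omega>\<bar>} + prob (\<Union>l\<in>L. A n l \<union> B n l)"
      using meas by (intro measure_Un_le) (auto simp: L_def)
    also have "prob (\<Union>l\<in>L. A n l \<union> B n l) \<le> (\<Sum>l\<in>L. prob (A n l \<union> B n l))"
      using meas by (intro measure_UNION_le) (auto simp: L_def)
    also have "\<dots> \<le> (\<Sum>l\<in>L. prob (A n l) + prob (B n l))"
      using meas by (intro sum_mono measure_Un_le) auto
    finally show ?case using elim by simp
  qed
qed

section \<open>Normal laws with a prescribed covariance matrix\<close>

text \<open>The factor is built by eliminating one index m at a time, as in a Cholesky decomposition: the Schur
complement K' is again positive semidefinite, as one sees by minimizing the quadratic form in the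
coordinate t m. If the pivot K m m is 0, then so is its whole column, and division by 0 yields K' = K, as it should.\<close>

lemma psd_factorization:
  fixes K :: "'i \<Rightarrow> 'i \<Rightarrow> real"
  assumes "finite I"
    and "\<And>i j. K i j = K j i"
    and "\<And>t. 0 \<le> (\<Sum>i\<in>I. \<Sum>j\<in>I. t i * t j * K i j)"
  shows "\<exists>A. \<forall>i\<in>I. \<forall>j\<in>I. K i j = (\<Sum>l\<in>I. A i l * A j l)"
  using assms
proof (induction I arbitrary: K rule: finite_induct)
  case empty
  then show ?case by simp
next
  case (insert m I)
  define s where "s t = (\<Sum>i\<in>I. t i * K i m)" for t
  define Q where "Q t = (\<Sum>i\<in>I. \<Sum>j\<in>I. t i * t j * K i j)" for t
  have form: "(\<Sum>i\<in>insert m I. \<Sum>j\<in>insert m I. t i * t j * K i j)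
      = (t m)\<^sup>2 * K m m + 2 * t m * s t + Q t" for t
  proof -
    have "(\<Sum>j\<in>I. t m * t j * K m j) = t m * s t"
      unfolding s_def sum_distrib_left by (intro sum.cong) (simp_all add: insert.prems(1)[of m])
    moreover have "(\<Sum>i\<in>I. t i * t m * K i m) = t m * s t"
      unfolding s_def sum_distrib_left by (intro sum.cong) simp_all
    ultimately show ?thesis
      using insert.hyps by (simp add: sum.distrib Q_def power2_eq_square)
  qed
  have nonneg: "0 \<le> (t m)\<^sup>2 * K m m + 2 * t m * s t + Q t" for t
    using insert.prems(2)[of t] unfolding form .
  have upd: "s (t(m := x)) = s t" "Q (t(m := x)) = Q t" for t x
    using insert.hyps(2) unfolding s_def Q_def by (intro sum.cong refl; auto)+
  have mm: "0 \<le> K m m"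
    using nonneg[of "\<lambda>i. if i = m then 1 else 0"] insert.hyps(2)
    by (simp add: s_def Q_def sum.neutral)
  have degenerate: "K i m = 0" if "K m m = 0" "i \<in> I" for i
  proof (rule ccontr)
    assume ne: "K i m \<noteq> 0"
    define t where "t = (\<lambda>j. if j = i then 1 else (0::real))"
    have "s t = K i m" "Q t = K i i"
      unfolding s_def Q_def t_def using that(2) insert.hyps(1)
      by (simp_all add: if_distrib[of "\<lambda>x. x * _"] if_distrib[of "(*) _"] sum.delta cong: if_cong)
    then have "0 \<le> 2 * x * K i m + K i i" for x
      using nonneg[of "t(m := x)"] that(1) by (simp add: upd)
    \<comment> \<open>A nonconstant affine function of x takes the value -1 somewhere.\<close>
    from this[of "- (K i i + 1) / (2 * K i m)"] show False using ne by (simp add: field_simps)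
  qed
  define K' where "K' i j = K i j - K i m * K j m / K m m" for i j
  have "\<exists>A. \<forall>i\<in>I. \<forall>j\<in>I. K' i j = (\<Sum>l\<in>I. A i l * A j l)"
  proof (rule insert.IH)
    show "K' i j = K' j i" for i j
      using insert.prems(1)[of i j] by (simp add: K'_def mult.commute)
    show "0 \<le> (\<Sum>i\<in>I. \<Sum>j\<in>I. t i * t j * K' i j)" for t
    proof -
      have "(\<Sum>i\<in>I. \<Sum>j\<in>I. t i * t j * K' i j) = Q t - s t * s t / K m m"
        by (simp add: K'_def Q_def s_def algebra_simps sum_subtractf sum_product sum_divide_distrib)
      also have "\<dots> = (- s t / K m m)\<^sup>2 * K m m + 2 * (- s t / K m m) * s t + Q t"
        by (simp add: field_simps power2_eq_square)
      also have "\<dots> \<ge> 0"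
        using nonneg[of "t(m := - s t / K m m)"] by (simp only: upd fun_upd_same)
      finally show ?thesis .
    qed
  qed
  then obtain A where A: "\<And>i j. i \<in> I \<Longrightarrow> j \<in> I \<Longrightarrow> K' i j = (\<Sum>l\<in>I. A i l * A j l)"
    by blast
  define A' where "A' i l = (if l = m then if i = m then sqrt (K m m) else K i m / sqrt (K m m)
      else if i = m then 0 else A i l)" for i l
  have "K i j = (\<Sum>l\<in>insert m I. A' i l * A' j l)" if "i \<in> insert m I" "j \<in> insert m I" for i j
  proof -
    have "(\<Sum>l\<in>I. A' i l * A' j l) = (if i = m \<or> j = m then 0 else \<Sum>l\<in>I. A i l * A j l)"
      using insert.hyps(2) by (auto simp: A'_def intro!: sum.neutral sum.cong)
    moreover have "sqrt (K m m) * (K i m / sqrt (K m m)) = K i m" if "i \<in> I" for i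
      using degenerate[OF _ that] by (cases "K m m = 0") auto
    ultimately show ?thesis
      using that insert.hyps mm A[of i j] insert.prems(1)[of m j]
      by (auto simp: A'_def K'_def mult.commute)
  qed
  then show ?case by blast
qed

lemma char_normal_law:
  assumes "0 \<le> v"
  shows "char (normal_law 0 v) s = of_real (exp (- (v * s\<^sup>2) / 2))"
    and "real_distribution (normal_law 0 v)"
proof -
  have *: "char (normal_law 0 v) s = of_real (exp (- (v * s\<^sup>2) / 2)) \<and> real_distribution (normal_law 0 v)"
  proof (cases "v = 0")
    case True
    then show ?thesis
      by (auto simp: normal_law_def char_def integral_return real_distribution_def
          real_distribution_axioms_def prob_space_return)
  next
    case False
    interpret N: prob_space std_normal_distribution
      by (rule prob_space_normal_density) simp
    have "distributed std_normal_distribution lborel (\<lambda>x. x) std_normal_density"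
      by (simp add: distributed_def distr_id2)
    from N.normal_density_affine[OF this, of "sqrt v" 0]
    have "distr std_normal_distribution lborel (\<lambda>x. sqrt v * x) = normal_law 0 v"
      using False assms by (simp add: distributed_def normal_law_def)
    then have eq: "normal_law 0 v = distr std_normal_distribution borel (\<lambda>x. sqrt v * x)"
      by (metis distr_cong sets_lborel)
    have "char (normal_law 0 v) s = char std_normal_distribution (s * sqrt v)"
      unfolding eq char_def by (subst integral_distr) (auto simp: mult.assoc)
    then show ?thesis
      using assms by (simp add: char_std_normal_distribution power_mult_distrib mult.commute eq N.real_distribution_distr)
  qed
  then show "char (normal_law 0 v) s = of_real (exp (- (v * s\<^sup>2) / 2))"
    and "real_distribution (normal_law 0 v)" by auto
qed

text \<open>With S factored as A times its transpose, the law in question is the image under A of a product of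
standard normal laws. Its projections are identified by their characteristic functions.\<close>

lemma mv_normal_exists:
  fixes S :: "real ^ 'd ^ 'd"
  assumes sym: "transpose S = S" and psd: "\<And>t. 0 \<le> t \<bullet> (S *v t)"
  shows "\<exists>\<mu>. mv_normal \<mu> 0 S"
proof -
  have quad: "t \<bullet> (S *v t) = (\<Sum>i\<in>UNIV. \<Sum>j\<in>UNIV. t $ i * t $ j * S $ i $ j)" for t
    by (simp add: inner_vec_def matrix_vector_mult_def sum_distrib_left mult_ac)
  have "\<exists>A. \<forall>i\<in>UNIV. \<forall>j\<in>UNIV. S $ i $ j = (\<Sum>l\<in>(UNIV :: 'd set). A i l * A j l)"
  proof (rule psd_factorization)
    show "S $ i $ j = S $ j $ i" for i j
    proof -
      have "S $ i $ j = transpose S $ i $ j" by (simp only: sym)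
      also have "\<dots> = S $ j $ i" by (simp add: transpose_def)
      finally show ?thesis .
    qed
    show "0 \<le> (\<Sum>i\<in>UNIV. \<Sum>j\<in>UNIV. t i * t j * S $ i $ j)" for t
      using psd[of "\<chi> i. t i"] unfolding quad by simp
  qed simp
  then obtain A where A: "\<And>i j. S $ i $ j = (\<Sum>l\<in>(UNIV :: 'd set). A i l * A j l)" by blast
  define P where "P = (\<Pi>\<^sub>M l\<in>(UNIV :: 'd set). std_normal_distribution)"
  define T :: "('d \<Rightarrow> real) \<Rightarrow> real ^ 'd" where "T g = (\<chi> i. \<Sum>l\<in>UNIV. A i l * g l)" for g
  interpret N: prob_space std_normal_distribution
    by (rule prob_space_normal_density) simp
  interpret P: product_prob_space "\<lambda>_ :: 'd. std_normal_distribution" UNIV ..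
  have T[measurable]: "T \<in> borel_measurable P"
    unfolding T_def P_def 
    by (subst borel_measurable_euclidean_space) (auto simp: Basis_vec_def inner_axis)
  define \<mu> where "\<mu> = distr P borel T"
  interpret PP: prob_space P unfolding P_def by (rule P.prob_space_axioms)
  interpret \<mu>: prob_space \<mu> unfolding \<mu>_def by (rule PP.prob_space_distr) simp
  have "distr \<mu> borel (\<lambda>x. t \<bullet> x) = normal_law 0 (t \<bullet> (S *v t))" for t
  proof (rule Levy_uniqueness)
    show "real_distribution (distr \<mu> borel (\<lambda>x. t \<bullet> x))"
      by (rule \<mu>.real_distribution_distr) (simp add: \<mu>_def)
    show "real_distribution (normal_law 0 (t \<bullet> (S *v t)))"
      by (rule char_normal_law(2)[OF psd])
    define c where "c l = (\<Sum>i\<in>UNIV. t $ i * A i l)" for l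
    have tT: "t \<bullet> T g = (\<Sum>l\<in>UNIV. c l * g l)" for g
      unfolding T_def c_def inner_vec_def 
      by (simp add: sum_distrib_left sum_distrib_right mult.assoc) (rule sum.swap)
    have var: "(\<Sum>l\<in>UNIV. (c l)\<^sup>2) = t \<bullet> (S *v t)"
    proof -
      have "(\<Sum>l\<in>UNIV. (c l)\<^sup>2) = (\<Sum>l\<in>UNIV. \<Sum>i\<in>UNIV. \<Sum>j\<in>UNIV. t $ i * A i l * (t $ j * A j l))"
        by (simp add: c_def power2_eq_square sum_product)
      also have "\<dots> = (\<Sum>i\<in>UNIV. \<Sum>l\<in>UNIV. \<Sum>j\<in>UNIV. t $ i * A i l * (t $ j * A j l))"
        by (rule sum.swap)
      also have "\<dots> = (\<Sum>i\<in>UNIV. \<Sum>j\<in>UNIV. \<Sum>l\<in>UNIV. t $ i * A i l * (t $ j * A j l))"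
        by (intro sum.cong refl sum.swap)
      finally show ?thesis
        unfolding quad A sum_distrib_left by (simp add: mult_ac)
    qed
    show "char (distr \<mu> borel (\<lambda>x. t \<bullet> x)) = char (normal_law 0 (t \<bullet> (S *v t)))"
    proof
      fix s
      have "char (distr \<mu> borel (\<lambda>x. t \<bullet> x)) s = (CLINT g|P. iexp (s * (t \<bullet> T g)))"
        unfolding char_def \<mu>_def by (simp add: integral_distr)
      also have "\<dots> = (CLINT g|P. \<Prod>l\<in>UNIV. iexp (s * c l * g l))"
        unfolding tT by (simp add: sum_distrib_left exp_sum[symmetric] mult_ac)
      also have "\<dots> = (\<Prod>l\<in>UNIV. CLINT x|std_normal_distribution. iexp (s * c l * x))"
        unfolding P_def
        by (intro P.product_integral_prod) (auto intro!: N.integrable_iexp)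
      also have "\<dots> = (\<Prod>l\<in>UNIV. of_real (exp (- ((s * c l)\<^sup>2) / 2)))"
        unfolding char_def[of std_normal_distribution, symmetric] char_std_normal_distribution by simp
      also have "\<dots> = of_real (exp (- ((t \<bullet> (S *v t)) * s\<^sup>2) / 2))"
        unfolding var[symmetric] sum_distrib_right
        by (simp add: of_real_prod[symmetric] exp_sum[symmetric] sum_negf sum_divide_distrib power_mult_distrib mult.commute
            del: of_real_prod of_real_exp)
      finally show "char (distr \<mu> borel (\<lambda>x. t \<bullet> x)) s = char (normal_law 0 (t \<bullet> (S *v t))) s"
        by (simp add: char_normal_law(1)[OF psd])
    qed
  qed
  then have "mv_normal \<mu> 0 S"
    unfolding mv_normal_def using sym psd \<mu>.prob_space_axioms by (simp add: \<mu>_def)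
  then show ?thesis by blast
qed

lemma iexp_integral_mv_normal:
  assumes "mv_normal \<mu> 0 S"
  shows "(CLINT x|\<mu>. iexp (t \<bullet> x)) = of_real (exp (- (t \<bullet> (S *v t)) / 2))"
proof -
  have \<mu>: "sets \<mu> = sets borel" "0 \<le> t \<bullet> (S *v t)"
    and d: "distr \<mu> borel (\<lambda>x. t \<bullet> x) = normal_law 0 (t \<bullet> (S *v t))"
    using assms by (auto simp: mv_normal_def)
  have [measurable]: "(\<lambda>x. t \<bullet> x) \<in> borel_measurable \<mu>"
    by (simp add: measurable_cong_sets[OF \<mu>(1) refl])
  have "(CLINT x|\<mu>. iexp (t \<bullet> x)) = char (distr \<mu> borel (\<lambda>x. t \<bullet> x)) 1"
    unfolding char_def by (simp add: integral_distr)
  then show ?thesis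
    unfolding d by (simp add: char_normal_law(1)[OF \<mu>(2)])
qed

section \<open>Convergence in distribution\<close>

text \<open>Trigonometric polynomials are a convenient class of test functions: their expectations are
determined by the characteristic function, and the product formula for cosines makes them an
algebra. Arbitrary frequencies t are admitted, so that they are in general not periodic.\<close>

inductive trig_poly :: "('b :: euclidean_space \<Rightarrow> real) \<Rightarrow> bool" where
  wave: "trig_poly (\<lambda>x. c * cos (t \<bullet> x + \<theta>))"
| add: "trig_poly f \<Longrightarrow> trig_poly g \<Longrightarrow> trig_poly (\<lambda>x. f x + g x)"

lemma trig_poly_const: "trig_poly (\<lambda>x. c)"
  using wave[of c 0 0] by simp

lemma trig_poly_mult:
  assumes "trig_poly f" "trig_poly g"
  shows "trig_poly (\<lambda>x. f x * g x)"
  using assms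
proof (induction f rule: trig_poly.induct)
  case (wave c t \<theta>)
  from wave show ?case
  proof (induction g rule: trig_poly.induct)
    case (wave c' t' \<theta>')
    have eq: "(\<lambda>x. c * cos (t \<bullet> x + \<theta>) * (c' * cos (t' \<bullet> x + \<theta>'))) =
      (\<lambda>x. (c * c' / 2) * cos ((t - t') \<bullet> x + (\<theta> - \<theta>')) + (c * c' / 2) * cos ((t + t') \<bullet> x + (\<theta> + \<theta>')))"
    proof
      fix x
      have "(t - t') \<bullet> x + (\<theta> - \<theta>') = (t \<bullet> x + \<theta>) - (t' \<bullet> x + \<theta>')"
        "(t + t') \<bullet> x + (\<theta> + \<theta>') = (t \<bullet> x + \<theta>) + (t' \<bullet> x + \<theta>')"
        by (simp_all add: inner_simps)
      then show "c * cos (t \<bullet> x + \<theta>) * (c' * cos (t' \<bullet> x + \<theta>')) =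
         (c * c' / 2) * cos ((t - t') \<bullet> x + (\<theta> - \<theta>')) + (c * c' / 2) * cos ((t + t') \<bullet> x + (\<theta> + \<theta>'))"
        by (simp only: cos_diff cos_add) (simp add: algebra_simps)
    qed
    show ?case unfolding eq by (rule trig_poly.add; rule trig_poly.wave)
  next
    case (add f g)
    then show ?case by (simp add: distrib_left trig_poly.add)
  qed
next
  case (add f1 f2)
  then show ?case by (simp add: distrib_right trig_poly.add)
qed

lemma trig_poly_compose_polynomial:
  assumes "real_polynomial_function q" "trig_poly f"
  shows "trig_poly (\<lambda>x. q (f x))"
  using assms(1)
proof (induction q rule: real_polynomial_function.induct)
  case (linear h)
  then obtain c where "h = (\<lambda>x. x * c)" using real_bounded_linear by blast
  then show ?case using trig_poly_mult[OF assms(2) trig_poly_const] by simp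
qed (auto intro: trig_poly_const trig_poly.add trig_poly_mult)

lemma trig_poly_continuous: "trig_poly f \<Longrightarrow> continuous_on S f"
  by (induction f rule: trig_poly.induct) (auto intro!: continuous_intros)

lemma trig_poly_bounded: "trig_poly f \<Longrightarrow> \<exists>B. \<forall>x. \<bar>f x\<bar> \<le> B"
proof (induction f rule: trig_poly.induct)
  case (wave c t \<theta>)
  have "\<bar>c * cos (t \<bullet> x + \<theta>)\<bar> \<le> \<bar>c\<bar>" for x
    using mult_left_mono[OF abs_cos_le_one, of "\<bar>c\<bar>" "t \<bullet> x + \<theta>"] by (simp add: abs_mult)
  then show ?case by blast
next
  case (add f g)
  then obtain B C where "\<And>x. \<bar>f x\<bar> \<le> B" "\<And>x. \<bar>g x\<bar> \<le> C" by blast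
  then have "\<bar>f x + g x\<bar> \<le> B + C" for x by (meson abs_triangle_ineq add_mono order_trans)
  then show ?case by blast
qed

text \<open>The approximation h that Stone-Weierstrass yields on a ball may be large outside of the
ball. A polynomial q close to truncation at height B on the range of h repairs this, because q
composed with h is again a trigonometric polynomial.\<close>

lemma trig_poly_approx:
  fixes g :: "'b :: euclidean_space \<Rightarrow> real"
  assumes g: "continuous_on UNIV g" "\<And>x. \<bar>g x\<bar> \<le> B" and e: "0 < e"
  shows "\<exists>h. trig_poly h \<and> (\<forall>x. norm x \<le> R \<longrightarrow> \<bar>g x - h x\<bar> < e) \<and> (\<forall>x. \<bar>h x\<bar> \<le> B + e)"
proof -
  have B: "0 \<le> B" using g(2)[of 0] by linarith
  have "\<exists>h. trig_poly h \<and> (\<forall>x\<in>cball 0 R. \<bar>g x - h x\<bar> < e / 2)"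
  proof (rule Stone_Weierstrass_HOL)
    fix x y :: 'b assume "x \<in> cball 0 R \<and> y \<in> cball 0 R \<and> x \<noteq> y"
    then have xy: "(norm (x - y))\<^sup>2 \<noteq> 0" by simp
    define t where "t = (pi / (2 * (norm (x - y))\<^sup>2)) *\<^sub>R (x - y)"
    define h where "h z = 1 * cos (t \<bullet> z + (- (t \<bullet> y)))" for z
    have half_pi: "t \<bullet> x + (- (t \<bullet> y)) = pi / 2"
    proof -
      have "t \<bullet> x + (- (t \<bullet> y)) = t \<bullet> (x - y)" by (simp add: inner_diff_right)
      also have "\<dots> = pi / 2" using xy unfolding t_def inner_scaleR_left power2_norm_eq_inner by simp
      finally show ?thesis .
    qed
    have "h x = 0" unfolding h_def half_pi by simp
    moreover have "h y = 1" by (simp add: h_def)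
    moreover have "trig_poly h" unfolding h_def by (rule wave)
    ultimately show "\<exists>f. trig_poly f \<and> f x \<noteq> f y" by (intro exI[of _ h]) simp
  qed (use g(1) e in \<open>auto intro: trig_poly_const trig_poly.add trig_poly_mult trig_poly_continuous continuous_on_subset\<close>)
  then obtain h where h: "trig_poly h" "\<And>x. norm x \<le> R \<Longrightarrow> \<bar>g x - h x\<bar> < e / 2" by auto
  obtain H where H: "\<And>x. \<bar>h x\<bar> \<le> H" using trig_poly_bounded[OF h(1)] by blast
  define clamp where "clamp y = max (- B) (min B y)" for y :: real
  have "\<exists>q. real_polynomial_function q \<and> (\<forall>y\<in>{-H..H}. \<bar>clamp y - q y\<bar> < e / 2)"
  proof (rule Stone_Weierstrass_HOL)
    show "continuous_on {-H..H} clamp" unfolding clamp_def by (intro continuous_intros)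
    show "\<exists>f. real_polynomial_function f \<and> f x \<noteq> f y" if "x \<in> {-H..H} \<and> y \<in> {-H..H} \<and> x \<noteq> y" for x y
      using that by (intro exI[of _ "\<lambda>x. x"]) (auto intro: real_polynomial_function.intros(1))
    show "continuous_on {-H..H} f" if "real_polynomial_function f" for f
      using that by (simp add: real_polynomial_function_eq continuous_on_polymonial_function)
  qed (use e in auto)
  then obtain q where q: "real_polynomial_function q" "\<And>y. y \<in> {-H..H} \<Longrightarrow> \<bar>clamp y - q y\<bar> < e / 2"
    by blast
  have hH: "h x \<in> {-H..H}" for x using H[of x] by (auto simp: abs_le_iff)
  have "\<bar>g x - q (h x)\<bar> < e" if "norm x \<le> R" for x
  proof -
    have "\<bar>g x - clamp (h x)\<bar> \<le> \<bar>g x - h x\<bar>"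
      using g(2)[of x] by (auto simp: clamp_def)
    then show ?thesis using q(2)[OF hH[of x]] h(2)[OF that] by linarith
  qed
  moreover have "\<bar>q (h x)\<bar> \<le> B + e" for x
  proof -
    have "\<bar>clamp (h x)\<bar> \<le> B" using B by (auto simp: clamp_def)
    then show ?thesis using q(2)[OF hH[of x]] e by linarith
  qed
  ultimately show ?thesis
    using trig_poly_compose_polynomial[OF q(1) h(1)] by blast
qed

lemma (in prob_space) expectation_diff_le:
  fixes u v :: "'a \<Rightarrow> real"
  assumes "integrable M u" "integrable M v" "E \<in> events"
    and "\<And>\<omega>. \<omega> \<in> space M \<Longrightarrow> \<bar>u \<omega> - v \<omega>\<bar> \<le> e + c * indicator E \<omega>"
  shows "\<bar>expectation u - expectation v\<bar> \<le> e + c * prob E"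
proof -
  have "\<bar>expectation u - expectation v\<bar> = \<bar>expectation (\<lambda>\<omega>. u \<omega> - v \<omega>)\<bar>"
    using assms by simp
  also have "\<dots> \<le> expectation (\<lambda>\<omega>. \<bar>u \<omega> - v \<omega>\<bar>)"
    using integral_norm_bound[of M "\<lambda>\<omega>. u \<omega> - v \<omega>"] by simp
  also have "\<dots> \<le> expectation (\<lambda>\<omega>. e + c * indicator E \<omega>)"
    using assms by (intro integral_mono) (auto intro!: integrable_real_indicator simp: emeasure_eq_measure)
  also have "\<dots> = e + c * prob E"
    using assms(3) by (simp add: prob_space emeasure_eq_measure)
  finally show ?thesis .
qed

lemma (in prob_space) trig_poly_expectation_tendsto:
  fixes W :: "nat \<Rightarrow> 'a \<Rightarrow> 'b :: euclidean_space"
  assumes W: "\<And>n. W n \<in> borel_measurable M" and \<mu>: "prob_space \<mu>" "sets \<mu> = sets borel"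
    and lim: "\<And>t. (\<lambda>n. CLINT \<omega>|M. iexp (t \<bullet> W n \<omega>)) \<longlonglongrightarrow> (CLINT x|\<mu>. iexp (t \<bullet> x))"
    and h: "trig_poly h"
  shows "(\<lambda>n. expectation (\<lambda>\<omega>. h (W n \<omega>))) \<longlonglongrightarrow> (\<integral>x. h x \<partial>\<mu>)"
  using h
proof (induction h rule: trig_poly.induct)
  case (wave c t \<theta>)
  have Re: "(\<integral>\<omega>. c * cos (t \<bullet> V \<omega> + \<theta>) \<partial>K) = c * Re (cis \<theta> * (CLINT \<omega>|K. iexp (t \<bullet> V \<omega>)))"
    if K: "prob_space K" and V: "V \<in> borel_measurable K" for K and V :: "'x \<Rightarrow> 'b"
  proof -
    interpret K: prob_space K by fact
    note V[measurable]
    have int: "integrable K (\<lambda>\<omega>. iexp (t \<bullet> V \<omega>))" by (rule K.integrable_iexp) auto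
    have "cis \<theta> * (CLINT \<omega>|K. iexp (t \<bullet> V \<omega>)) = (CLINT \<omega>|K. cis \<theta> * iexp (t \<bullet> V \<omega>))" by simp
    also have "\<dots> = (CLINT \<omega>|K. cis (t \<bullet> V \<omega> + \<theta>))"
      by (simp add: cis_mult cis_conv_exp exp_add[symmetric] algebra_simps)
    also have "Re \<dots> = (\<integral>\<omega>. Re (cis (t \<bullet> V \<omega> + \<theta>)) \<partial>K)"
    proof (rule integral_Re[symmetric])
      have "integrable K (\<lambda>\<omega>. cis \<theta> * iexp (t \<bullet> V \<omega>))" using int by simp
      then show "integrable K (\<lambda>\<omega>. cis (t \<bullet> V \<omega> + \<theta>))"
        by (simp add: cis_mult cis_conv_exp exp_add[symmetric] algebra_simps)
    qed
    finally show ?thesis by simp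
  qed
  have "(\<lambda>x. x) \<in> borel_measurable \<mu>" by (simp add: measurable_cong_sets[OF \<mu>(2) refl])
  from Re[OF \<mu>(1) this] Re[OF prob_space_axioms W] show ?case
    by (simp only:) (intro tendsto_intros lim)
next
  case (add f g)
  interpret \<mu>: prob_space \<mu> by fact
  have int: "integrable M (\<lambda>\<omega>. f (W n \<omega>))" "integrable \<mu> f" if f: "trig_poly f" for f n
  proof -
    obtain B where B: "\<And>x. \<bar>f x\<bar> \<le> B" using trig_poly_bounded[OF f] by blast
    have [measurable]: "f \<in> borel_measurable borel"
      using trig_poly_continuous[OF f] by (rule borel_measurable_continuous_onI)
    note W[measurable]
    show "integrable M (\<lambda>\<omega>. f (W n \<omega>))"
      by (rule integrable_const_bound[where B = B]) (use B in auto)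
    show "integrable \<mu> f"
      by (rule \<mu>.integrable_const_bound[where B = B]) (use B in \<open>auto simp: measurable_cong_sets[OF \<mu>(2) refl]\<close>)
  qed
  show ?case
    using tendsto_add[OF add.IH] int[OF add.hyps(1)] int[OF add.hyps(2)] by simp
qed

text \<open>Convergence of characteristic functions gives the convergence of expectations of trigonometric
polynomials, hence of all bounded continuous functions, since tightness allows one to compare
functions on a large ball only. On such a ball a continuous g is uniformly continuous, which is why
W may be replaced by a sequence Y that is close to it in probability.\<close>

lemma (in prob_space) conv_in_dist_if_iexp_tendsto:
  fixes W Y :: "nat \<Rightarrow> 'a \<Rightarrow> 'b :: euclidean_space"
  assumes W: "\<And>n. W n \<in> borel_measurable M" and Y: "\<And>n. Y n \<in> borel_measurable M"
    and \<mu>: "prob_space \<mu>" "sets \<mu> = sets borel"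
    and lim: "\<And>t. (\<lambda>n. CLINT \<omega>|M. iexp (t \<bullet> W n \<omega>)) \<longlonglongrightarrow> (CLINT x|\<mu>. iexp (t \<bullet> x))"
    and tight: "\<And>e. 0 < e \<Longrightarrow> \<exists>R. \<forall>\<^sub>F n in sequentially. prob {\<omega> \<in> space M. R < norm (W n \<omega>)} < e"
    and YW: "\<And>e. 0 < e \<Longrightarrow> (\<lambda>n. prob {\<omega> \<in> space M. e < norm (Y n \<omega> - W n \<omega>)}) \<longlonglongrightarrow> 0"
  shows "conv_in_dist M Y \<mu>"
  unfolding conv_in_dist_def
proof (intro conjI allI impI Y)
  fix g :: "'b \<Rightarrow> real" assume g: "continuous_on UNIV g" "bounded (range g)"
  interpret \<mu>: prob_space \<mu> by fact
  note W[measurable] Y[measurable]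
  have id[measurable]: "(\<lambda>x. x) \<in> borel_measurable \<mu>" by (simp add: measurable_cong_sets[OF \<mu>(2) refl])
  have sp: "space \<mu> = UNIV" using sets_eq_imp_space_eq[OF \<mu>(2)] by simp
  from g(2) obtain B where B: "\<And>x. \<bar>g x\<bar> \<le> B" by (auto simp: bounded_iff)
  have B0: "0 \<le> B" using B[of 0] by linarith
  have gm[measurable]: "g \<in> borel_measurable borel" using g(1) by (rule borel_measurable_continuous_onI)
  have intg: "integrable K (\<lambda>\<omega>. f (V \<omega>))" if "prob_space K" "V \<in> borel_measurable K" 
     "f \<in> borel_measurable borel" "\<And>x. \<bar>f x\<bar> \<le> C" for K :: "'x measure" and V and f :: "'b \<Rightarrow> real" and C
  proof -
    interpret K: prob_space K by fact
    note that(2,3)[measurable]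
    show ?thesis by (rule K.integrable_const_bound[where B = C]) (use that in auto)
  qed
  show "(\<lambda>n. expectation (\<lambda>\<omega>. g (Y n \<omega>))) \<longlonglongrightarrow> (\<integral>x. g x \<partial>\<mu>)"
  proof (rule tendstoI)
    fix e0 :: real assume "0 < e0"
    define C where "C = 2 * B + 1"
    have C: "C > 0" using B0 by (simp add: C_def)
    \<comment> \<open>C bounds all differences of values of g and h. Passing from Y to W costs at most
      e + 2 C e, exchanging g for h costs e + C e twice, and the expectations of h differ by e.\<close>
    define e where "e = min 1 (e0 / (5 + 4 * C))"
    have e: "0 < e" "e \<le> 1" "(4 + 4 * C) * e < e0"
    proof -
      show "0 < e" "e \<le> 1" using \<open>0 < e0\<close> C by (simp_all add: e_def)
      then have "(4 + 4 * C) * e < (5 + 4 * C) * e" using C by simp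
      also have "\<dots> \<le> (5 + 4 * C) * (e0 / (5 + 4 * C))"
        using C by (intro mult_left_mono) (auto simp: e_def)
      also have "\<dots> = e0" using C by simp
      finally show "(4 + 4 * C) * e < e0" .
    qed
    have ball_borel: "{x :: 'b. r < norm x} \<in> sets borel" for r by simp
    obtain R1 where R1: "\<forall>\<^sub>F n in sequentially. prob {\<omega> \<in> space M. R1 < norm (W n \<omega>)} < e"
      using tight[OF e(1)] by blast
    obtain R2 where R2: "measure \<mu> {x. R2 < norm x} < e"
    proof -
      have "(\<lambda>n. measure \<mu> {x. real n < norm x}) \<longlonglongrightarrow> measure \<mu> (\<Inter>n. {x. real n < norm x})"
      proof (rule \<mu>.finite_Lim_measure_decseq)
        show "range (\<lambda>n. {x. real n < norm x}) \<subseteq> sets \<mu>"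
          using ball_borel unfolding \<mu>(2) by blast
        show "decseq (\<lambda>n. {x :: 'b. real n < norm x})"
          by (rule decseq_SucI) auto
      qed
      also have "(\<Inter>n. {x :: 'b. real n < norm x}) = {}"
      proof -
        have "\<exists>n. \<not> real n < norm x" for x :: 'b
        proof -
          obtain n where "norm x < real n" using reals_Archimedean2 by blast
          then show ?thesis by (intro exI[of _ n]) simp
        qed
        then show ?thesis by blast
      qed
      finally have "(\<lambda>n. measure \<mu> {x. real n < norm x}) \<longlonglongrightarrow> 0" by simp
      from order_tendstoD(2)[OF this e(1)] show ?thesis
        using eventually_happens'[OF trivial_limit_sequentially] that by fast
    qed
    define R where "R = max R1 R2"
    have W_R: "\<forall>\<^sub>F n in sequentially. prob {\<omega> \<in> space M. R < norm (W n \<omega>)} < e"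
      using R1
    proof eventually_elim
      case (elim n)
      have "prob {\<omega> \<in> space M. R < norm (W n \<omega>)} \<le> prob {\<omega> \<in> space M. R1 < norm (W n \<omega>)}"
        by (rule finite_measure_mono) (auto simp: R_def)
      then show ?case using elim by simp
    qed
    have "measure \<mu> {x. R < norm x} \<le> measure \<mu> {x. R2 < norm x}"
      by (rule \<mu>.finite_measure_mono) (auto simp: R_def \<mu>(2) ball_borel)
    then have \<mu>_R: "measure \<mu> {x. R < norm x} < e" using R2 by simp
    obtain h where h: "trig_poly h" "\<And>x. norm x \<le> R \<Longrightarrow> \<bar>g x - h x\<bar> < e" "\<And>x. \<bar>h x\<bar> \<le> B + e"
      using trig_poly_approx[OF g(1) B e(1), of R] by blast
    have [measurable]: "h \<in> borel_measurable borel"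
      using trig_poly_continuous[OF h(1)] by (rule borel_measurable_continuous_onI)
    have gh: "\<bar>g x - h x\<bar> \<le> e + C * indicator {x. R < norm x} x" for x
    proof (cases "norm x \<le> R")
      case True
      then show ?thesis using h(2)[OF True] by (auto simp: indicator_def)
    next
      case False
      have "\<bar>g x - h x\<bar> \<le> C" using B[of x] h(3)[of x] e(2) unfolding C_def by linarith
      then show ?thesis using False e(1) by (simp add: indicator_def)
    qed
    have W_gh: "\<bar>expectation (\<lambda>\<omega>. g (W n \<omega>)) - expectation (\<lambda>\<omega>. h (W n \<omega>))\<bar>
        \<le> e + C * prob {\<omega> \<in> space M. R < norm (W n \<omega>)}" for n
      by (rule expectation_diff_le)
         (use gh[of "W n _"] in \<open>auto intro!: intg prob_space_axioms B h(3) simp: indicator_def\<close>)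
    have \<mu>_gh: "\<bar>(\<integral>x. g x \<partial>\<mu>) - (\<integral>x. h x \<partial>\<mu>)\<bar> \<le> e + C * measure \<mu> {x. R < norm x}"
      by (rule \<mu>.expectation_diff_le)
         (use gh ball_borel \<mu>(2) in \<open>auto intro!: intg[of _ "\<lambda>x. x"] \<mu>(1) id B h(3)\<close>)
    have "uniformly_continuous_on (cball 0 (R + 1)) g"
      by (rule compact_uniformly_continuous) (auto intro: continuous_on_subset[OF g(1)])
    then obtain d where d: "0 < d" "\<And>x y. x \<in> cball 0 (R + 1) \<Longrightarrow> y \<in> cball 0 (R + 1) \<Longrightarrow> dist y x < d \<Longrightarrow> dist (g y) (g x) < e"
      using e(1) unfolding uniformly_continuous_on_def by blast
    define d' where "d' = min 1 (d / 2)"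
    have d': "0 < d'" "d' \<le> 1" "d' < d" using d(1) by (auto simp: d'_def)
    have YW_g: "\<bar>expectation (\<lambda>\<omega>. g (Y n \<omega>)) - expectation (\<lambda>\<omega>. g (W n \<omega>))\<bar>
        \<le> e + C * prob ({\<omega> \<in> space M. R < norm (W n \<omega>)} \<union> {\<omega> \<in> space M. d' < norm (Y n \<omega> - W n \<omega>)})" for n
    proof (rule expectation_diff_le)
      fix \<omega> assume \<omega>: "\<omega> \<in> space M"
      show "\<bar>g (Y n \<omega>) - g (W n \<omega>)\<bar> \<le> e + C * indicator
          ({\<omega> \<in> space M. R < norm (W n \<omega>)} \<union> {\<omega> \<in> space M. d' < norm (Y n \<omega> - W n \<omega>)}) \<omega>"
      proof (cases "norm (W n \<omega>) \<le> R \<and> norm (Y n \<omega> - W n \<omega>) \<le> d'")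
        case True
        have "norm (Y n \<omega>) \<le> norm (W n \<omega>) + norm (Y n \<omega> - W n \<omega>)"
          using norm_triangle_ineq[of "W n \<omega>" "Y n \<omega> - W n \<omega>"] by simp
        then have "dist (g (Y n \<omega>)) (g (W n \<omega>)) < e"
          using True d' by (intro d(2)) (auto simp: dist_norm)
        then show ?thesis using True by (auto simp: dist_real_def indicator_def)
      next
        case False
        have "\<bar>g (Y n \<omega>) - g (W n \<omega>)\<bar> \<le> C" using B[of "Y n \<omega>"] B[of "W n \<omega>"] unfolding C_def by linarith
        then show ?thesis using False \<omega> e(1) by (auto simp: indicator_def)
      qed
    qed (auto intro!: intg prob_space_axioms B)
    have YW': "\<forall>\<^sub>F n in sequentially. prob {\<omega> \<in> space M. d' < norm (Y n \<omega> - W n \<omega>)} < e"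
      by (rule order_tendstoD(2)[OF YW[OF d'(1)] e(1)])
    have hlim: "\<forall>\<^sub>F n in sequentially. dist (expectation (\<lambda>\<omega>. h (W n \<omega>))) (\<integral>x. h x \<partial>\<mu>) < e"
      using trig_poly_expectation_tendsto[OF W \<mu> lim h(1)] e(1) by (rule tendstoD)
    show "\<forall>\<^sub>F n in sequentially. dist (expectation (\<lambda>\<omega>. g (Y n \<omega>))) (\<integral>x. g x \<partial>\<mu>) < e0"
      using W_R YW' hlim
    proof eventually_elim
      case (elim n)
      have "prob ({\<omega> \<in> space M. R < norm (W n \<omega>)} \<union> {\<omega> \<in> space M. d' < norm (Y n \<omega> - W n \<omega>)}) \<le> 
          prob {\<omega> \<in> space M. R < norm (W n \<omega>)} + prob {\<omega> \<in> space M. d' < norm (Y n \<omega> - W n \<omega>)}"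
        by (rule measure_Un_le) auto
      also have "\<dots> \<le> 2 * e" using elim by linarith
      finally have "C * prob ({\<omega> \<in> space M. R < norm (W n \<omega>)} \<union> {\<omega> \<in> space M. d' < norm (Y n \<omega> - W n \<omega>)}) \<le> C * (2 * e)"
        using C by (intro mult_left_mono) auto
      then have U: "\<bar>expectation (\<lambda>\<omega>. g (Y n \<omega>)) - expectation (\<lambda>\<omega>. g (W n \<omega>))\<bar> \<le> e + C * (2 * e)"
        using YW_g[of n] by linarith
      have V: "\<bar>expectation (\<lambda>\<omega>. g (W n \<omega>)) - expectation (\<lambda>\<omega>. h (W n \<omega>))\<bar> \<le> e + C * e"
        using W_gh[of n] mult_left_mono[OF less_imp_le[OF elim(1)] less_imp_le[OF C]] by linarith
      have "\<bar>(\<integral>x. g x \<partial>\<mu>) - (\<integral>x. h x \<partial>\<mu>)\<bar> \<le> e + C * e"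
        using \<mu>_gh mult_left_mono[OF less_imp_le[OF \<mu>_R] less_imp_le[OF C]] by linarith
      then have "\<bar>expectation (\<lambda>\<omega>. g (Y n \<omega>)) - (\<integral>x. g x \<partial>\<mu>)\<bar> < (4 + 4 * C) * e"
        using U V elim(3) unfolding dist_real_def by (simp add: algebra_simps)
      then show ?case using e(3) by (simp add: dist_real_def)
    qed
  qed
qed

section \<open>Intermediate order statistics and exceedance counts\<close>

lemma borel_measurable_vec_lambda:
  fixes f :: "'i::finite \<Rightarrow> 'b \<Rightarrow> real"
  assumes "\<And>i. f i \<in> borel_measurable K"
  shows "(\<lambda>\<omega>. \<chi> i. f i \<omega>) \<in> borel_measurable K"
  using assms by (subst borel_measurable_euclidean_space) (auto simp: Basis_vec_def inner_axis)

lemma (in prob_space) prob_abs_gt_le: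
  fixes Z :: "'a \<Rightarrow> real"
  assumes Z: "Z \<in> borel_measurable M" "integrable M (\<lambda>\<omega>. (Z \<omega>)\<^sup>2)" and R: "0 < R"
  shows "prob {\<omega> \<in> space M. R < \<bar>Z \<omega>\<bar>} \<le> expectation (\<lambda>\<omega>. (Z \<omega>)\<^sup>2) / R\<^sup>2"
proof -
  note Z(1)[measurable]
  let ?E = "{\<omega> \<in> space M. R < \<bar>Z \<omega>\<bar>}"
  have "R\<^sup>2 * prob ?E = expectation (\<lambda>\<omega>. R\<^sup>2 * indicat_real ?E \<omega>)" by simp
  also have "\<dots> \<le> expectation (\<lambda>\<omega>. (Z \<omega>)\<^sup>2)"
  proof (rule integral_mono)
    show "R\<^sup>2 * indicat_real ?E \<omega> \<le> (Z \<omega>)\<^sup>2" if "\<omega> \<in> space M" for \<omega>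
      using R power_mono[of R "\<bar>Z \<omega>\<bar>" 2] by (auto simp: indicator_def)
  qed (use Z in \<open>auto intro!: integrable_mult_right integrable_real_indicator simp: emeasure_eq_measure\<close>)
  finally show ?thesis using R by (simp add: pos_le_divide_eq mult.commute)
qed

lemma (in prob_space) tight_if_second_moment_bounded:
  fixes Z :: "nat \<Rightarrow> 'a \<Rightarrow> real"
  assumes Z: "\<And>n. Z n \<in> borel_measurable M" "\<And>n. integrable M (\<lambda>\<omega>. (Z n \<omega>)\<^sup>2)"
    and B: "\<forall>\<^sub>F n in sequentially. expectation (\<lambda>\<omega>. (Z n \<omega>)\<^sup>2) \<le> B" and e: "0 < e"
  shows "\<exists>R. \<forall>\<^sub>F n in sequentially. prob {\<omega> \<in> space M. R < \<bar>Z n \<omega>\<bar>} < e"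
proof -
  define R where "R = sqrt ((\<bar>B\<bar> + 1) / e)"
  have R: "0 < R" "R\<^sup>2 = (\<bar>B\<bar> + 1) / e" using e by (simp_all add: R_def)
  show ?thesis
  proof (intro exI[of _ R], use B in eventually_elim)
    case (elim n)
    have "prob {\<omega> \<in> space M. R < \<bar>Z n \<omega>\<bar>} \<le> expectation (\<lambda>\<omega>. (Z n \<omega>)\<^sup>2) / R\<^sup>2"
      by (rule prob_abs_gt_le[OF Z R(1)])
    also have "\<dots> < (\<bar>B\<bar> + 1) / R\<^sup>2"
      using elim R(1) by (intro divide_strict_right_mono) auto
    also have "\<dots> = e" unfolding R(2) using e by (simp add: field_simps)
    finally show ?case .
  qed
qed

text \<open>The indicator of an exceedance of u by the i-th component, minus its probability when V has
distribution function F.\<close>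

definition exceed_dev :: "(real ^ 'd \<Rightarrow> real) \<Rightarrow> ('a \<Rightarrow> real ^ 'd) \<Rightarrow> 'd \<Rightarrow> real \<Rightarrow> 'a \<Rightarrow> real" where
  "exceed_dev F V i u \<omega> = (if u < V \<omega> $ i then 1 else 0) - (1 - margin F i u)"

context prob_space
begin

context
  fixes F :: "real ^ 'd \<Rightarrow> real" and V
  assumes V: "has_dist_fun M V F"
begin

lemma component_measurable[measurable]: "(\<lambda>\<omega>. V \<omega> $ i) \<in> borel_measurable M"
  by (rule has_dist_fun_borel_measurable[OF V])

lemma exceed_dev_measurable: "exceed_dev F V i u \<in> borel_measurable M"
  unfolding exceed_dev_def by measurable

lemma margin_bounds: "0 \<le> margin F i u" "margin F i u \<le> 1"
  unfolding margin_eq_prob[OF V] by auto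

lemma exceed_dev_bound: "\<bar>exceed_dev F V i u \<omega>\<bar> \<le> 1"
  using margin_bounds[of i u] unfolding exceed_dev_def by auto

lemma exceed_prob: "prob {\<omega> \<in> space M. u < V \<omega> $ i} = 1 - margin F i u"
proof -
  have "{\<omega> \<in> space M. u < V \<omega> $ i} = space M - {\<omega> \<in> space M. V \<omega> $ i \<le> u}" by auto
  then show ?thesis unfolding margin_eq_prob[OF V] by (simp add: prob_compl)
qed

lemma exceed_dev_alt:
  "\<omega> \<in> space M \<Longrightarrow> exceed_dev F V i u \<omega> = indicat_real {\<omega> \<in> space M. u < V \<omega> $ i} \<omega> - (1 - margin F i u)"
  by (simp add: exceed_dev_def)

lemma expectation_exceed_dev: "expectation (exceed_dev F V i u) = 0"
proof -
  have "expectation (exceed_dev F V i u) = expectation (\<lambda>\<omega>. indicat_real {\<omega> \<in> space M. u < V \<omega> $ i} \<omega> - (1 - margin F i u))"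
    by (intro Bochner_Integration.integral_cong refl exceed_dev_alt)
  also have "\<dots> = 0"
    by (subst Bochner_Integration.integral_diff) 
       (auto simp: exceed_prob prob_space intro!: integrable_real_indicator simp: emeasure_eq_measure)
  finally show ?thesis .
qed

lemma expectation_exceed_dev_mult:
  "expectation (\<lambda>\<omega>. exceed_dev F V i u \<omega> * exceed_dev F V l t \<omega>) =
    prob {\<omega> \<in> space M. u < V \<omega> $ i \<and> t < V \<omega> $ l} - (1 - margin F i u) * (1 - margin F l t)"
proof -
  let ?A = "{\<omega> \<in> space M. u < V \<omega> $ i}" and ?B = "{\<omega> \<in> space M. t < V \<omega> $ l}"
  have int: "integrable M (exceed_dev F V l t)"
    by (rule integrable_const_bound[where B = 1]) (use exceed_dev_bound exceed_dev_measurable in auto)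
  have "exceed_dev F V i u \<omega> * exceed_dev F V l t \<omega> = 
     indicat_real (?A \<inter> ?B) \<omega> - (1 - margin F l t) * indicat_real ?A \<omega> - (1 - margin F i u) * exceed_dev F V l t \<omega>"
    if "\<omega> \<in> space M" for \<omega>
    using that by (auto simp: exceed_dev_def indicator_def algebra_simps)
  then have "expectation (\<lambda>\<omega>. exceed_dev F V i u \<omega> * exceed_dev F V l t \<omega>) = 
     expectation (\<lambda>\<omega>. indicat_real (?A \<inter> ?B) \<omega> - (1 - margin F l t) * indicat_real ?A \<omega> - (1 - margin F i u) * exceed_dev F V l t \<omega>)"
    by (intro Bochner_Integration.integral_cong refl)
  also have "\<dots> = prob (?A \<inter> ?B) - (1 - margin F l t) * prob ?A - (1 - margin F i u) * expectation (exceed_dev F V l t)"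
    using int by (subst Bochner_Integration.integral_diff, auto simp: emeasure_eq_measure intro!: integrable_real_indicator integrable_mult_right)+
  also have "?A \<inter> ?B = {\<omega> \<in> space M. u < V \<omega> $ i \<and> t < V \<omega> $ l}" by auto
  finally show ?thesis by (simp add: expectation_exceed_dev exceed_prob mult.commute)
qed

lemma expectation_exceed_dev_square_le:
  "expectation (\<lambda>\<omega>. (exceed_dev F V i u \<omega>)\<^sup>2) \<le> 1 - margin F i u"
  using expectation_exceed_dev_mult[of i u i u] exceed_prob[of u i] by (simp add: power2_eq_square)

text \<open>The difference is, up to sign, the centered indicator of the event that the component falls between
the two levels, and its variance is at most the probability of that event.\<close>

lemma expectation_exceed_dev_diff_square_le:
  "expectation (\<lambda>\<omega>. (exceed_dev F V i u \<omega> - exceed_dev F V i t \<omega>)\<^sup>2) \<le> \<bar>margin F i u - margin F i t\<bar>"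
proof -
  have wlog: "expectation (\<lambda>\<omega>. (exceed_dev F V i u \<omega> - exceed_dev F V i t \<omega>)\<^sup>2) \<le> margin F i t - margin F i u"
    if "u \<le> t" for u t
  proof -
    let ?u = "exceed_dev F V i u" and ?t = "exceed_dev F V i t"
    have int: "integrable M (\<lambda>\<omega>. exceed_dev F V i x \<omega> * exceed_dev F V i y \<omega>)" for x y
      by (rule integrable_const_bound[where B = 1])
         (use exceed_dev_bound exceed_dev_measurable in \<open>auto simp: abs_mult intro!: mult_le_one\<close>)
    have "expectation (\<lambda>\<omega>. (?u \<omega> - ?t \<omega>)\<^sup>2) = expectation (\<lambda>\<omega>. ?u \<omega> * ?u \<omega> - 2 * (?u \<omega> * ?t \<omega>) + ?t \<omega> * ?t \<omega>)"
      by (simp add: power2_eq_square algebra_simps)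
    also have "\<dots> = expectation (\<lambda>\<omega>. ?u \<omega> * ?u \<omega>) - 2 * expectation (\<lambda>\<omega>. ?u \<omega> * ?t \<omega>) + expectation (\<lambda>\<omega>. ?t \<omega> * ?t \<omega>)"
      using int by simp
    also have "\<dots> = (margin F i t - margin F i u) - (margin F i t - margin F i u)\<^sup>2"
    proof -
      have "{\<omega> \<in> space M. u < V \<omega> $ i \<and> t < V \<omega> $ i} = {\<omega> \<in> space M. t < V \<omega> $ i}" using that by auto
      then show ?thesis
        unfolding expectation_exceed_dev_mult by (simp add: exceed_prob algebra_simps power2_eq_square)
    qed
    finally show ?thesis by (simp add: add_increasing2)
  qed
  show ?thesis
  proof (cases "u \<le> t")
    case True
    then show ?thesis using wlog[OF True] by linarith
  next
    case False
    then show ?thesis using wlog[of t u] by (simp add: power2_commute)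
  qed
qed

end

end

text \<open>Here the levels d n i + c n i s are such that the expected number of exceedances is
k n i - s sqrt (k n i), up to an error of smaller order than sqrt (k n i). Only through this do the
margins and the normalizing constants affect the limit law.\<close>

locale exceedance_levels = prob_space M for M :: "'a measure" +
  fixes X :: "nat \<Rightarrow> 'a \<Rightarrow> real ^ 'd" and F :: "real ^ 'd \<Rightarrow> real"
    and k :: "nat \<Rightarrow> 'd \<Rightarrow> nat" and c d :: "nat \<Rightarrow> 'd \<Rightarrow> real"
    and \<kappa> :: "'d \<Rightarrow> 'd \<Rightarrow> real"
  assumes indep: "indep_vars (\<lambda>_. borel) X {1..}"
    and dist: "\<And>j. 1 \<le> j \<Longrightarrow> has_dist_fun M (X j) F"
    and k: "\<And>n i. 1 \<le> n \<Longrightarrow> k n i \<in> {1..n}"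
    and k_top: "\<And>i. filterlim (\<lambda>n. real (k n i)) at_top sequentially"
    and k_small: "\<And>i. (\<lambda>n. real (k n i) / real n) \<longlonglongrightarrow> 0"
    and k_ratio: "\<And>i j. (\<lambda>n. real (k n i) / real (k n j)) \<longlonglongrightarrow> (\<kappa> i j)\<^sup>2" and \<kappa>_pos: "\<And>i j. 0 < \<kappa> i j"
    and c_pos: "\<And>n i. 0 < c n i"
    and level: "\<And>i s. (\<lambda>n. (real n * (1 - margin F i (d n i + c n i * s)) - real (k n i)) / sqrt (real (k n i))) \<longlonglongrightarrow> - s"
begin

text \<open>An order statistic is at most a level if and only if few observations exceed that level. After
normalization, this says that the number of exceedances of the level with parameter s, centered and
divided by sqrt k, stays below a threshold that tends to s.\<close>

definition count_dev :: "nat \<Rightarrow> 'd \<Rightarrow> real \<Rightarrow> 'a \<Rightarrow> real" where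
  "count_dev n i s \<omega> = (\<Sum>j\<in>{1..n}. exceed_dev F (X j) i (d n i + c n i * s) \<omega> / sqrt (real (k n i)))"

definition threshold :: "nat \<Rightarrow> 'd \<Rightarrow> real \<Rightarrow> real" where
  "threshold n i s = (real (k n i) - real n * (1 - margin F i (d n i + c n i * s))) / sqrt (real (k n i))"

definition scaled_order_stat :: "nat \<Rightarrow> 'd \<Rightarrow> 'a \<Rightarrow> real" where
  "scaled_order_stat n i \<omega> = (order_stat n (n - k n i + 1) (\<lambda>j. X j \<omega> $ i) - d n i) / c n i"

lemma threshold_tendsto: "(\<lambda>n. threshold n i s) \<longlonglongrightarrow> s"
proof -
  have "(\<lambda>n. - ((real n * (1 - margin F i (d n i + c n i * s)) - real (k n i)) / sqrt (real (k n i)))) \<longlonglongrightarrow> - (- s)"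
    by (intro tendsto_minus level)
  then show ?thesis unfolding threshold_def by (simp add: minus_divide_left)
qed

lemma k_pos: "1 \<le> n \<Longrightarrow> 0 < real (k n i)"
  using k[of n i] by simp

lemma inverse_sqrt_k: "(\<lambda>n. 1 / sqrt (real (k n i))) \<longlonglongrightarrow> 0"
  by (intro tendsto_divide_0[OF tendsto_const] filterlim_at_top_imp_at_infinity
      filterlim_compose[OF sqrt_at_top k_top])

lemma tail_prob_over_k: "(\<lambda>n. real n * (1 - margin F i (d n i)) / real (k n i)) \<longlonglongrightarrow> 1"
proof -
  have "(\<lambda>n. 1 - threshold n i 0 * (1 / sqrt (real (k n i)))) \<longlonglongrightarrow> 1 - 0 * 0"
    by (intro tendsto_intros threshold_tendsto inverse_sqrt_k)
  moreover have "\<forall>\<^sub>F n in sequentially. 1 - threshold n i 0 * (1 / sqrt (real (k n i))) = real n * (1 - margin F i (d n i)) / real (k n i)"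
    using eventually_ge_at_top[of 1]
  proof eventually_elim
    case (elim n)
    then show ?case using k_pos[OF elim, of i]
      by (simp add: threshold_def diff_divide_distrib)
  qed
  ultimately show ?thesis using Lim_transform_eventually by fastforce
qed

lemma X_comp_measurable: "1 \<le> j \<Longrightarrow> (\<lambda>\<omega>. X j \<omega> $ i) \<in> borel_measurable M"
  using has_dist_fun_borel_measurable[OF dist] .

lemma dev_measurable: "1 \<le> j \<Longrightarrow> exceed_dev F (X j) i u \<in> borel_measurable M"
  using exceed_dev_measurable[OF dist] .

lemma count_dev_measurable: "count_dev n i s \<in> borel_measurable M"
  unfolding count_dev_def by (intro borel_measurable_sum borel_measurable_divide dev_measurable) auto

lemma scaled_order_stat_measurable: "scaled_order_stat n i \<in> borel_measurable M"
proof (cases "n = 0")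
  case True
  then show ?thesis by (simp add: scaled_order_stat_def[abs_def] order_stat_def)
next
  case False
  then have "(\<lambda>\<omega>. order_stat n (n - k n i + 1) (\<lambda>j. X j \<omega> $ i)) \<in> borel_measurable M"
    using k[of n i] by (intro borel_measurable_order_stat X_comp_measurable) auto
  then show ?thesis unfolding scaled_order_stat_def by measurable
qed

lemma scaled_order_stat_le_iff:
  assumes n: "1 \<le> n"
  shows "scaled_order_stat n i \<omega> \<le> s \<longleftrightarrow> count_dev n i s \<omega> < threshold n i s"
proof -
  let ?x = "d n i + c n i * s"
  have "scaled_order_stat n i \<omega> \<le> s \<longleftrightarrow> order_stat n (n - k n i + 1) (\<lambda>j. X j \<omega> $ i) \<le> ?x"
    unfolding scaled_order_stat_def using c_pos[of n i] by (simp add: pos_divide_le_eq algebra_simps)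
  also have "\<dots> \<longleftrightarrow> card {j \<in> {1..n}. ?x < X j \<omega> $ i} < k n i"
    using k[OF n, of i] by (intro upper_order_stat_le_iff) auto
  also have "\<dots> \<longleftrightarrow> real (card {j \<in> {1..n}. ?x < X j \<omega> $ i}) - real n * (1 - margin F i ?x) < real (k n i) - real n * (1 - margin F i ?x)"
    by simp
  also have "real (card {j \<in> {1..n}. ?x < X j \<omega> $ i}) - real n * (1 - margin F i ?x) = (\<Sum>j\<in>{1..n}. exceed_dev F (X j) i ?x \<omega>)"
    by (simp add: exceed_dev_def sum_subtractf sum.If_cases Int_def)
  also have "\<dots> < real (k n i) - real n * (1 - margin F i ?x) \<longleftrightarrow> count_dev n i s \<omega> < threshold n i s"
    unfolding count_dev_def threshold_def sum_divide_distrib[symmetric]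
    using k_pos[OF n, of i] by (simp add: divide_less_cancel)
  finally show ?thesis .
qed

lemma indep_functional:
  assumes "\<And>j. h j \<in> borel_measurable borel"
  shows "indep_vars (\<lambda>_. borel) (\<lambda>j \<omega>. h j (X j \<omega>)) {1..n}"
proof (rule indep_vars_compose2[where X = X])
  show "indep_vars (\<lambda>_. borel) X {1..n}" by (rule indep_vars_subset[OF indep]) auto
qed (rule assms)

lemma exceed_dev_functional: "(\<lambda>x. exceed_dev F (\<lambda>x. x) i u x) \<in> borel_measurable borel"
proof -
  have [measurable]: "(\<lambda>x :: real ^ 'd. x $ i) \<in> borel_measurable borel"
    by (intro borel_measurable_continuous_onI continuous_intros)
  show ?thesis unfolding exceed_dev_def by measurable
qed

lemma exceed_dev_eq_functional: "exceed_dev F (X j) i u \<omega> = exceed_dev F (\<lambda>x. x) i u (X j \<omega>)"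
  by (simp add: exceed_dev_def)

lemma expectation_count_dev_square:
  assumes n: "1 \<le> n"
  shows "expectation (\<lambda>\<omega>. (count_dev n i 0 \<omega>)\<^sup>2) \<le> real n * (1 - margin F i (d n i)) / real (k n i)"
proof -
  let ?K = "sqrt (real (k n i))"
  have K: "0 < ?K" using k_pos[OF n] by simp
  have "expectation (\<lambda>\<omega>. (\<Sum>j\<in>{1..n}. exceed_dev F (X j) i (d n i) \<omega> / ?K)\<^sup>2) 
      = (\<Sum>j\<in>{1..n}. expectation (\<lambda>\<omega>. (exceed_dev F (X j) i (d n i) \<omega> / ?K)\<^sup>2))"
  proof (rule expectation_square_sum_indep[where B = "1 / ?K"])
    show "indep_vars (\<lambda>_. borel) (\<lambda>j \<omega>. exceed_dev F (X j) i (d n i) \<omega> / ?K) {1..n}"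
      unfolding exceed_dev_eq_functional
      by (intro indep_functional borel_measurable_divide exceed_dev_functional borel_measurable_const)
  next
    fix j \<omega> assume "j \<in> {1..n}"
    then have "\<bar>exceed_dev F (X j) i (d n i) \<omega>\<bar> \<le> 1" using exceed_dev_bound[OF dist[of j]] by simp
    then show "\<bar>exceed_dev F (X j) i (d n i) \<omega> / ?K\<bar> \<le> 1 / ?K" using K by (simp add: divide_right_mono)
  next
    fix j assume "j \<in> {1..n}"
    then show "expectation (\<lambda>\<omega>. exceed_dev F (X j) i (d n i) \<omega> / ?K) = 0"
      using expectation_exceed_dev[OF dist[of j]] by simp
  qed simp
  also have "\<dots> \<le> (\<Sum>j\<in>{1..n}. (1 - margin F i (d n i)) / real (k n i))"
  proof (rule sum_mono)
    fix j assume "j \<in> {1..n}"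
    then show "expectation (\<lambda>\<omega>. (exceed_dev F (X j) i (d n i) \<omega> / ?K)\<^sup>2) \<le> (1 - margin F i (d n i)) / real (k n i)"
      using expectation_exceed_dev_square_le[OF dist[of j], of i "d n i"] k_pos[OF n, of i]
      by (simp add: power_divide divide_right_mono)
  qed
  finally show ?thesis by (simp add: count_dev_def)
qed

text \<open>Only observations between the two levels contribute. Their expected number is of order sqrt k, which
is small compared with the normalization k of the squared count.\<close>

lemma expectation_count_dev_diff_square:
  assumes n: "1 \<le> n"
  shows "expectation (\<lambda>\<omega>. (count_dev n i s \<omega> - count_dev n i 0 \<omega>)\<^sup>2)
    \<le> \<bar>threshold n i s - threshold n i 0\<bar> * (1 / sqrt (real (k n i)))"
proof -
  let ?K = "sqrt (real (k n i))" and ?x = "d n i + c n i * s"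
  let ?D = "\<lambda>j \<omega>. (exceed_dev F (X j) i ?x \<omega> - exceed_dev F (X j) i (d n i) \<omega>) / ?K"
  have K: "0 < ?K" using k_pos[OF n] by simp
  have "count_dev n i s \<omega> - count_dev n i 0 \<omega> = (\<Sum>j\<in>{1..n}. ?D j \<omega>)" for \<omega>
    by (simp add: count_dev_def sum_subtractf[symmetric] diff_divide_distrib)
  then have "expectation (\<lambda>\<omega>. (count_dev n i s \<omega> - count_dev n i 0 \<omega>)\<^sup>2) = expectation (\<lambda>\<omega>. (\<Sum>j\<in>{1..n}. ?D j \<omega>)\<^sup>2)"
    by simp
  also have "\<dots> = (\<Sum>j\<in>{1..n}. expectation (\<lambda>\<omega>. (?D j \<omega>)\<^sup>2))"
  proof (rule expectation_square_sum_indep[where B = "2 / ?K"])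
    show "indep_vars (\<lambda>_. borel) ?D {1..n}"
      unfolding exceed_dev_eq_functional
      by (intro indep_functional borel_measurable_divide borel_measurable_diff exceed_dev_functional borel_measurable_const)
  next
    fix j \<omega> assume "j \<in> {1..n}"
    then have "\<bar>exceed_dev F (X j) i ?x \<omega>\<bar> \<le> 1" "\<bar>exceed_dev F (X j) i (d n i) \<omega>\<bar> \<le> 1"
      using exceed_dev_bound[OF dist[of j]] by simp_all
    then have "\<bar>exceed_dev F (X j) i ?x \<omega> - exceed_dev F (X j) i (d n i) \<omega>\<bar> \<le> 2" by linarith
    then show "\<bar>?D j \<omega>\<bar> \<le> 2 / ?K" using K by (simp add: divide_right_mono)
  next
    fix j assume j: "j \<in> {1..n}"
    have int: "integrable M (exceed_dev F (X j) i u)" for u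
      by (rule integrable_const_bound[where B = 1]) (use j exceed_dev_bound[OF dist[of j]] dev_measurable[of j] in auto)
    show "expectation (?D j) = 0"
      using expectation_exceed_dev[OF dist[of j]] j int by simp
  qed simp
  also have "\<dots> \<le> (\<Sum>j\<in>{1..n}. \<bar>margin F i ?x - margin F i (d n i)\<bar> / real (k n i))"
  proof (rule sum_mono)
    fix j assume "j \<in> {1..n}"
    then show "expectation (\<lambda>\<omega>. (?D j \<omega>)\<^sup>2) \<le> \<bar>margin F i ?x - margin F i (d n i)\<bar> / real (k n i)"
      using expectation_exceed_dev_diff_square_le[OF dist[of j], of i ?x "d n i"] k_pos[OF n, of i]
      by (simp add: power_divide divide_right_mono)
  qed
  also have "\<dots> = real n * \<bar>margin F i ?x - margin F i (d n i)\<bar> / real (k n i)" by simp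
  also have "\<dots> = \<bar>threshold n i s - threshold n i 0\<bar> * (1 / ?K)"
  proof -
    have "threshold n i s - threshold n i 0 = real n * (margin F i ?x - margin F i (d n i)) / ?K"
      using K by (simp add: threshold_def diff_divide_distrib[symmetric] algebra_simps)
    then have "\<bar>threshold n i s - threshold n i 0\<bar> = real n * \<bar>margin F i ?x - margin F i (d n i)\<bar> / ?K"
      using K by (simp add: abs_mult)
    moreover have "real (k n i) = ?K * ?K" by simp
    ultimately show ?thesis by (simp only: divide_divide_eq_left mult_1_right times_divide_eq_right)
  qed
  finally show ?thesis .
qed

lemma count_dev_square_integrable:
  "integrable M (\<lambda>\<omega>. (count_dev n i s \<omega>)\<^sup>2)" 
  "integrable M (\<lambda>\<omega>. (count_dev n i s \<omega> - count_dev n i 0 \<omega>)\<^sup>2)"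
proof -
  define B where "B = real n * (1 / sqrt (real (k n i)))"
  have bound: "\<bar>count_dev n i s \<omega>\<bar> \<le> B" for s \<omega>
  proof -
    have "\<bar>count_dev n i s \<omega>\<bar> \<le> (\<Sum>j\<in>{1..n}. \<bar>exceed_dev F (X j) i (d n i + c n i * s) \<omega> / sqrt (real (k n i))\<bar>)"
      unfolding count_dev_def by (rule sum_abs)
    also have "\<dots> \<le> (\<Sum>j\<in>{1..n}. 1 / sqrt (real (k n i)))"
      using exceed_dev_bound[OF dist] by (intro sum_mono) (simp add: divide_right_mono)
    finally show ?thesis by (simp add: B_def)
  qed
  have diff: "\<bar>count_dev n i s \<omega> - count_dev n i 0 \<omega>\<bar> \<le> 2 * B" for \<omega>
    using bound[of s \<omega>] bound[of 0 \<omega>] by linarith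
  show "integrable M (\<lambda>\<omega>. (count_dev n i s \<omega>)\<^sup>2)"
    by (rule integrable_const_bound[where B = "B\<^sup>2"])
       (use power_mono[OF bound abs_ge_zero, of _ _ 2] count_dev_measurable in auto)
  show "integrable M (\<lambda>\<omega>. (count_dev n i s \<omega> - count_dev n i 0 \<omega>)\<^sup>2)"
    by (rule integrable_const_bound[where B = "(2 * B)\<^sup>2"])
       (use power_mono[OF diff abs_ge_zero, of _ 2] count_dev_measurable in auto)
qed

lemma count_dev_bounded_variance:
  "\<forall>\<^sub>F n in sequentially. expectation (\<lambda>\<omega>. (count_dev n i 0 \<omega>)\<^sup>2) \<le> 2"
proof -
  have "\<forall>\<^sub>F n in sequentially. real n * (1 - margin F i (d n i)) / real (k n i) < 2"
    using order_tendstoD(2)[OF tail_prob_over_k, of 2] by simp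
  then show ?thesis
    using eventually_ge_at_top[of 1]
  proof eventually_elim
    case (elim n)
    then show ?case using expectation_count_dev_square[of n i] by linarith
  qed
qed

lemma count_dev_diff_tendsto_0:
  assumes e: "0 < e"
  shows "(\<lambda>n. prob {\<omega> \<in> space M. e < \<bar>count_dev n i s \<omega> - count_dev n i 0 \<omega>\<bar>}) \<longlonglongrightarrow> 0"
proof (rule Lim_null_comparison)
  show "\<forall>\<^sub>F n in sequentially. norm (prob {\<omega> \<in> space M. e < \<bar>count_dev n i s \<omega> - count_dev n i 0 \<omega>\<bar>})
      \<le> \<bar>threshold n i s - threshold n i 0\<bar> * (1 / sqrt (real (k n i))) / e\<^sup>2"
    using eventually_ge_at_top[of 1]
  proof eventually_elim
    case (elim n)
    have "prob {\<omega> \<in> space M. e < \<bar>count_dev n i s \<omega> - count_dev n i 0 \<omega>\<bar>}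
        \<le> expectation (\<lambda>\<omega>. (count_dev n i s \<omega> - count_dev n i 0 \<omega>)\<^sup>2) / e\<^sup>2"
      by (intro prob_abs_gt_le borel_measurable_diff count_dev_measurable count_dev_square_integrable e)
    also have "\<dots> \<le> \<bar>threshold n i s - threshold n i 0\<bar> * (1 / sqrt (real (k n i))) / e\<^sup>2"
      by (intro divide_right_mono expectation_count_dev_diff_square elim) simp
    finally show ?case by simp
  qed
  have "(\<lambda>n. \<bar>threshold n i s - threshold n i 0\<bar> * (1 / sqrt (real (k n i))) / e\<^sup>2) \<longlonglongrightarrow> \<bar>s - 0\<bar> * 0 / e\<^sup>2"
    using e by (intro tendsto_intros threshold_tendsto inverse_sqrt_k) auto
  then show "(\<lambda>n. \<bar>threshold n i s - threshold n i 0\<bar> * (1 / sqrt (real (k n i))) / e\<^sup>2) \<longlonglongrightarrow> 0" by simp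
qed

text \<open>A Bahadur representation: the order statistic is, up to an error that vanishes in probability, the
normalized number of exceedances of one fixed level. For each s the event that the order statistic
is at most s is described by the exceedances of the level with parameter s, and these may be
replaced by the exceedances of the level with parameter 0.\<close>

lemma scaled_order_stat_near_count_dev:
  assumes e: "0 < e"
  shows "(\<lambda>n. prob {\<omega> \<in> space M. e < \<bar>scaled_order_stat n i \<omega> - count_dev n i 0 \<omega>\<bar>}) \<longlonglongrightarrow> 0"
proof (rule diff_tendsto_0_in_prob[where Y = "\<lambda>n. scaled_order_stat n i" and W = "\<lambda>n. count_dev n i 0"])
  fix e :: real assume "0 < e"
  with count_dev_measurable count_dev_square_integrable(1) count_dev_bounded_variance
  show "\<exists>R. \<forall>\<^sub>F n in sequentially. prob {\<omega> \<in> space M. R < \<bar>count_dev n i 0 \<omega>\<bar>} < e"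
    by (rule tight_if_second_moment_bounded[where Z = "\<lambda>n. count_dev n i 0"])
next
  fix s e :: real assume e: "0 < e"
  note [measurable] = count_dev_measurable scaled_order_stat_measurable
  have lower: "\<forall>\<^sub>F n in sequentially. s - e / 2 < threshold n i s"
  proof -
    have "s - e / 2 < s" using e by simp
    with threshold_tendsto[of i s] show ?thesis by (rule order_tendstoD(1))
  qed
  show "(\<lambda>n. prob {\<omega> \<in> space M. count_dev n i 0 \<omega> < s - e \<and> s < scaled_order_stat n i \<omega>}) \<longlonglongrightarrow> 0"
  proof (rule Lim_null_comparison[OF _ count_dev_diff_tendsto_0[of "e / 2" i s]])
    show "\<forall>\<^sub>F n in sequentially. norm (prob {\<omega> \<in> space M. count_dev n i 0 \<omega> < s - e \<and> s < scaled_order_stat n i \<omega>})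
        \<le> prob {\<omega> \<in> space M. e / 2 < \<bar>count_dev n i s \<omega> - count_dev n i 0 \<omega>\<bar>}"
      using lower eventually_ge_at_top[of 1]
    proof eventually_elim
      case (elim n)
      have "prob {\<omega> \<in> space M. count_dev n i 0 \<omega> < s - e \<and> s < scaled_order_stat n i \<omega>}
          \<le> prob {\<omega> \<in> space M. e / 2 < \<bar>count_dev n i s \<omega> - count_dev n i 0 \<omega>\<bar>}"
      proof (rule finite_measure_mono)
        show "{\<omega> \<in> space M. count_dev n i 0 \<omega> < s - e \<and> s < scaled_order_stat n i \<omega>}
            \<subseteq> {\<omega> \<in> space M. e / 2 < \<bar>count_dev n i s \<omega> - count_dev n i 0 \<omega>\<bar>}"
        proof safe
          fix \<omega> assume "\<omega> \<in> space M" "count_dev n i 0 \<omega> < s - e" "s < scaled_order_stat n i \<omega>"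
          then show "e / 2 < \<bar>count_dev n i s \<omega> - count_dev n i 0 \<omega>\<bar>"
            using scaled_order_stat_le_iff[OF elim(2), of i \<omega> s] elim(1) by linarith
        qed
      qed measurable
      then show ?case by simp
    qed
  qed (use e in simp)
  have upper: "\<forall>\<^sub>F n in sequentially. threshold n i s < s + e / 2"
  proof -
    have "s < s + e / 2" using e by simp
    with threshold_tendsto[of i s] show ?thesis by (rule order_tendstoD(2))
  qed
  show "(\<lambda>n. prob {\<omega> \<in> space M. s + e < count_dev n i 0 \<omega> \<and> scaled_order_stat n i \<omega> \<le> s}) \<longlonglongrightarrow> 0"
  proof (rule Lim_null_comparison[OF _ count_dev_diff_tendsto_0[of "e / 2" i s]])
    show "\<forall>\<^sub>F n in sequentially. norm (prob {\<omega> \<in> space M. s + e < count_dev n i 0 \<omega> \<and> scaled_order_stat n i \<omega> \<le> s})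
        \<le> prob {\<omega> \<in> space M. e / 2 < \<bar>count_dev n i s \<omega> - count_dev n i 0 \<omega>\<bar>}"
      using upper eventually_ge_at_top[of 1]
    proof eventually_elim
      case (elim n)
      have "prob {\<omega> \<in> space M. s + e < count_dev n i 0 \<omega> \<and> scaled_order_stat n i \<omega> \<le> s}
          \<le> prob {\<omega> \<in> space M. e / 2 < \<bar>count_dev n i s \<omega> - count_dev n i 0 \<omega>\<bar>}"
      proof (rule finite_measure_mono)
        show "{\<omega> \<in> space M. s + e < count_dev n i 0 \<omega> \<and> scaled_order_stat n i \<omega> \<le> s}
            \<subseteq> {\<omega> \<in> space M. e / 2 < \<bar>count_dev n i s \<omega> - count_dev n i 0 \<omega>\<bar>}"
        proof safe
          fix \<omega> assume "\<omega> \<in> space M" "s + e < count_dev n i 0 \<omega>" "scaled_order_stat n i \<omega> \<le> s"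
          then show "e / 2 < \<bar>count_dev n i s \<omega> - count_dev n i 0 \<omega>\<bar>"
            using scaled_order_stat_le_iff[OF elim(2), of i \<omega> s] elim(1) by linarith
        qed
      qed measurable
      then show ?case by simp
    qed
  qed (use e in simp)
qed (intro scaled_order_stat_measurable count_dev_measurable e)+

lemma tail_prob_tendsto_0: "(\<lambda>n. 1 - margin F i (d n i)) \<longlonglongrightarrow> 0"
proof -
  have "(\<lambda>n. real n * (1 - margin F i (d n i)) / real (k n i) * (real (k n i) / real n)) \<longlonglongrightarrow> 1 * 0"
    by (intro tendsto_mult tail_prob_over_k k_small)
  moreover have "\<forall>\<^sub>F n in sequentially. real n * (1 - margin F i (d n i)) / real (k n i) * (real (k n i) / real n) = 1 - margin F i (d n i)"
    using eventually_ge_at_top[of 1]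
  proof eventually_elim
    case (elim n)
    then show ?case using k_pos[OF elim, of i] by simp
  qed
  ultimately show ?thesis using Lim_transform_eventually by fastforce
qed

lemma tail_prob_weighted:
  "(\<lambda>n. real n / (sqrt (real (k n i)) * sqrt (real (k n l))) * (1 - margin F i (d n i))) \<longlonglongrightarrow> \<kappa> i l"
proof -
  have "(\<lambda>n. real n * (1 - margin F i (d n i)) / real (k n i) * sqrt (real (k n i) / real (k n l))) \<longlonglongrightarrow> 1 * sqrt ((\<kappa> i l)\<^sup>2)"
    by (intro tendsto_mult tail_prob_over_k tendsto_real_sqrt k_ratio)
  moreover have "\<forall>\<^sub>F n in sequentially. real n * (1 - margin F i (d n i)) / real (k n i) * sqrt (real (k n i) / real (k n l))
     = real n / (sqrt (real (k n i)) * sqrt (real (k n l))) * (1 - margin F i (d n i))"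
    using eventually_ge_at_top[of 1]
  proof eventually_elim
    case (elim n)
    have "r * q / (K * K) * (K / L) = r / (K * L) * q" if "0 < K" for r q K L :: real
      using that by (cases "L = 0") (simp_all add: field_simps)
    from this[of "sqrt (real (k n i))" "real n" "1 - margin F i (d n i)" "sqrt (real (k n l))"]
    show ?case using k_pos[OF elim, of i] by (simp add: real_sqrt_divide)
  qed
  moreover have "1 * sqrt ((\<kappa> i l)\<^sup>2) = \<kappa> i l" using \<kappa>_pos[of i l] by simp
  ultimately show ?thesis using Lim_transform_eventually by fastforce
qed

lemma tail_prob_pos: "\<forall>\<^sub>F n in sequentially. 0 < 1 - margin F i (d n i)"
  using order_tendstoD(1)[OF tail_prob_over_k[of i] zero_less_one] eventually_ge_at_top[of 1]
proof eventually_elim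
  case (elim n)
  then show ?case using k_pos[OF elim(2), of i] by (simp add: zero_less_divide_iff zero_less_mult_iff)
qed

end

text \<open>The joint behavior of the components enters only through the probabilities J n i l of simultaneous
exceedances of the levels with parameter 0.\<close>

locale exceedance_array = exceedance_levels M X F k c d \<kappa>
  for M :: "'a measure" and X and F :: "real ^ 'd \<Rightarrow> real" and k c d \<kappa> +
  fixes J :: "nat \<Rightarrow> 'd \<Rightarrow> 'd \<Rightarrow> real" and S :: "real ^ 'd ^ 'd"
  assumes joint: "\<And>n j i l. 1 \<le> j \<Longrightarrow> i \<noteq> l \<Longrightarrow> prob {\<omega> \<in> space M. d n i < X j \<omega> $ i \<and> d n l < X j \<omega> $ l} = J n i l"
    and J_lim: "\<And>i l. i \<noteq> l \<Longrightarrow> (\<lambda>n. real n * J n i l / (sqrt (real (k n i)) * sqrt (real (k n l)))) \<longlonglongrightarrow> S $ i $ l"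
    and S_diag: "\<And>i. S $ i $ i = 1"
begin

text \<open>The covariance of two centered exceedance indicators; on the diagonal, the simultaneous exceedance is
a single one.\<close>

definition dev_cov :: "nat \<Rightarrow> 'd \<Rightarrow> 'd \<Rightarrow> real" where
  "dev_cov n i l = (if i = l then 1 - margin F i (d n i) else J n i l) - (1 - margin F i (d n i)) * (1 - margin F l (d n l))"

lemma expectation_dev_mult:
  assumes j: "1 \<le> j"
  shows "expectation (\<lambda>\<omega>. exceed_dev F (X j) i (d n i) \<omega> * exceed_dev F (X j) l (d n l) \<omega>) = dev_cov n i l"
  unfolding expectation_exceed_dev_mult[OF dist[OF j]] dev_cov_def
  using joint[OF j, of i l n] exceed_prob[OF dist[OF j], of "d n i" i] by (cases "i = l") auto

lemma dev_cov_tendsto: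
  "(\<lambda>n. real n / (sqrt (real (k n i)) * sqrt (real (k n l))) * dev_cov n i l) \<longlonglongrightarrow> S $ i $ l"
proof -
  let ?w = "\<lambda>n. real n / (sqrt (real (k n i)) * sqrt (real (k n l)))"
  have main: "(\<lambda>n. ?w n * (if i = l then 1 - margin F i (d n i) else J n i l)) \<longlonglongrightarrow> S $ i $ l"
  proof (cases "i = l")
    case True
    have "\<forall>\<^sub>F n in sequentially. real n * (1 - margin F i (d n i)) / real (k n i) = ?w n * (1 - margin F i (d n i))"
      using True by (intro always_eventually) simp
    from Lim_transform_eventually[OF tail_prob_over_k this] show ?thesis using True S_diag by simp
  next
    case False
    then show ?thesis using J_lim[OF False] by simp
  qed
  have "(\<lambda>n. ?w n * (1 - margin F i (d n i)) * (1 - margin F l (d n l))) \<longlonglongrightarrow> \<kappa> i l * 0"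
    by (intro tendsto_mult tail_prob_weighted tail_prob_tendsto_0)
  from tendsto_diff[OF main this]
  have "(\<lambda>n. ?w n * (if i = l then 1 - margin F i (d n i) else J n i l)
      - ?w n * (1 - margin F i (d n i)) * (1 - margin F l (d n l))) \<longlonglongrightarrow> S $ i $ l" by simp
  moreover have "?w n * dev_cov n i l = ?w n * (if i = l then 1 - margin F i (d n i) else J n i l)
      - ?w n * (1 - margin F i (d n i)) * (1 - margin F l (d n l))" for n
    unfolding dev_cov_def mult.assoc by (rule right_diff_distrib)
  ultimately show ?thesis by (simp only:)
qed

text \<open>The contribution of the j-th observation to the projection of the vector of normalized counts to the
direction t.\<close>

definition row_summand :: "real ^ 'd \<Rightarrow> nat \<Rightarrow> nat \<Rightarrow> 'a \<Rightarrow> real" where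
  "row_summand t n j \<omega> = (\<Sum>i\<in>UNIV. t $ i / sqrt (real (k n i)) * exceed_dev F (X j) i (d n i) \<omega>)"

definition row_variance :: "real ^ 'd \<Rightarrow> nat \<Rightarrow> real" where
  "row_variance t n = (\<Sum>i\<in>UNIV. \<Sum>l\<in>UNIV. t $ i * t $ l / (sqrt (real (k n i)) * sqrt (real (k n l))) * dev_cov n i l)"

lemma row_variance_tendsto: "(\<lambda>n. real n * row_variance t n) \<longlonglongrightarrow> t \<bullet> (S *v t)"
proof -
  have "(\<lambda>n. \<Sum>i\<in>UNIV. \<Sum>l\<in>UNIV. t $ i * t $ l * (real n / (sqrt (real (k n i)) * sqrt (real (k n l))) * dev_cov n i l))
      \<longlonglongrightarrow> (\<Sum>i\<in>UNIV. \<Sum>l\<in>UNIV. t $ i * t $ l * S $ i $ l)"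
    by (intro tendsto_sum tendsto_mult tendsto_const dev_cov_tendsto)
  moreover have "real n * row_variance t n = (\<Sum>i\<in>UNIV. \<Sum>l\<in>UNIV.
      t $ i * t $ l * (real n / (sqrt (real (k n i)) * sqrt (real (k n l))) * dev_cov n i l))" for n
    unfolding row_variance_def sum_distrib_left by (intro sum.cong refl) simp
  moreover have "t \<bullet> (S *v t) = (\<Sum>i\<in>UNIV. \<Sum>l\<in>UNIV. t $ i * t $ l * S $ i $ l)"
    by (simp add: inner_vec_def matrix_vector_mult_def sum_distrib_left mult_ac)
  ultimately show ?thesis by simp
qed

lemma dev_mult_integrable:
  assumes j: "1 \<le> j"
  shows "integrable M (\<lambda>\<omega>. exceed_dev F (X j) i u \<omega> * exceed_dev F (X j) l v \<omega>)"
  by (rule integrable_const_bound[where B = 1])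
     (use exceed_dev_bound[OF dist[OF j]] dev_measurable[OF j] in \<open>auto simp: abs_mult intro!: mult_le_one\<close>)

lemma row_summand_variance:
  assumes j: "1 \<le> j"
  shows "expectation (\<lambda>\<omega>. (row_summand t n j \<omega>)\<^sup>2) = row_variance t n"
proof -
  have "(row_summand t n j \<omega>)\<^sup>2 = (\<Sum>i\<in>UNIV. \<Sum>l\<in>UNIV. t $ i * t $ l / (sqrt (real (k n i)) * sqrt (real (k n l))) *
      (exceed_dev F (X j) i (d n i) \<omega> * exceed_dev F (X j) l (d n l) \<omega>))" for \<omega>
    unfolding row_summand_def power2_eq_square sum_product by (simp add: mult_ac)
  then have "expectation (\<lambda>\<omega>. (row_summand t n j \<omega>)\<^sup>2) = (\<Sum>i\<in>UNIV. \<Sum>l\<in>UNIV. t $ i * t $ l / (sqrt (real (k n i)) * sqrt (real (k n l))) *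
      expectation (\<lambda>\<omega>. exceed_dev F (X j) i (d n i) \<omega> * exceed_dev F (X j) l (d n l) \<omega>))"
    using dev_mult_integrable[OF j] by (simp add: Bochner_Integration.integral_sum)
  then show ?thesis
    unfolding expectation_dev_mult[OF j] row_variance_def .
qed

text \<open>The matrix S is positive semidefinite as a limit of covariance matrices.\<close>

lemma quadratic_form_nonneg: "0 \<le> t \<bullet> (S *v t)"
proof (rule tendsto_lowerbound[OF row_variance_tendsto])
  show "\<forall>\<^sub>F n in sequentially. 0 \<le> real n * row_variance t n"
    by (intro always_eventually allI) (simp add: row_summand_variance[of 1, symmetric])
qed simp

lemma iexp_count_dev_tendsto:
  "(\<lambda>n. CLINT \<omega>|M. iexp (t \<bullet> (\<chi> i. count_dev n i 0 \<omega>))) \<longlonglongrightarrow> of_real (exp (- (t \<bullet> (S *v t)) / 2))"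
proof -
  have "t \<bullet> (\<chi> i. count_dev n i 0 \<omega>) = (\<Sum>j\<in>{1..n}. row_summand t n j \<omega>)" for n \<omega>
    unfolding inner_vec_def count_dev_def row_summand_def
    by (simp add: sum_distrib_left mult_ac) (rule sum.swap)
  moreover have "(\<lambda>n. CLINT \<omega>|M. iexp (\<Sum>j\<in>{1..n}. row_summand t n j \<omega>)) \<longlonglongrightarrow> of_real (exp (- (t \<bullet> (S *v t)) / 2))"
  proof (rule iexp_row_sum_tendsto[OF _ _ _ _ _ row_variance_tendsto])
    show "indep_vars (\<lambda>_. borel) (row_summand t n) {1..n}" for n
      unfolding row_summand_def exceed_dev_eq_functional
      by (intro indep_functional borel_measurable_sum borel_measurable_times exceed_dev_functional borel_measurable_const)
    define \<epsilon> where "\<epsilon> n = (\<Sum>i\<in>UNIV. \<bar>t $ i\<bar> * (1 / sqrt (real (k n i))))" for n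
    have "\<epsilon> \<longlonglongrightarrow> (\<Sum>i\<in>UNIV. \<bar>t $ i\<bar> * 0)"
      unfolding \<epsilon>_def by (intro tendsto_sum tendsto_mult tendsto_const inverse_sqrt_k)
    then show "\<epsilon> \<longlonglongrightarrow> 0" by simp
    show "\<forall>\<^sub>F n in sequentially. \<forall>j\<in>{1..n}. \<forall>\<omega>. \<bar>row_summand t n j \<omega>\<bar> \<le> \<epsilon> n"
    proof (intro always_eventually allI ballI)
      fix n j :: nat and \<omega> assume j: "j \<in> {1..n}"
      have "\<bar>row_summand t n j \<omega>\<bar> \<le> (\<Sum>i\<in>UNIV. \<bar>t $ i / sqrt (real (k n i)) * exceed_dev F (X j) i (d n i) \<omega>\<bar>)"
        unfolding row_summand_def by (rule sum_abs)
      also have "\<dots> \<le> \<epsilon> n"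
        unfolding \<epsilon>_def
      proof (rule sum_mono)
        fix i
        have "\<bar>exceed_dev F (X j) i (d n i) \<omega>\<bar> \<le> 1" using exceed_dev_bound[OF dist[of j]] j by simp
        then have "\<bar>t $ i / sqrt (real (k n i))\<bar> * \<bar>exceed_dev F (X j) i (d n i) \<omega>\<bar> \<le> \<bar>t $ i / sqrt (real (k n i))\<bar> * 1"
          by (intro mult_left_mono) auto
        then show "\<bar>t $ i / sqrt (real (k n i)) * exceed_dev F (X j) i (d n i) \<omega>\<bar> \<le> \<bar>t $ i\<bar> * (1 / sqrt (real (k n i)))"
          by (simp add: abs_mult)
      qed
      finally show "\<bar>row_summand t n j \<omega>\<bar> \<le> \<epsilon> n" .
    qed
  next
    fix n j :: nat assume j: "j \<in> {1..n}"
    have int: "integrable M (exceed_dev F (X j) i u)" for i u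
      by (rule integrable_const_bound[where B = 1]) (use j exceed_dev_bound[OF dist[of j]] dev_measurable[of j] in auto)
    show "expectation (row_summand t n j) = 0"
      unfolding row_summand_def using j int expectation_exceed_dev[OF dist[of j]]
      by (subst Bochner_Integration.integral_sum) auto
    show "expectation (\<lambda>\<omega>. (row_summand t n j \<omega>)\<^sup>2) = row_variance t n"
      using j by (intro row_summand_variance) simp
  qed
  ultimately show ?thesis by simp
qed

lemma scaled_order_stats_asymptotically_normal:
  assumes sym: "transpose S = S"
  shows "\<exists>\<mu>. mv_normal \<mu> 0 S \<and> conv_in_dist M (\<lambda>n \<omega>. \<chi> i. scaled_order_stat n i \<omega>) \<mu>"
proof -
  obtain \<mu> where \<mu>: "mv_normal \<mu> 0 S" using mv_normal_exists[OF sym quadratic_form_nonneg] by blast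
  note [measurable] = count_dev_measurable scaled_order_stat_measurable borel_measurable_vec_lambda
  have "conv_in_dist M (\<lambda>n \<omega>. \<chi> i. scaled_order_stat n i \<omega>) \<mu>"
  proof (rule conv_in_dist_if_iexp_tendsto[where W = "\<lambda>n \<omega>. \<chi> i. count_dev n i 0 \<omega>"])
    show "prob_space \<mu>" "sets \<mu> = sets borel" using \<mu> by (auto simp: mv_normal_def)
    show "(\<lambda>n. CLINT \<omega>|M. iexp (t \<bullet> (\<chi> i. count_dev n i 0 \<omega>))) \<longlonglongrightarrow> (CLINT x|\<mu>. iexp (t \<bullet> x))" for t
      unfolding iexp_integral_mv_normal[OF \<mu>] by (rule iexp_count_dev_tendsto)
  next
    fix e :: real assume e: "0 < e"
    define V where "V n \<omega> = norm (\<chi> i. count_dev n i 0 \<omega>)" for n \<omega>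
    have V2: "(V n \<omega>)\<^sup>2 = (\<Sum>i\<in>UNIV. (count_dev n i 0 \<omega>)\<^sup>2)" for n \<omega>
      by (simp add: V_def norm_vec_def L2_set_def sum_nonneg)
    have "\<forall>\<^sub>F n in sequentially. \<forall>i. expectation (\<lambda>\<omega>. (count_dev n i 0 \<omega>)\<^sup>2) \<le> 2"
      by (intro eventually_all_finite count_dev_bounded_variance)
    then have "\<forall>\<^sub>F n in sequentially. expectation (\<lambda>\<omega>. (V n \<omega>)\<^sup>2) \<le> 2 * CARD('d)"
    proof eventually_elim
      case (elim n)
      have "expectation (\<lambda>\<omega>. (V n \<omega>)\<^sup>2) = (\<Sum>i\<in>UNIV. expectation (\<lambda>\<omega>. (count_dev n i 0 \<omega>)\<^sup>2))"
        unfolding V2 by (rule Bochner_Integration.integral_sum) (rule count_dev_square_integrable)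
      also have "\<dots> \<le> (\<Sum>i\<in>(UNIV :: 'd set). 2)" using elim by (intro sum_mono) auto
      finally show ?case by simp
    qed
    then have "\<exists>R. \<forall>\<^sub>F n in sequentially. prob {\<omega> \<in> space M. R < \<bar>V n \<omega>\<bar>} < e"
    proof (intro tight_if_second_moment_bounded e)
      show "V n \<in> borel_measurable M" for n
        unfolding V_def
        by (intro measurable_compose[OF borel_measurable_vec_lambda borel_measurable_norm] count_dev_measurable)
      show "integrable M (\<lambda>\<omega>. (V n \<omega>)\<^sup>2)" for n
        unfolding V2 by (intro Bochner_Integration.integrable_sum count_dev_square_integrable)
    qed
    then show "\<exists>R. \<forall>\<^sub>F n in sequentially. prob {\<omega> \<in> space M. R < norm (\<chi> i. count_dev n i 0 \<omega>)} < e"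
      by (simp add: V_def)
  next
    fix e :: real assume e: "0 < e"
    \<comment> \<open>The Euclidean norm is at most the sum of the absolute values of the components.\<close>
    define h where "h = e / CARD('d)"
    have h: "0 < h" using e by (simp add: h_def)
    let ?A = "\<lambda>n i. {\<omega> \<in> space M. h < \<bar>scaled_order_stat n i \<omega> - count_dev n i 0 \<omega>\<bar>}"
    show "(\<lambda>n. prob {\<omega> \<in> space M. e < norm ((\<chi> i. scaled_order_stat n i \<omega>) - (\<chi> i. count_dev n i 0 \<omega>))}) \<longlonglongrightarrow> 0"
    proof (rule Lim_null_comparison)
      have "(\<lambda>n. \<Sum>i\<in>UNIV. prob (?A n i)) \<longlonglongrightarrow> (\<Sum>i\<in>(UNIV :: 'd set). 0)"
        by (intro tendsto_sum scaled_order_stat_near_count_dev h)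
      then show "(\<lambda>n. \<Sum>i\<in>UNIV. prob (?A n i)) \<longlonglongrightarrow> 0" by simp
      show "\<forall>\<^sub>F n in sequentially. norm (prob {\<omega> \<in> space M. e < norm ((\<chi> i. scaled_order_stat n i \<omega>) - (\<chi> i. count_dev n i 0 \<omega>))})
          \<le> (\<Sum>i\<in>UNIV. prob (?A n i))"
      proof (intro always_eventually allI)
        fix n
        have meas: "?A n i \<in> events" for i by measurable
        have "{\<omega> \<in> space M. e < norm ((\<chi> i. scaled_order_stat n i \<omega>) - (\<chi> i. count_dev n i 0 \<omega>))} \<subseteq> (\<Union>i\<in>UNIV. ?A n i)"
        proof
          fix \<omega> assume "\<omega> \<in> {\<omega> \<in> space M. e < norm ((\<chi> i. scaled_order_stat n i \<omega>) - (\<chi> i. count_dev n i 0 \<omega>))}"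
          then have \<omega>: "\<omega> \<in> space M" and far: "e < norm ((\<chi> i. scaled_order_stat n i \<omega>) - (\<chi> i. count_dev n i 0 \<omega>))" by auto
          note far
          also have "\<dots> \<le> (\<Sum>i\<in>UNIV. \<bar>scaled_order_stat n i \<omega> - count_dev n i 0 \<omega>\<bar>)"
            using norm_le_l1_cart[of "(\<chi> i. scaled_order_stat n i \<omega>) - (\<chi> i. count_dev n i 0 \<omega>)"] by simp
          finally have gt: "e < (\<Sum>i\<in>UNIV. \<bar>scaled_order_stat n i \<omega> - count_dev n i 0 \<omega>\<bar>)" .
          have "\<not> (\<forall>i. \<bar>scaled_order_stat n i \<omega> - count_dev n i 0 \<omega>\<bar> \<le> h)"
          proof
            assume "\<forall>i. \<bar>scaled_order_stat n i \<omega> - count_dev n i 0 \<omega>\<bar> \<le> h"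
            then have "(\<Sum>i\<in>UNIV. \<bar>scaled_order_stat n i \<omega> - count_dev n i 0 \<omega>\<bar>) \<le> (\<Sum>i\<in>(UNIV :: 'd set). h)"
              by (intro sum_mono) auto
            also have "\<dots> = e" by (simp add: h_def)
            finally show False using gt by simp
          qed
          then show "\<omega> \<in> (\<Union>i\<in>UNIV. ?A n i)" using \<omega> by (auto simp: not_le)
        qed
        then have "prob {\<omega> \<in> space M. e < norm ((\<chi> i. scaled_order_stat n i \<omega>) - (\<chi> i. count_dev n i 0 \<omega>))} \<le> prob (\<Union>i\<in>UNIV. ?A n i)"
          using meas by (intro finite_measure_mono) auto
        also have "\<dots> \<le> (\<Sum>i\<in>UNIV. prob (?A n i))"
          using meas by (intro measure_UNION_le) auto
        finally show "norm (prob {\<omega> \<in> space M. e < norm ((\<chi> i. scaled_order_stat n i \<omega>) - (\<chi> i. count_dev n i 0 \<omega>))})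
          \<le> (\<Sum>i\<in>UNIV. prob (?A n i))" by simp
      qed
    qed
  qed measurable
  with \<mu> show ?thesis by blast
qed

end

theorem proposition3p1:
  fixes F C Dn N :: "real ^ 'd \<Rightarrow> real"
    and f :: "'d \<Rightarrow> real \<Rightarrow> real"
    and M :: "'a measure"
    and X :: "nat \<Rightarrow> 'a \<Rightarrow> real ^ 'd"
    and k :: "nat \<Rightarrow> 'd \<Rightarrow> nat"
    and \<kappa> :: "'d \<Rightarrow> 'd \<Rightarrow> real"
    and a b c d :: "nat \<Rightarrow> 'd \<Rightarrow> real"
    and S :: "real ^ 'd ^ 'd"
  assumes "dist_fun F"
    and "copula C"
    and "\<And>x. F x = C (\<chi> i. margin F i (x $ i))"
    and "is_norm N"
    and "D_norm Dn"
    and "(\<lambda>u. C u - (1 - Dn (1 - u))) \<in> o[at 1 within {u. \<forall>i. 0 \<le> u $ i \<and> u $ i \<le> 1}](\<lambda>u. N (1 - u))"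
    and "\<And>i. \<exists>x0. ereal x0 < right_endpoint (margin F i) \<and>
           (\<forall>x. x0 < x \<and> ereal x < right_endpoint (margin F i) \<longrightarrow>
              (margin F i has_real_derivative f i x) (at x) \<and> 0 < f i x)"
    and "\<And>i. von_mises_1 (margin F i) (f i) \<or> von_mises_2 (margin F i) (f i) \<or>
           von_mises_3 (margin F i) (f i)"
    and "prob_space M"
    and "prob_space.indep_vars M (\<lambda>_. borel) X {1..}"
    and "\<And>j. 1 \<le> j \<Longrightarrow> has_dist_fun M (X j) F"
    and "\<And>n i. 1 \<le> n \<Longrightarrow> k n i \<in> {1..n}"
    and "\<And>i j. 0 < \<kappa> i j"
    and "\<And>i j. (\<lambda>n. real (k n i) / real (k n j)) \<longlonglongrightarrow> (\<kappa> i j)\<^sup>2"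
    and "filterlim (\<lambda>n. N (\<chi> i. real (k n i))) at_top sequentially"
    and "(\<lambda>n. N (\<chi> i. real (k n i)) / real n) \<longlonglongrightarrow> 0"
    and "\<And>n i. b n i = gen_inv (margin F i) (1 - real (k n i) / real n)"
    and "\<And>n i. a n i = sqrt (real (k n i)) / (real n * f i (b n i))"
    and "\<And>n i. 0 < c n i"
    and "\<And>i. (\<lambda>n. c n i / a n i) \<longlonglongrightarrow> 1"
    and "\<And>i. (\<lambda>n. (d n i - b n i) / a n i) \<longlonglongrightarrow> 0"
    and "S = (\<chi> i j. if i = j then 1
                else \<kappa> i j + \<kappa> j i - Dn (\<kappa> i j *\<^sub>R axis i 1 + \<kappa> j i *\<^sub>R axis j 1))"
  shows "\<exists>\<mu>. mv_normal \<mu> 0 S \<and>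
           conv_in_dist M
             (\<lambda>n \<omega>. \<chi> i. (order_stat n (n - k n i + 1) (\<lambda>j. X j \<omega> $ i) - d n i) / c n i) \<mu>"
proof -
  note F_dist = assms(11) and C = assms(2,3) and N = assms(4)
  have Dn: "is_norm Dn" using assms(5) by (simp add: D_norm_def)
  interpret prob_space M by fact
  have \<kappa>2: "0 < (\<kappa> i j)\<^sup>2" for i j using assms(13)[of i j] by simp
  note k_props = intermediate_sequence_components[OF N assms(12) assms(14) \<kappa>2 assms(15,16)]
  have level: "(\<lambda>n. (real n * (1 - margin F i (d n i + c n i * s)) - real (k n i)) / sqrt (real (k n i))) \<longlonglongrightarrow> - s" for i s
  proof -
    obtain x0 where x0: "ereal x0 < right_endpoint (margin F i)"
      "\<And>x. x0 < x \<Longrightarrow> ereal x < right_endpoint (margin F i) \<Longrightarrow> (margin F i has_real_derivative f i x) (at x) \<and> 0 < f i x"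
      using assms(7)[of i] by blast
    interpret T: smooth_tail "margin F i" "f i" "right_endpoint (margin F i)" x0
      by unfold_locales (use x0 margin_mono_and_lim[OF F_dist[OF order_refl]] in auto)
    obtain A where "T.tail_scale A"
      using assms(8)[of i] T.tail_scale_von_mises_1 T.tail_scale_von_mises_2 T.tail_scale_von_mises_3 by blast
    from T.exceedance_expansion[OF this k_props assms(17,18,20,21)] show ?thesis .
  qed
  interpret L: exceedance_levels M X F k c d \<kappa>
    by unfold_locales (use assms(10-14,19) k_props level in auto)
  define p where "p i n = 1 - margin F i (d n i)" for i n
  define J where "J n i l = p i n + p l n - (1 - C (1 - (p i n *\<^sub>R axis i 1 + p l n *\<^sub>R axis l 1)))" for n i l
  interpret A: exceedance_array M X F k c d \<kappa> J S
  proof unfold_locales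
    show "prob {\<omega> \<in> space M. d n i < X j \<omega> $ i \<and> d n l < X j \<omega> $ l} = J n i l" if "1 \<le> j" "i \<noteq> l" for n j i l
      unfolding J_def p_def by (rule joint_exceedance[OF F_dist[OF that(1)] C that(2)])
    show "S $ i $ i = 1" for i by (simp add: assms(22))
    show "(\<lambda>n. real n * J n i l / (sqrt (real (k n i)) * sqrt (real (k n l)))) \<longlonglongrightarrow> S $ i $ l" if il: "i \<noteq> l" for i l
    proof -
      let ?w = "\<lambda>n. real n / (sqrt (real (k n i)) * sqrt (real (k n l)))"
      have "(\<lambda>n. ?w n * J n i l) \<longlonglongrightarrow> \<kappa> i l + \<kappa> l i - Dn (\<kappa> i l *\<^sub>R axis i 1 + \<kappa> l i *\<^sub>R axis l 1)"
        unfolding J_def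
      proof (rule copula_expansion_tendsto[OF N Dn assms(6) il])
        show "p i \<longlonglongrightarrow> 0" "p l \<longlonglongrightarrow> 0" unfolding p_def by (rule L.tail_prob_tendsto_0)+
        show "\<forall>\<^sub>F n in sequentially. 0 < p i n" "\<forall>\<^sub>F n in sequentially. 0 < p l n"
          unfolding p_def by (rule L.tail_prob_pos)+
        show "(\<lambda>n. ?w n * p i n) \<longlonglongrightarrow> \<kappa> i l" unfolding p_def by (rule L.tail_prob_weighted)
        show "(\<lambda>n. ?w n * p l n) \<longlonglongrightarrow> \<kappa> l i"
          unfolding p_def using L.tail_prob_weighted[of l i] by (simp add: mult.commute)
      qed simp
      then show ?thesis using il by (simp add: assms(22))
    qed
  qed
  have "transpose S = S"
    unfolding assms(22) transpose_def by (auto simp: vec_eq_iff add.commute)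
  from A.scaled_order_stats_asymptotically_normal[OF this] show ?thesis
    unfolding L.scaled_order_stat_def .
qed

end
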